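(* Let $h=h_2\circ h_1^\star$ be a mixed tabulation hash function and let $X\subseteq[u]$ be any input set. Let $p_1,\dots,p_b$ be any $b$ bit positions of the output, $v_1,\dots,v_b\in\{0,1\}$ desired bit values, and let $Y$ be the set of keys $x\in X$ with $h(x)_{p_i}=v_i$ for all $i$. Let $\varepsilon>0$ be a constant. If $\mathbb E[|Y|]=|X|\cdot2^{-b}\le|\Sigma|/(1+\varepsilon)$, then with probability $1-O(|\Sigma|^{1-\lfloor d/2\rfloor})$ the remaining bits (the output bits other than $p_1,\dots,p_b$) of the hash values of the keys in $Y$ are completely independent.
   Context: Simple tabulation: fix an integer $c\ge1$ and an alphabet $\Sigma$ whose size is a power of two. A key $x\in[u]$ is viewed as a vector $(x_0,\dots,x_{c-1})$ of $c$ characters in $\Sigma$. A simple tabulation function $g:\Sigma^c\to\mathcal R$ ($\mathcal R=[2^r]$ bit strings, or $\Sigma^d$) is given by $c$ independent fully random tables $T_i:\Sigma\to\mathcal R$ with $g(x)=T_0[x_0]\oplus\cdots\oplus T_{c-1}[x_{c-1}]$ (bitwise XOR). Mixed tabulation with parameters $c,d$: independent simple tabulation functions $h_1:\Sigma^c\to\Sigma^d$ and $h_2:\Sigma^{c+d}\to\mathcal R$, derived key $h_1^\star(x)=x\cdot h_1(x)$ (concatenation), $h(x)=h_2(h_1^\star(x))$. Standing assumptions: $c,d=O(1)$, $u^{1/c}\le|\Sigma|\le u^{1/(c-1)}$; constants in $O(\cdot)$ may depend on $c,d,\varepsilon$. *)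

theory Defs
  imports "HOL-Probability.Probability"
begin

unbundle bit_operations_syntax

text \<open>
  The alphabet is the set of \<open>s\<close>-bit strings, represented as \<open>{..<2 ^ s}\<close>, so its size is \<open>2 ^ s\<close>.
  A vector of \<open>m\<close> characters is represented by the number below \<open>(2 ^ s) ^ m\<close> whose digits in base
  \<open>2 ^ s\<close> are the characters, least significant first. In particular the range \<open>\<Sigma>\<^sup>d\<close> is the
  range \<open>{..<2 ^ (s * d)}\<close> of \<open>s * d\<close>-bit strings, and characterwise XOR is XOR of numbers.
\<close>

definition character :: "nat \<Rightarrow> nat \<Rightarrow> nat \<Rightarrow> nat" where
  "character s x i = x div (2 ^ s) ^ i mod 2 ^ s"

type_synonym tables = "nat \<Rightarrow> nat \<Rightarrow> nat"

definition simple_tabulation :: "nat \<Rightarrow> nat \<Rightarrow> tables \<Rightarrow> nat \<Rightarrow> nat" where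
  "simple_tabulation s m T x = foldr (XOR) (map (\<lambda>i. T i (character s x i)) [0..<m]) 0"

definition all_tables :: "nat \<Rightarrow> nat \<Rightarrow> nat \<Rightarrow> tables set" where
  "all_tables s m r = {..<m} \<rightarrow>\<^sub>E ({..<2 ^ s} \<rightarrow>\<^sub>E {..<2 ^ r})"

text \<open>
  For \<open>x < (2 ^ s) ^ c\<close>, the concatenation of the \<open>c\<close> characters of \<open>x\<close> with the \<open>d\<close> characters of
  its image under the first simple tabulation function.
\<close>

definition derived_key :: "nat \<Rightarrow> nat \<Rightarrow> tables \<Rightarrow> nat \<Rightarrow> nat" where
  "derived_key s c T1 x = x + (2 ^ s) ^ c * simple_tabulation s c T1 x"

definition mixed_tabulation :: "nat \<Rightarrow> nat \<Rightarrow> nat \<Rightarrow> tables \<times> tables \<Rightarrow> nat \<Rightarrow> nat" where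
  "mixed_tabulation s c d = (\<lambda>(T1, T2) x. simple_tabulation s (c + d) T2 (derived_key s c T1 x))"

text \<open>A uniform choice from all families of tables makes all table entries independent and uniform.\<close>

definition random_mixed_tables :: "nat \<Rightarrow> nat \<Rightarrow> nat \<Rightarrow> nat \<Rightarrow> (tables \<times> tables) pmf" where
  "random_mixed_tables s c d r =
     pair_pmf (pmf_of_set (all_tables s c (s * d))) (pmf_of_set (all_tables s (c + d) r))"

definition selected_keys ::
  "nat \<Rightarrow> nat \<Rightarrow> nat \<Rightarrow> nat set \<Rightarrow> nat \<Rightarrow> (nat \<Rightarrow> nat) \<Rightarrow> (nat \<Rightarrow> bool) \<Rightarrow> tables \<times> tables \<Rightarrow> nat set" where
  "selected_keys s c d X b p v T = {x \<in> X. \<forall>i<b. bit (mixed_tabulation s c d T x) (p i) = v i}"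

text \<open>
  The selected keys are determined by the first simple tabulation function together with the bits at
  the positions \<open>B = p ` {..<b}\<close> of all entries of the second family of tables.
\<close>

definition revealed :: "nat set \<Rightarrow> tables \<times> tables \<Rightarrow> tables \<times> (nat \<Rightarrow> nat \<Rightarrow> nat set)" where
  "revealed B = (\<lambda>(T1, T2). (T1, \<lambda>i a. {k \<in> B. bit (T2 i a) k}))"

text \<open>
  Independence is a property of a distribution, so saying that it holds with some probability
  requires conditioning: for the outcome \<open>T\<close>, the remaining bits of the selected keys are
  considered in the conditional distribution given the information that determines the selected keys.
  There they are mutually independent fair coin flips.
\<close>

definition remaining_bits_independent ::
  "nat \<Rightarrow> nat \<Rightarrow> nat \<Rightarrow> nat \<Rightarrow> nat set \<Rightarrow> nat \<Rightarrow> (nat \<Rightarrow> nat) \<Rightarrow> (nat \<Rightarrow> bool) \<Rightarrow> tables \<times> tables \<Rightarrow> bool" where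
  "remaining_bits_independent s c d r X b p v T \<longleftrightarrow>
     (let B = p ` {..<b};
          D = cond_pmf (random_mixed_tables s c d r) {T'. revealed B T' = revealed B T};
          I = selected_keys s c d X b p v T \<times> ({..<r} - B);
          Z = (\<lambda>(x, q) T'. bit (mixed_tabulation s c d T' x) q)
      in prob_space.indep_vars (measure_pmf D) (\<lambda>_. count_space UNIV) Z I \<and>
         (\<forall>j\<in>I. map_pmf (Z j) D = pmf_of_set UNIV))"

lemma finite_all_tables: "finite (all_tables s m r)"
  unfolding all_tables_def by (intro finite_PiE) auto

lemma all_tables_nonempty: "all_tables s m r \<noteq> {}"
proof -
  have "(0::nat) \<in> {..<2 ^ r}" by simp
  then show ?thesis unfolding all_tables_def by (auto simp: PiE_eq_empty_iff simp del: lessThan_iff)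
qed

definition shift_table :: "nat \<Rightarrow> nat \<Rightarrow> tables \<Rightarrow> tables" where
  "shift_table s w T = T(0 := \<lambda>a. if a < 2 ^ s then T 0 a XOR w else undefined)"

lemma xor_less_power:
  fixes x y :: nat
  assumes "x < 2 ^ r" "y < 2 ^ r"
  shows "x XOR y < 2 ^ r"
  using assms by (metis take_bit_nat_eq_self_iff take_bit_xor)

lemma shift_table_mem:
  assumes "m \<ge> 1" "w < 2 ^ r" "T \<in> all_tables s m r"
  shows "shift_table s w T \<in> all_tables s m r"
  using assms unfolding shift_table_def all_tables_def
  by (auto simp: PiE_iff extensional_def xor_less_power)

lemma shift_table_shift_table:
  assumes "m \<ge> 1" "T \<in> all_tables s m r"
  shows "shift_table s w (shift_table s w T) = T"
proof -
  have "T 0 \<in> {..<2 ^ s} \<rightarrow>\<^sub>E {..<2 ^ r}"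
    using assms by (auto simp: all_tables_def)
  then show ?thesis
    by (auto simp: shift_table_def fun_eq_iff PiE_iff extensional_def xor.assoc)
qed

lemma simple_tabulation_shift_table:
  assumes "m \<ge> 1"
  shows "simple_tabulation s m (shift_table s w T) x = simple_tabulation s m T x XOR w"
proof -
  have eq: "[0..<m] = 0 # [1..<m]" using assms by (simp add: upt_conv_Cons)
  have "map (\<lambda>i. shift_table s w T i (character s x i)) [1..<m]
      = map (\<lambda>i. T i (character s x i)) [1..<m]"
    by (simp add: shift_table_def)
  moreover have "shift_table s w T 0 (character s x 0) = T 0 (character s x 0) XOR w"
    by (simp add: shift_table_def character_def)
  ultimately show ?thesis
    unfolding simple_tabulation_def eq list.map foldr.simps o_apply
    by (simp only: xor.assoc xor.commute xor.left_commute)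
qed

lemma ex_bits:
  assumes "finite S" "S \<subseteq> {..<r}"
  shows "\<exists>w::nat. w < 2 ^ r \<and> (\<forall>k. bit w k \<longleftrightarrow> k \<in> S)"
proof -
  from assms(1) have "\<exists>w::nat. \<forall>k. bit w k \<longleftrightarrow> k \<in> S"
  proof (induction S rule: finite_induct)
    case empty
    show ?case by (rule exI[of _ 0]) simp
  next
    case (insert a S)
    then obtain w :: nat where "\<forall>k. bit w k \<longleftrightarrow> k \<in> S" by blast
    then show ?case
      by (intro exI[of _ "Bit_Operations.set_bit a w"]) (auto simp: bit_set_bit_iff)
  qed
  then obtain w :: nat where w: "\<forall>k. bit w k \<longleftrightarrow> k \<in> S" by blast
  have "take_bit r w = w" using w assms(2) by (auto simp: bit_eq_iff bit_take_bit_iff)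
  then show ?thesis using w take_bit_nat_eq_self_iff by blast
qed

lemma pmf_bits_simple_tabulation:
  assumes "m \<ge> 1" "B \<subseteq> {..<r}" "S \<subseteq> B"
  shows "pmf (map_pmf (\<lambda>T. {k \<in> B. bit (simple_tabulation s m T x) k})
               (pmf_of_set (all_tables s m r))) S = 1 / 2 ^ card B"
proof -
  let ?D = "pmf_of_set (all_tables s m r)"
  let ?f = "\<lambda>T. {k \<in> B. bit (simple_tabulation s m T x) k}"
  let ?N = "map_pmf ?f ?D"
  have finB: "finite B" using assms(2) finite_subset by blast
  have shift: "pmf ?N S = pmf ?N {}" if "S \<subseteq> B" for S
  proof -
    obtain w :: nat where w: "w < 2 ^ r" "\<forall>k. bit w k \<longleftrightarrow> k \<in> S"
      using ex_bits[of S r] \<open>S \<subseteq> B\<close> assms(2) finB finite_subset by (metis subset_trans)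
    have "bij_betw (shift_table s w) (all_tables s m r) (all_tables s m r)"
      by (rule bij_betw_byWitness[where f' = "shift_table s w"])
        (auto simp: shift_table_shift_table[OF assms(1)] shift_table_mem[OF assms(1) w(1)])
    then have "map_pmf (shift_table s w) ?D = ?D"
      by (rule map_pmf_of_set_bij_betw) (rule all_tables_nonempty finite_all_tables)+
    then have "?N = map_pmf ?f (map_pmf (shift_table s w) ?D)"
      by (simp only:)
    also have "\<dots> = map_pmf (\<lambda>T. ?f (shift_table s w T)) ?D" by (rule map_pmf_comp)
    also have "(\<lambda>T. ?f (shift_table s w T)) = (\<lambda>T. sym_diff (?f T) S)"
      using w(2) \<open>S \<subseteq> B\<close>
      by (auto simp: fun_eq_iff simple_tabulation_shift_table[OF assms(1)] bit_xor_iff)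
    also have "map_pmf \<dots> ?D = map_pmf (\<lambda>A. sym_diff A S) ?N"
      by (simp add: map_pmf_comp)
    finally have "pmf ?N S = pmf (map_pmf (\<lambda>A. sym_diff A S) ?N) S"
      by (rule arg_cong)
    also have "\<dots> = pmf (map_pmf (\<lambda>A. sym_diff A S) ?N) (sym_diff {} S)" by simp
    also have "\<dots> = pmf ?N {}"
      by (rule pmf_map_inj') (auto simp: inj_def)
    finally show ?thesis .
  qed
  have "1 = (\<Sum>A\<in>Pow B. pmf ?N A)"
    by (rule sum_pmf_eq_1[symmetric]) (use finB in auto)
  also have "\<dots> = (\<Sum>A\<in>Pow B. pmf ?N {})" by (intro sum.cong refl shift) blast
  also have "\<dots> = 2 ^ card B * pmf ?N {}" using finB by (simp add: card_Pow)
  finally have "pmf ?N {} = 1 / 2 ^ card B" by (simp add: eq_divide_eq mult.commute)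
  with shift[OF assms(3)] show ?thesis by (rule trans)
qed

lemma expectation_card_selected_keys:
  assumes "c \<ge> 1" "finite X" "inj_on p {..<b}" "p ` {..<b} \<subseteq> {..<r}"
  shows "measure_pmf.expectation (random_mixed_tables s c d r)
           (\<lambda>T. real (card (selected_keys s c d X b p v T))) = real (card X) / 2 ^ b"
proof -
  let ?M = "random_mixed_tables s c d r"
  let ?B = "p ` {..<b}"
  let ?S = "{k \<in> ?B. \<exists>i<b. p i = k \<and> v i}"
  let ?E = "\<lambda>x. {T. \<forall>i<b. bit (mixed_tabulation s c d T x) (p i) = v i}"
  have cardB: "card ?B = b" using assms(3) by (simp add: card_image)
  have prob: "measure_pmf.prob ?M (?E x) = 1 / 2 ^ b" for x
  proof -
    let ?g = "\<lambda>T. {k \<in> ?B. bit (mixed_tabulation s c d T x) k}"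
    have "?E x = ?g -` {?S}"
      using assms(3) by (fastforce simp: inj_on_def set_eq_iff)
    then have "measure_pmf.prob ?M (?E x) = pmf (map_pmf ?g ?M) ?S"
      by (simp add: pmf_map)
    also have "map_pmf ?g ?M = bind_pmf (pmf_of_set (all_tables s c (s * d)))
        (\<lambda>T1. map_pmf (\<lambda>T2. {k \<in> ?B. bit (simple_tabulation s (c + d) T2 (derived_key s c T1 x)) k})
          (pmf_of_set (all_tables s (c + d) r)))"
      by (simp add: random_mixed_tables_def pair_pmf_def map_bind_pmf mixed_tabulation_def
          map_pmf_def bind_assoc_pmf bind_return_pmf)
    also have "pmf \<dots> ?S = 1 / 2 ^ b"
      unfolding pmf_bind
      by (subst pmf_bits_simple_tabulation) (use assms(1,4) cardB in auto)
    finally show ?thesis .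
  qed
  have card: "real (card (selected_keys s c d X b p v T)) = (\<Sum>x\<in>X. indicator (?E x) T)" for T
    using assms(2) by (simp add: selected_keys_def indicator_def sum.If_cases Int_def)
  have "measure_pmf.expectation ?M (\<lambda>T. real (card (selected_keys s c d X b p v T)))
      = (\<Sum>x\<in>X. measure_pmf.prob ?M (?E x))"
    unfolding card by (subst Bochner_Integration.integral_sum)
      (auto intro!: integrable_real_indicator simp: less_top[symmetric])
  then show ?thesis by (simp add: prob)
qed

end

theory Submission
  imports Defs "HOL-Library.Z2" "HOL-Real_Asymp.Real_Asymp"
begin

text \<open>
  Every character of a derived key contributes one table entry, so the hash values of a set of keys
  are independent and uniform as soon as the incidence vectors of their derived keys are linearly
  independent over the field with two elements. If the derived keys of the selected keys \<open>Y\<close> are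
  dependent, there is a nonempty \<open>A \<subseteq> Y\<close> in which every key shares each of its derived characters
  with another key of \<open>A\<close>. Group the derived characters into \<open>D = d div 2\<close> pairs. For each pair, walk
  through \<open>A\<close> from a root, following shared characters at the two positions of the pair in turn, as
  long as the original keys stay linearly independent. Every step costs at most
  \<open>|X| / (2 ^ b |\<Sigma>|) \<le> 1 / (1 + \<epsilon>)\<close>, so arbitrarily long walks can be afforded, and the first root
  costs \<open>|\<Sigma>|\<close>. When a walk reaches a key \<open>w\<close> in the span of the keys seen so far, there are two cases.
  Either the closing equality of characters does not follow from the earlier ones, which gains a factor
  \<open>1 / |\<Sigma>|\<close> in the probability; or \<open>w\<close> is the sum of an odd set of at least three keys of the current
  walk, which gains the same factor in the number of walks. If that set contains the root, the next root
  is another key of the set, so that consecutive dependencies share at most one key and the gains multiply, by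
  the Cauchy--Schwarz inequality. The \<open>D\<close> gains give \<open>|\<Sigma>| ^ (1 - D)\<close>. There are too many subsets of a
  long walk to enumerate all dependencies, but a dependency of more than constant size determines many
  of its keys by the others and yields all \<open>D\<close> gains at once.
\<close>

section \<open>Linear algebra over the field with two elements\<close>

text \<open>These rules would rewrite sums and products to bit operations, out of reach of the lemmas on sums.\<close>

declare add_bit_eq_xor [simp del] mult_bit_eq_and [simp del]

text \<open>The gain from a linear dependency is only an average statement. For a fixed root the
  number of triples of keys that complete it to a zero sum can exceed every constant multiple of
  |X|: with three characters, take the root (0,0,0) and all keys (0,\<alpha>,\<beta>),
  (\<gamma>,0,\<beta>), (\<gamma>,\<alpha>,0); N values per character give N^3 dependencies among
  3N^2+1 keys. Using the worst root for every walk therefore fails. Instead, the cost of the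
  remaining walks is a function \<open>weight\<close> of the current root, and one walk acts as a
  bilinear form in a function at its root and a function at the next root. This form has norm
  O(1/|\<Sigma>|), because weighted zero-sum quadruples are bounded by 3^c |X| times two L2 norms.
  The D walks give (C/|\<Sigma>|)^D, and the free choice of the first root gives |X|/2^b \<le>
  |\<Sigma>|. The norm contains a sum over walk lengths l of a count times (1+\<epsilon>)^(-l).
  Every count made along a walk must hence be polynomial in l: this is why closing keys are only
  located in a box of \<open>card E ^ c\<close> keys, and why dependency sets are enumerated only
  below the size (D+1)(c+1).\<close>

definition indep :: "'i set \<Rightarrow> ('i \<Rightarrow> 'q \<Rightarrow> bit) \<Rightarrow> bool" where
  "indep I f \<longleftrightarrow> (\<forall>S\<subseteq>I. S \<noteq> {} \<longrightarrow> (\<exists>q. (\<Sum>i\<in>S. f i q) \<noteq> 0))"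

definition in_span :: "'i set \<Rightarrow> ('i \<Rightarrow> 'q \<Rightarrow> bit) \<Rightarrow> ('q \<Rightarrow> bit) \<Rightarrow> bool" where
  "in_span I f u \<longleftrightarrow> (\<exists>S\<subseteq>I. \<forall>q. u q = (\<Sum>i\<in>S. f i q))"

lemma bit_add_self [simp]: "(a::bit) + a = 0"
  by (cases a) (simp_all add: add_bit_eq_xor)

lemma bit_add_eq_0_iff: "(a::bit) + b = 0 \<longleftrightarrow> a = b"
  by (cases a; cases b) (simp_all add: add_bit_eq_xor)

lemma of_bool_xor_bit: "(of_bool (a \<noteq> b) :: bit) = of_bool a + of_bool b"
  by (cases a; cases b) (simp_all add: add_bit_eq_xor)

lemma indep_subset: "indep I f \<Longrightarrow> J \<subseteq> I \<Longrightarrow> indep J f"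
  unfolding indep_def by (meson subset_trans)

lemma indep_insert:
  assumes "finite I" "indep I f" "\<not> in_span I f (f a)"
  shows "indep (insert a I) f"
  unfolding indep_def
proof (intro allI impI)
  fix S assume S: "S \<subseteq> insert a I" "S \<noteq> {}"
  show "\<exists>q. (\<Sum>i\<in>S. f i q) \<noteq> 0"
  proof (cases "a \<in> S")
    case False
    then show ?thesis using S assms(2) unfolding indep_def by blast
  next
    case True
    have fin: "finite S" using S assms(1) finite_subset by auto
    show ?thesis
    proof (rule ccontr)
      assume "\<not> ?thesis"
      then have "\<And>q. f a q + (\<Sum>i\<in>S - {a}. f i q) = 0"
        using True fin by (simp add: sum.remove)
      then have "\<And>q. f a q = (\<Sum>i\<in>S - {a}. f i q)" by (simp only: bit_add_eq_0_iff)
      moreover have "S - {a} \<subseteq> I" using S by auto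
      ultimately show False using assms(3) unfolding in_span_def by blast
    qed
  qed
qed

lemma not_in_span_imp_notin: "\<not> in_span I f (f a) \<Longrightarrow> a \<notin> I"
  unfolding in_span_def by (metis empty_subsetI insert_subset sum.infinite sum.empty sum.insert
      finite.emptyI add.right_neutral insert_absorb empty_iff)

text \<open>Independent vectors admit a linear functional with arbitrary values on them. The
  functional \<open>D\<close> later becomes a table whose entries are XORed into the random ones, so
  independence of keys turns into the freedom to change their hash bits.\<close>

lemma dual_family:
  fixes f :: "'i \<Rightarrow> 'q \<Rightarrow> bit" and g :: "'i \<Rightarrow> bit"
  assumes "finite I" "finite Q" "indep I f" "\<And>i q. i \<in> I \<Longrightarrow> q \<notin> Q \<Longrightarrow> f i q = 0"
  shows "\<exists>D. \<forall>i\<in>I. (\<Sum>q\<in>Q. f i q * D q) = g i"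
  using assms(1,3,4)
proof (induction I arbitrary: g rule: finite_induct)
  case empty
  then show ?case by simp
next
  case (insert a I)
  have ind: "indep I f" using insert.prems(1) indep_subset by blast
  have IH: "\<exists>D. \<forall>i\<in>I. (\<Sum>q\<in>Q. f i q * D q) = h i" for h
    by (rule insert.IH[OF ind]) (use insert.prems(2) in blast)
  have "\<forall>x. \<exists>D. \<forall>i\<in>I. (\<Sum>q\<in>Q. f i q * D q) = of_bool (i = x)"
    by (intro allI IH)
  then obtain Df where Df: "\<And>x i. i \<in> I \<Longrightarrow> (\<Sum>q\<in>Q. f i q * Df x q) = of_bool (i = x)"
    by metis
  obtain D where D: "\<And>i. i \<in> I \<Longrightarrow> (\<Sum>q\<in>Q. f i q * D q) = g i" using IH by blast
  \<comment> \<open>A functional that separates the new vector from the old ones. If there were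
    none, \<open>f a\<close> would be a combination of the old vectors, the coefficient of
    \<open>f x\<close> being the value at \<open>f a\<close> of the functional dual to
    \<open>x\<close>.\<close>
  have "\<exists>D0. (\<forall>i\<in>I. (\<Sum>q\<in>Q. f i q * D0 q) = 0) \<and> (\<Sum>q\<in>Q. f a q * D0 q) \<noteq> 0"
  proof (rule ccontr)
    assume "\<not> ?thesis"
    then have van: "\<And>D0. (\<forall>i\<in>I. (\<Sum>q\<in>Q. f i q * D0 q) = 0) \<Longrightarrow> (\<Sum>q\<in>Q. f a q * D0 q) = 0"
      by blast
    define l where "l x = (\<Sum>q\<in>Q. f a q * Df x q)" for x
    have eq: "f a q0 = (\<Sum>x\<in>I. f x q0 * l x)" for q0
    proof (cases "q0 \<in> Q")
      case False
      then show ?thesis using insert.prems(2) by simp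
    next
      case True
      \<comment> \<open>The coordinate functional at \<open>q0\<close>, corrected by the dual
        functionals so that it vanishes on all of \<open>I\<close>. It must then vanish at
        \<open>f a\<close> too, which is the expansion of \<open>f a\<close> at
        \<open>q0\<close>.\<close>
      define E where "E q = of_bool (q = q0) + (\<Sum>x\<in>I. f x q0 * Df x q)" for q
      have pair: "(\<Sum>q\<in>Q. h q * E q) = h q0 + (\<Sum>x\<in>I. f x q0 * (\<Sum>q\<in>Q. h q * Df x q))"
        for h :: "'q \<Rightarrow> bit"
      proof -
        have "(\<Sum>q\<in>Q. h q * E q)
            = (\<Sum>q\<in>Q. h q * of_bool (q = q0)) + (\<Sum>q\<in>Q. \<Sum>x\<in>I. f x q0 * (h q * Df x q))"
          by (simp add: E_def distrib_left sum.distrib sum_distrib_left mult.left_commute)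
        also have "(\<Sum>q\<in>Q. h q * of_bool (q = q0)) = h q0"
          using True assms(2) by (simp add: sum.delta' of_bool_def if_distrib cong: if_cong)
        also have "(\<Sum>q\<in>Q. \<Sum>x\<in>I. f x q0 * (h q * Df x q))
            = (\<Sum>x\<in>I. f x q0 * (\<Sum>q\<in>Q. h q * Df x q))"
          by (subst sum.swap) (simp add: sum_distrib_left)
        finally show ?thesis .
      qed
      have "(\<Sum>q\<in>Q. f i q * E q) = 0" if "i \<in> I" for i
      proof -
        have "(\<Sum>q\<in>Q. f i q * E q) = f i q0 + (\<Sum>x\<in>I. f x q0 * of_bool (i = x))"
          unfolding pair using Df[OF that] by simp
        also have "(\<Sum>x\<in>I. f x q0 * of_bool (i = x)) = f i q0"
          using insert.hyps(1) that by (simp add: sum.delta of_bool_def if_distrib cong: if_cong)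
        finally show ?thesis by simp
      qed
      then have "f a q0 + (\<Sum>x\<in>I. f x q0 * l x) = 0"
        using van pair[of "f a"] unfolding l_def by simp
      then show ?thesis by (simp only: bit_add_eq_0_iff)
    qed
    define S where "S = insert a {x \<in> I. l x = 1}"
    have "(\<Sum>i\<in>S. f i q) = 0" for q
    proof -
      have "(\<Sum>x\<in>I. f x q * l x) = (\<Sum>x\<in>I. if l x = 1 then f x q else 0)"
        by (intro sum.cong) auto
      also have "\<dots> = (\<Sum>x\<in>{x\<in>I. l x = 1}. f x q)"
        using insert.hyps(1) by (simp add: sum.inter_filter)
      finally have "(\<Sum>x\<in>{x\<in>I. l x = 1}. f x q) = f a q" by (simp add: eq)
      then show ?thesis unfolding S_def using insert.hyps by simp
    qed
    moreover have "S \<subseteq> insert a I" "S \<noteq> {}" unfolding S_def by auto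
    ultimately show False using insert.prems(1) unfolding indep_def by blast
  qed
  then obtain D0 where D0: "\<And>i. i \<in> I \<Longrightarrow> (\<Sum>q\<in>Q. f i q * D0 q) = 0" "(\<Sum>q\<in>Q. f a q * D0 q) = 1"
    by auto
  \<comment> \<open>Adding \<open>k * D0\<close> repairs the value at \<open>a\<close> and leaves
    the values on \<open>I\<close> alone.\<close>
  define k where "k = g a + (\<Sum>q\<in>Q. f a q * D q)"
  have "(\<Sum>q\<in>Q. f i q * (D q + k * D0 q)) = (\<Sum>q\<in>Q. f i q * D q) + k * (\<Sum>q\<in>Q. f i q * D0 q)" for i
    by (simp add: distrib_left sum.distrib sum_distrib_left mult.left_commute)
  then have "\<forall>i\<in>insert a I. (\<Sum>q\<in>Q. f i q * (D q + k * D0 q)) = g i"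
    using D D0 by (auto simp: k_def add.left_commute)
  then show ?case by (rule exI[of _ "\<lambda>q. D q + k * D0 q"])
qed

text \<open>Measure-preserving shifts carry every bit pattern to every other one, so the
  \<open>2 ^ card I\<close> patterns are equally likely; they partition the space. The shift may
  depend on the pattern.\<close>

lemma prob_of_shift_invariance:
  fixes D :: "'w pmf" and \<Phi> :: "'i \<Rightarrow> 'w \<Rightarrow> bit"
  assumes "finite I"
    and "\<And>g. \<exists>\<sigma>. map_pmf \<sigma> D = D \<and> (\<forall>\<omega>\<in>set_pmf D. \<forall>i\<in>I. \<Phi> i (\<sigma> \<omega>) = \<Phi> i \<omega> + g i)"
  shows "measure_pmf.prob D {\<omega>. \<forall>i\<in>I. \<Phi> i \<omega> = g i} = (1 / 2) ^ card I"
proof -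
  let ?A = "\<lambda>g. {\<omega>. \<forall>i\<in>I. \<Phi> i \<omega> = g i}"
  have eq: "measure_pmf.prob D (?A g) = measure_pmf.prob D (?A g')" for g g'
  proof -
    obtain \<sigma> where \<sigma>: "map_pmf \<sigma> D = D"
      "\<And>\<omega> i. \<omega> \<in> set_pmf D \<Longrightarrow> i \<in> I \<Longrightarrow> \<Phi> i (\<sigma> \<omega>) = \<Phi> i \<omega> + (g i + g' i)"
      using assms(2)[of "\<lambda>i. g i + g' i"] by blast
    have "measure_pmf.prob D (?A g) = measure_pmf.prob (map_pmf \<sigma> D) (?A g)" by (simp only: \<sigma>(1))
    also have "\<dots> = measure_pmf.prob D (\<sigma> -` ?A g)" by (simp only: measure_map_pmf)
    also have "\<dots> = measure_pmf.prob D (?A g')"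
    proof (rule measure_pmf.finite_measure_eq_AE)
      show "AE \<omega> in measure_pmf D. \<omega> \<in> \<sigma> -` ?A g \<longleftrightarrow> \<omega> \<in> ?A g'"
      proof (rule AE_pmfI)
        fix \<omega> assume w: "\<omega> \<in> set_pmf D"
        have "(\<Phi> i \<omega> + (g i + g' i) = g i) = (\<Phi> i \<omega> = g' i)" for i
          by (cases "\<Phi> i \<omega>"; cases "g i"; cases "g' i") (simp_all add: add_bit_eq_xor)
        then show "\<omega> \<in> \<sigma> -` ?A g \<longleftrightarrow> \<omega> \<in> ?A g'" using \<sigma>(2)[OF w] by simp
      qed
    qed auto
    finally show ?thesis .
  qed
  let ?P = "I \<rightarrow>\<^sub>E (UNIV :: bit set)"
  have U: "(UNIV :: bit set) = {0, 1}" using bit_not_zero_iff by blast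
  have cU: "card (UNIV :: bit set) = 2" "finite (UNIV :: bit set)" by (simp_all only: U) simp_all
  have finP: "finite ?P" using assms(1) cU(2) by (intro finite_PiE)
  have card: "card ?P = 2 ^ card I" using assms(1) by (simp add: card_PiE cU(1))
  have "1 = measure_pmf.prob D (\<Union>h\<in>?P. ?A h)"
  proof -
    have "\<omega> \<in> (\<Union>h\<in>?P. ?A h)" for \<omega>
      by (rule UN_I[of "\<lambda>i\<in>I. \<Phi> i \<omega>"]) auto
    then have "(\<Union>h\<in>?P. ?A h) = UNIV" by blast
    then show ?thesis by simp
  qed
  also have "\<dots> = (\<Sum>h\<in>?P. measure_pmf.prob D (?A h))"
  proof (rule measure_pmf.finite_measure_finite_Union[OF finP])
    show "disjoint_family_on ?A ?P"
      unfolding disjoint_family_on_def by (auto simp: PiE_iff extensional_def fun_eq_iff) metis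
  qed auto
  also have "\<dots> = (\<Sum>h\<in>?P. measure_pmf.prob D (?A g))" by (intro sum.cong refl eq)
  also have "\<dots> = 2 ^ card I * measure_pmf.prob D (?A g)" by (simp add: card)
  finally show ?thesis by (simp add: field_simps power_divide)
qed

section \<open>Bits of simple tabulation hashing\<close>

text \<open>The incidence vector of a key on pairs of a position and a character. A hash bit is the
  inner product of this vector with the same bit of all table entries. The characters are a
  parameter because both original and derived keys are used.\<close>

definition kvec :: "nat \<Rightarrow> (nat \<Rightarrow> 'a \<Rightarrow> 'q) \<Rightarrow> 'a \<Rightarrow> nat \<times> 'q \<Rightarrow> bit" where
  "kvec m ch x = (\<lambda>(i, a). of_bool (i < m \<and> ch i x = a))"

definition tbit :: "tables \<Rightarrow> nat \<Rightarrow> nat \<times> nat \<Rightarrow> bit" where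
  "tbit T k = (\<lambda>(i, a). of_bool (bit (T i a) k))"

definition xor_tables :: "nat \<Rightarrow> nat \<Rightarrow> tables \<Rightarrow> tables \<Rightarrow> tables" where
  "xor_tables s m W T = (\<lambda>i\<in>{..<m}. \<lambda>a\<in>{..<2 ^ s}. T i a XOR W i a)"

lemma character_less: "character s x i < 2 ^ s"
  by (simp add: character_def)

lemma of_bool_bit_xor:
  fixes x y :: nat
  shows "(of_bool (bit (x XOR y) k) :: bit) = of_bool (bit x k) + of_bool (bit y k)"
  by (simp only: bit_xor_iff of_bool_xor_bit)

lemma bit_foldr_xor:
  "(of_bool (bit (foldr (XOR) (map h xs) (0::nat)) k) :: bit) = (\<Sum>i\<leftarrow>xs. of_bool (bit (h i) k))"
  by (induction xs) (simp_all add: of_bool_bit_xor)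

lemma bit_simple_tabulation:
  "(of_bool (bit (simple_tabulation s m T x) k) :: bit) = (\<Sum>i<m. of_bool (bit (T i (character s x i)) k))"
  unfolding simple_tabulation_def bit_foldr_xor
  by (simp add: interv_sum_list_conv_sum_set_nat atLeast0LessThan)

lemma sum_kvec:
  fixes D :: "nat \<times> nat \<Rightarrow> bit"
  shows "(\<Sum>q\<in>{..<m} \<times> {..<2 ^ s}. kvec m (\<lambda>i x. character s x i) x q * D q)
    = (\<Sum>i<m. D (i, character s x i))"
proof -
  have "(\<Sum>q\<in>{..<m} \<times> {..<2 ^ s}. kvec m (\<lambda>i x. character s x i) x q * D q)
      = (\<Sum>i<m. \<Sum>a<2 ^ s. of_bool (character s x i = a) * D (i, a))"
    unfolding sum.cartesian_product by (intro sum.cong) (auto simp: kvec_def)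
  also have "\<dots> = (\<Sum>i<m. D (i, character s x i))"
    by (intro sum.cong refl) (simp add: character_less sum.delta' of_bool_def if_distrib if_distribR cong: if_cong)
  finally show ?thesis .
qed

lemma simple_tabulation_xor_tables:
  "simple_tabulation s m (xor_tables s m W T) x = simple_tabulation s m T x XOR simple_tabulation s m W x"
proof (rule bit_eqI)
  fix k
  have "(of_bool (bit (simple_tabulation s m (xor_tables s m W T) x) k) :: bit)
      = of_bool (bit (simple_tabulation s m T x) k) + of_bool (bit (simple_tabulation s m W x) k)"
    unfolding bit_simple_tabulation sum.distrib[symmetric]
    by (intro sum.cong refl)
      (simp add: xor_tables_def character_less bit_xor_iff of_bool_xor_bit[symmetric])
  then show "bit (simple_tabulation s m (xor_tables s m W T) x) k
      = bit (simple_tabulation s m T x XOR simple_tabulation s m W x) k"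
    by (simp add: of_bool_xor_bit[symmetric] bit_xor_iff del: of_bool_eq_iff) (simp only: of_bool_eq_iff)
qed

lemma xor_tables_mem:
  assumes "T \<in> all_tables s m r" "\<And>i a. W i a < 2 ^ r"
  shows "xor_tables s m W T \<in> all_tables s m r"
  using assms unfolding xor_tables_def all_tables_def
  by (auto simp: PiE_iff extensional_def xor_less_power)

lemma xor_tables_twice:
  assumes "T \<in> all_tables s m r"
  shows "xor_tables s m W (xor_tables s m W T) = T"
  using assms unfolding xor_tables_def all_tables_def
  by (auto simp: PiE_iff extensional_def fun_eq_iff xor.assoc)

lemma bij_xor_tables:
  assumes "\<And>i a. W i a < 2 ^ r"
  shows "bij_betw (xor_tables s m W) (all_tables s m r) (all_tables s m r)"
  by (rule bij_betw_byWitness[where f' = "xor_tables s m W"])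
    (auto simp: xor_tables_twice xor_tables_mem assms)

lemma map_pmf_xor_tables:
  assumes "\<And>i a. W i a < 2 ^ r"
  shows "map_pmf (xor_tables s m W) (pmf_of_set (all_tables s m r)) = pmf_of_set (all_tables s m r)"
  by (rule map_pmf_of_set_bij_betw[OF bij_xor_tables[OF assms]])
    (rule all_tables_nonempty finite_all_tables)+

lemma ex_tables_of_bits:
  fixes D :: "nat \<Rightarrow> nat \<times> nat \<Rightarrow> bit"
  obtains W :: tables where "\<And>i a. W i a < 2 ^ r"
    "\<And>i a k. bit (W i a) k \<longleftrightarrow> k < r \<and> D k (i, a) = 1"
proof -
  have "\<forall>q. \<exists>w::nat. w < 2 ^ r \<and> (\<forall>k. bit w k \<longleftrightarrow> k \<in> {k. k < r \<and> D k q = 1})"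
    by (intro allI ex_bits) (auto intro: finite_subset[of _ "{..<r}"])
  from choice[OF this] obtain W :: "nat \<times> nat \<Rightarrow> nat"
    where W: "\<And>q. W q < 2 ^ r" "\<And>q k. bit (W q) k \<longleftrightarrow> k < r \<and> D k q = 1"
    by auto
  show ?thesis by (rule that[of "\<lambda>i a. W (i, a)"]) (auto simp: W)
qed

lemma of_bool_eq_1_bit [simp]: "(of_bool (x = (1::bit)) :: bit) = x"
  by (cases x) auto

text \<open>Distinct bit positions of the entries do not interact under XOR, so a dual functional is
  written into each bit position \<open>k\<close> separately. The sets \<open>A k i\<close> are
  singletons when hash bits are prescribed, and pairs when two characters are required to agree.
  Keeping the bits outside \<open>K\<close> zero is what later leaves the revealed bits
  unchanged.\<close>

lemma ex_shift_tables:
  fixes f :: "nat \<Rightarrow> 'i \<Rightarrow> nat \<times> nat \<Rightarrow> bit" and g :: "nat \<Rightarrow> 'i \<Rightarrow> bit"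
  assumes fin: "\<And>k. k \<in> K \<Longrightarrow> finite (I k)" and ind: "\<And>k. k \<in> K \<Longrightarrow> indep (I k) (f k)" and "K \<subseteq> {..<r}"
    and f: "\<And>k i. k \<in> K \<Longrightarrow> i \<in> I k \<Longrightarrow> f k i = (\<lambda>q. \<Sum>x\<in>A k i. kvec m (\<lambda>i x. character s x i) x q)"
  obtains W where "\<And>i a. W i a < 2 ^ r"
    "\<And>k i. k \<in> K \<Longrightarrow> i \<in> I k \<Longrightarrow> (\<Sum>x\<in>A k i. of_bool (bit (simple_tabulation s m W x) k)) = g k i"
    "\<And>i a k. k \<notin> K \<Longrightarrow> \<not> bit (W i a) k"
proof -
  let ?Q = "{..<m} \<times> {..<2 ^ s} :: (nat \<times> nat) set"
  let ?v = "kvec m (\<lambda>i x. character s x i)"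
  have v0: "?v x q = 0" if "q \<notin> ?Q" for x q
    using that character_less[of s x] by (cases q) (auto simp: kvec_def)
  have "\<exists>D. \<forall>i\<in>I k. (\<Sum>q\<in>?Q. f k i q * D q) = g k i" if k: "k \<in> K" for k
    by (rule dual_family[OF fin[OF k] _ ind[OF k]]) (auto simp: f[OF k] v0 simp del: mem_Sigma_iff)
  then obtain D where D: "\<And>k i. k \<in> K \<Longrightarrow> i \<in> I k \<Longrightarrow> (\<Sum>q\<in>?Q. f k i q * D k q) = g k i"
    by metis
  obtain W :: tables where W: "\<And>i a. W i a < 2 ^ r"
    "\<And>i a k. bit (W i a) k \<longleftrightarrow> k < r \<and> (if k \<in> K then D k else (\<lambda>_. 0)) (i, a) = 1"
    using ex_tables_of_bits[of r "\<lambda>k. if k \<in> K then D k else (\<lambda>_. 0)"] by blast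
  have st: "(of_bool (bit (simple_tabulation s m W x) k) :: bit)
      = (if k \<in> K then \<Sum>q\<in>?Q. ?v x q * D k q else 0)" for x k
    proof (cases "k \<in> K")
    case True
    then have "k < r" using assms(3) by auto
    then show ?thesis unfolding bit_simple_tabulation sum_kvec W(2)
      using True by (simp del: sum_of_bool_eq)
  next
    case False
    then show ?thesis unfolding bit_simple_tabulation W(2) by simp
  qed
  show ?thesis
  proof (rule that[OF W(1)])
    fix k i assume k: "k \<in> K" "i \<in> I k"
    have "(\<Sum>x\<in>A k i. of_bool (bit (simple_tabulation s m W x) k))
        = (\<Sum>x\<in>A k i. \<Sum>q\<in>?Q. ?v x q * D k q)" by (simp add: st k(1))
    also have "\<dots> = (\<Sum>q\<in>?Q. f k i q * D k q)"
      by (subst sum.swap) (simp add: f[OF k] sum_distrib_right)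
    finally show "(\<Sum>x\<in>A k i. of_bool (bit (simple_tabulation s m W x) k)) = g k i"
      by (simp add: D k)
  next
    fix i a k assume "k \<notin> K"
    then show "\<not> bit (W i a) k" by (simp add: W(2))
  qed
qed

section \<open>From equally likely bit patterns to independent hash bits\<close>

text \<open>Equal pattern probabilities identify the joint law with a product of fair coins, for
  which independence and the marginals are known; both are transported back.\<close>

lemma indep_vars_of_fair_bits:
  fixes D :: "'w pmf" and Z :: "'i \<Rightarrow> 'w \<Rightarrow> bool"
  assumes fin: "finite I"
    and prob: "\<And>g. measure_pmf.prob D {\<omega>. \<forall>i\<in>I. Z i \<omega> = g i} = (1 / 2) ^ card I"
  shows "prob_space.indep_vars (measure_pmf D) (\<lambda>_. count_space UNIV) Z I"
    and "\<forall>j\<in>I. map_pmf (Z j) D = pmf_of_set UNIV"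
proof -
  \<comment> \<open>The default \<open>False\<close> outside \<open>I\<close> is the one used by
    \<open>Pi_pmf\<close>.\<close>
  define F where "F \<omega> = (\<lambda>i. if i \<in> I then Z i \<omega> else False)" for \<omega>
  let ?P = "Pi_pmf I False (\<lambda>_. pmf_of_set (UNIV :: bool set))"
  have FP: "map_pmf F D = ?P"
  proof (rule pmf_eqI)
    fix f
    show "pmf (map_pmf F D) f = pmf ?P f"
    proof (cases "\<forall>x. x \<notin> I \<longrightarrow> f x = False")
      case True
      then have "F -` {f} = {\<omega>. \<forall>i\<in>I. Z i \<omega> = f i}" unfolding F_def by (auto simp: fun_eq_iff)
      then have "pmf (map_pmf F D) f = (1 / 2) ^ card I" by (simp add: pmf_map prob)
      also have "\<dots> = pmf ?P f" using True by (subst pmf_Pi'[OF fin]) simp_all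
      finally show ?thesis .
    next
      case False
      then have "F -` {f} = {}" unfolding F_def by (auto simp: fun_eq_iff)
      then show ?thesis using False pmf_Pi_outside[OF fin, of f] by (auto simp: pmf_map)
    qed
  qed
  show "\<forall>j\<in>I. map_pmf (Z j) D = pmf_of_set UNIV"
  proof
    fix j assume j: "j \<in> I"
    have "map_pmf (Z j) D = map_pmf (\<lambda>f. f j) (map_pmf F D)"
      unfolding map_pmf_comp using j by (simp add: F_def)
    also have "\<dots> = pmf_of_set UNIV" unfolding FP using j by (subst Pi_pmf_component[OF fin]) simp
    finally show "map_pmf (Z j) D = pmf_of_set UNIV" .
  qed
  have empty: "prob_space.indep_vars (measure_pmf D) (\<lambda>_. count_space UNIV) Z {}"
    by (subst prob_space.indep_vars_def[OF measure_pmf.prob_space_axioms],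
        subst prob_space.indep_sets_def[OF measure_pmf.prob_space_axioms]) simp
  show "prob_space.indep_vars (measure_pmf D) (\<lambda>_. count_space UNIV) Z I"
  proof (cases "I = {}")
    case True
    then show ?thesis using empty by simp
  next
    case False
    have "measure_pmf.prob D (\<Inter>j\<in>I. Z j -` A j) = (\<Prod>j\<in>I. measure_pmf.prob D (Z j -` A j))" for A
    proof -
      have "(\<Inter>j\<in>I. Z j -` A j) = F -` (\<Inter>j\<in>I. (\<lambda>f. f j) -` A j)"
        by (rule set_eqI) (simp add: F_def)
      then have "measure_pmf.prob D (\<Inter>j\<in>I. Z j -` A j) = measure_pmf.prob ?P (\<Inter>j\<in>I. (\<lambda>f. f j) -` A j)"
        by (simp only: FP[symmetric] measure_map_pmf)
      also have "\<dots> = (\<Prod>j\<in>I. measure_pmf.prob ?P ((\<lambda>f. f j) -` A j))"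
      proof -
        have "measure_pmf.prob ?P (\<Inter>j\<in>I. (\<lambda>f. f j) -` A j \<inter> space (measure_pmf ?P))
            = (\<Prod>j\<in>I. measure_pmf.prob ?P ((\<lambda>f. f j) -` A j \<inter> space (measure_pmf ?P)))"
          by (rule prob_space.indep_varsD_finite[OF measure_pmf.prob_space_axioms indep_vars_Pi_pmf[OF fin] False fin])
            simp
        then show ?thesis by (simp only: space_measure_pmf Int_UNIV_right)
      qed
      also have "\<dots> = (\<Prod>j\<in>I. measure_pmf.prob D (Z j -` A j))"
      proof (intro prod.cong refl)
        fix j assume j: "j \<in> I"
        have "Z j -` A j = F -` ((\<lambda>f. f j) -` A j)"
          by (rule set_eqI) (simp only: vimage_eq F_def j if_True)
        then show "measure_pmf.prob ?P ((\<lambda>f. f j) -` A j) = measure_pmf.prob D (Z j -` A j)"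
          by (simp only: FP[symmetric] measure_map_pmf)
      qed
      finally show ?thesis .
    qed
    then have eq: "measure_pmf.prob D (\<Inter>j\<in>I. Z j -` A j \<inter> space (measure_pmf D))
        = (\<Prod>j\<in>I. measure_pmf.prob D (Z j -` A j \<inter> space (measure_pmf D)))" for A
      by (simp only: space_measure_pmf Int_UNIV_right)
    have sets: "sets (count_space UNIV) = sigma_sets (space (count_space UNIV)) (UNIV :: bool set set)"
    proof -
      have "x \<in> sigma_sets UNIV (UNIV :: bool set set)" for x by (rule sigma_sets.Basic) simp
      then have "sigma_sets UNIV (UNIV :: bool set set) = UNIV" by (intro UNIV_eq_I[symmetric])
      then show ?thesis by (simp only: sets_count_space space_count_space Pow_UNIV)
    qed
    have "prob_space.indep_vars (measure_pmf D) (\<lambda>_. count_space UNIV) Z I \<longleftrightarrow>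
      (\<forall>A\<in>I \<rightarrow> UNIV. measure_pmf.prob D (\<Inter>j\<in>I. Z j -` A j \<inter> space (measure_pmf D))
        = (\<Prod>j\<in>I. measure_pmf.prob D (Z j -` A j \<inter> space (measure_pmf D))))"
    proof (rule prob_space.indep_vars_finite[OF measure_pmf.prob_space_axioms False fin,
            where M' = "\<lambda>_. count_space UNIV" and E = "\<lambda>_. UNIV" and X = Z])
      show "sets (count_space UNIV) = sigma_sets (space (count_space UNIV)) (UNIV :: bool set set)"
        by (rule sets)
      show "Z i \<in> measurable (measure_pmf D) (count_space UNIV)" for i by simp
      show "Int_stable (UNIV :: bool set set)" unfolding Int_stable_def by blast
    qed simp_all
    then show ?thesis using eq by blast
  qed
qed

lemma bit_character: "bit (character s y j) k \<longleftrightarrow> k < s \<and> bit y (j * s + k)"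
proof -
  have "character s y j = take_bit s (drop_bit (s * j) y)"
    by (simp add: character_def take_bit_eq_mod drop_bit_eq_div power_mult)
  then show ?thesis by (simp add: bit_take_bit_iff bit_drop_bit_eq mult.commute)
qed

lemma character_eq_iff:
  "character s y j = character s y' j \<longleftrightarrow> (\<forall>k<s. bit y (j * s + k) \<longleftrightarrow> bit y' (j * s + k))"
  unfolding bit_eq_iff bit_character by auto

lemma character_derived_key:
  assumes "x < (2 ^ s) ^ c"
  shows "character s (derived_key s c T x) i
    = (if i < c then character s x i else character s (simple_tabulation s c T x) (i - c))"
proof (cases "i < c")
  case True
  define h where "h = simple_tabulation s c T x"
  obtain e where e: "c = Suc (i + e)" using True less_iff_Suc_add by auto
  have "x + (2 ^ s) ^ c * h = x + (2 ^ s) ^ i * (2 ^ s * ((2 ^ s) ^ e * h))"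
    by (simp add: e power_add algebra_simps)
  then have "(x + (2 ^ s) ^ c * h) div (2 ^ s) ^ i
      = (x + (2 ^ s) ^ i * (2 ^ s * ((2 ^ s) ^ e * h))) div (2 ^ s) ^ i"
    by (rule arg_cong)
  also have "\<dots> = x div (2 ^ s) ^ i + 2 ^ s * ((2 ^ s) ^ e * h)" by simp
  finally have "(x + (2 ^ s) ^ c * h) div (2 ^ s) ^ i = x div (2 ^ s) ^ i + 2 ^ s * ((2 ^ s) ^ e * h)" .
  then show ?thesis using True unfolding character_def derived_key_def h_def[symmetric] by simp
next
  case False
  define h where "h = simple_tabulation s c T x"
  obtain e where e: "i = c + e" using False le_Suc_ex not_less by blast
  have "(x + (2 ^ s) ^ c * h) div (2 ^ s) ^ i = (x + (2 ^ s) ^ c * h) div (2 ^ s) ^ c div (2 ^ s) ^ e"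
    by (simp only: e power_add div_mult2_eq)
  also have "\<dots> = h div (2 ^ s) ^ e" using assms by simp
  finally show ?thesis using False unfolding character_def derived_key_def h_def[symmetric] e by simp
qed

lemma prob_bits_simple_tabulation:
  assumes "finite E" "B \<subseteq> {..<r}" and ind: "indep E (\<lambda>e. kvec m (\<lambda>i x. character s x i) (key e))"
  shows "measure_pmf.prob (pmf_of_set (all_tables s m r))
      {T. \<forall>e\<in>E. \<forall>k\<in>B. bit (simple_tabulation s m T (key e)) k = g e k} = (1 / 2) ^ (card E * card B)"
proof -
  let ?D = "pmf_of_set (all_tables s m r)"
  let ?\<Phi> = "\<lambda>(e, k) T. of_bool (bit (simple_tabulation s m T (key e)) k) :: bit"
  have "measure_pmf.prob ?D {T. \<forall>i\<in>E \<times> B. ?\<Phi> i T = (\<lambda>(e, k). of_bool (g e k)) i} = (1 / 2) ^ card (E \<times> B)"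
  proof (rule prob_of_shift_invariance)
    show "finite (E \<times> B)" using assms finite_subset by blast
    fix h :: "'a \<times> nat \<Rightarrow> bit"
    obtain W :: tables where W: "\<And>i a. W i a < 2 ^ r"
      "\<And>k e. k \<in> B \<Longrightarrow> e \<in> E \<Longrightarrow> (\<Sum>x\<in>{key e}. of_bool (bit (simple_tabulation s m W x) k)) = h (e, k)"
      by (rule ex_shift_tables[where K = B and I = "\<lambda>_. E" and A = "\<lambda>_ e. {key e}"
            and f = "\<lambda>_ e. kvec m (\<lambda>i x. character s x i) (key e)" and g = "\<lambda>k e. h (e, k)"
            and r = r and s = s and m = m]) (use assms in auto)
    have "of_bool (bit (simple_tabulation s m W (key e)) k) = h (e, k)" if "k \<in> B" "e \<in> E" for k e
      using W(2)[OF that] by (simp del: sum_of_bool_eq)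
    then show "\<exists>\<sigma>. map_pmf \<sigma> ?D = ?D \<and> (\<forall>T\<in>set_pmf ?D. \<forall>i\<in>E \<times> B. ?\<Phi> i (\<sigma> T) = ?\<Phi> i T + h i)"
      by (intro exI[of _ "xor_tables s m W"] conjI map_pmf_xor_tables W(1))
        (auto simp: simple_tabulation_xor_tables of_bool_bit_xor simp del: of_bool_eq_iff)
  qed
  moreover have "{T. \<forall>i\<in>E \<times> B. ?\<Phi> i T = (\<lambda>(e, k). of_bool (g e k)) i}
      = {T. \<forall>e\<in>E. \<forall>k\<in>B. bit (simple_tabulation s m T (key e)) k = g e k}" by auto
  ultimately show ?thesis by (simp add: card_cartesian_product)
qed

text \<open>One equality of characters consists of \<open>s\<close> bit equations. Equalities at
  different positions \<open>j\<close> concern different bits of the table entries, so linear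
  independence is needed only within each position.\<close>

lemma prob_equal_characters:
  fixes Cn :: "(nat \<times> nat \<times> nat) set"
  assumes fin: "finite Cn" and j: "\<And>x x' j. (x, x', j) \<in> Cn \<Longrightarrow> j < d"
    and ind: "\<And>j. indep {t \<in> Cn. snd (snd t) = j}
      (\<lambda>(x, x', _) q. kvec m (\<lambda>i x. character s x i) x q + kvec m (\<lambda>i x. character s x i) x' q)"
  shows "measure_pmf.prob (pmf_of_set (all_tables s m (s * d)))
      {T. \<forall>(x, x', j)\<in>Cn. character s (simple_tabulation s m T x) j = character s (simple_tabulation s m T x') j}
     = (1 / 2 ^ s) ^ card Cn"
proof -
  let ?D = "pmf_of_set (all_tables s m (s * d))"
  let ?v = "kvec m (\<lambda>i x. character s x i)"
  let ?\<Phi> = "\<lambda>((x, x', j), k) T. of_bool (bit (simple_tabulation s m T x) (j * s + k))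
    + of_bool (bit (simple_tabulation s m T x') (j * s + k)) :: bit"
  \<comment> \<open>An equality of a key with itself has the zero vector, which is not independent.
    Distinctness makes \<open>{x, x'}\<close> a genuine two-element index set below.\<close>
  have ne: "x \<noteq> x'" if "(x, x', j) \<in> Cn" for x x' j
  proof
    assume "x = x'"
    moreover have "\<exists>q. (\<Sum>t\<in>{(x, x', j)}. (\<lambda>(x, x', _) q. ?v x q + ?v x' q) t q) \<noteq> 0"
      by (rule ind[of j, unfolded indep_def, rule_format]) (use that in auto)
    ultimately show False by simp
  qed
  have "measure_pmf.prob ?D {T. \<forall>i\<in>Cn \<times> {..<s}. ?\<Phi> i T = (\<lambda>_. 0) i} = (1 / 2) ^ card (Cn \<times> {..<s})"
  proof (rule prob_of_shift_invariance)
    show "finite (Cn \<times> {..<s})" using fin by simp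
    fix h :: "(nat \<times> nat \<times> nat) \<times> nat \<Rightarrow> bit"
    \<comment> \<open>Bit \<open>k\<close> of an entry is bit \<open>k mod s\<close> of the derived
      character number \<open>k div s\<close>.\<close>
    obtain W :: tables where W: "\<And>i a. W i a < 2 ^ (s * d)"
      "\<And>k t. k \<in> {..<s * d} \<Longrightarrow> t \<in> {t \<in> Cn. snd (snd t) = k div s} \<Longrightarrow>
        (\<Sum>x\<in>{fst t, fst (snd t)}. of_bool (bit (simple_tabulation s m W x) k)) = h (t, k mod s)"
    proof (rule ex_shift_tables[where K = "{..<s * d}" and I = "\<lambda>k. {t \<in> Cn. snd (snd t) = k div s}"
          and A = "\<lambda>_ t. {fst t, fst (snd t)}" and g = "\<lambda>k t. h (t, k mod s)"
          and f = "\<lambda>_ (x, x', _) q. ?v x q + ?v x' q" and r = "s * d" and s = s and m = m])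
      show "finite {t \<in> Cn. snd (snd t) = k div s}" for k using fin by simp
    next
      fix k t assume "t \<in> {t \<in> Cn. snd (snd t) = k div s}"
      then have "fst t \<noteq> fst (snd t)" using ne by (cases t) auto
      then show "(\<lambda>(x, x', _) q. ?v x q + ?v x' q) t = (\<lambda>q. \<Sum>x\<in>{fst t, fst (snd t)}. ?v x q)"
        by (auto simp: case_prod_beta)
    qed (use ind in auto)
    have "?\<Phi> i (xor_tables s m W T) = ?\<Phi> i T + h i" if i: "i \<in> Cn \<times> {..<s}" for i T
    proof -
      obtain x x' j k where ie: "i = ((x, x', j), k)" by (metis prod.exhaust)
      have k: "k < s" "(x, x', j) \<in> Cn" "j < d" using i j ie by auto
      have "j * s + k < Suc j * s" using k by simp
      also have "\<dots> \<le> d * s" using k by (intro mult_right_mono) auto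
      finally have "j * s + k < s * d" by (simp add: mult.commute)
      moreover have "(j * s + k) div s = j" "(j * s + k) mod s = k" using k by auto
      ultimately have "(\<Sum>x\<in>{x, x'}. of_bool (bit (simple_tabulation s m W x) (j * s + k))) = h i"
        using W(2)[of "j * s + k" "(x, x', j)"] k ie by (simp del: sum_of_bool_eq)
      then show ?thesis using ne[OF k(2)]
        by (simp add: ie simple_tabulation_xor_tables of_bool_bit_xor ac_simps del: sum_of_bool_eq)
    qed
    then show "\<exists>\<sigma>. map_pmf \<sigma> ?D = ?D \<and> (\<forall>T\<in>set_pmf ?D. \<forall>i\<in>Cn \<times> {..<s}. ?\<Phi> i (\<sigma> T) = ?\<Phi> i T + h i)"
      by (intro exI[of _ "xor_tables s m W"] conjI map_pmf_xor_tables W(1)) blast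
  qed
  moreover have "{T. \<forall>i\<in>Cn \<times> {..<s}. ?\<Phi> i T = (\<lambda>_. 0) i}
    = {T. \<forall>(x, x', j)\<in>Cn. character s (simple_tabulation s m T x) j = character s (simple_tabulation s m T x') j}"
    by (rule Collect_cong) (auto simp: Ball_def character_eq_iff bit_add_eq_0_iff)
  ultimately show ?thesis by (simp add: card_cartesian_product power_mult mult.commute power_divide)
qed

lemma cond_pmf_invariant:
  assumes "map_pmf \<sigma> M = M" "set_pmf M \<inter> A \<noteq> {}" "\<And>\<omega>. \<omega> \<in> set_pmf M \<Longrightarrow> \<sigma> \<omega> \<in> A \<longleftrightarrow> \<omega> \<in> A"
  shows "map_pmf \<sigma> (cond_pmf M A) = cond_pmf M A"
proof -
  have ne: "set_pmf M \<inter> \<sigma> -` A \<noteq> {}" using assms(2,3) by blast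
  have "map_pmf \<sigma> (cond_pmf M (\<sigma> -` A)) = cond_pmf M A"
    using cond_map_pmf[OF ne] assms(1) by simp
  moreover have "cond_pmf M (\<sigma> -` A) = cond_pmf M A"
  proof (rule pmf_eqI)
    fix \<omega>
    have "measure_pmf.prob M (\<sigma> -` A) = measure_pmf.prob M A"
      by (rule measure_pmf.finite_measure_eq_AE) (auto intro!: AE_pmfI simp: assms(3))
    then show "pmf (cond_pmf M (\<sigma> -` A)) \<omega> = pmf (cond_pmf M A) \<omega>"
      using assms(3)[of \<omega>] by (auto simp: pmf_cond[OF ne] pmf_cond[OF assms(2)] set_pmf_iff)
  qed
  ultimately show ?thesis by simp
qed

text \<open>The shifting tables live on the bits outside \<open>B\<close>, so they preserve the
  revealed information and therefore the conditional distribution, while they move the remaining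
  bits of the selected keys to any pattern.\<close>

lemma remaining_bits_independentI:
  assumes T: "(T1, T2) \<in> set_pmf (random_mixed_tables s c d r)"
    and Y: "Y = selected_keys s c d X b p v (T1, T2)" "finite X"
    and ind: "indep Y (\<lambda>x. kvec (c + d) (\<lambda>i x. character s x i) (derived_key s c T1 x))"
  shows "remaining_bits_independent s c d r X b p v (T1, T2)"
proof -
  define B where "B = p ` {..<b}"
  define M where "M = random_mixed_tables s c d r"
  define A where "A = {T'. revealed B T' = revealed B (T1, T2)}"
  define D where "D = cond_pmf M A"
  define I where "I = Y \<times> ({..<r} - B)"
  define Z where "Z = (\<lambda>(x, q) T'. bit (mixed_tabulation s c d T' x) q)"
  have finY: "finite Y" using Y unfolding selected_keys_def by simp
  have ne: "set_pmf M \<inter> A \<noteq> {}" using T unfolding M_def A_def by auto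
  have prob: "measure_pmf.prob D {\<omega>. \<forall>i\<in>I. Z i \<omega> = g i} = (1 / 2) ^ card I" for g
  proof -
    have "measure_pmf.prob D {\<omega>. \<forall>i\<in>I. of_bool (Z i \<omega>) = (of_bool (g i) :: bit)} = (1 / 2) ^ card I"
    proof (rule prob_of_shift_invariance)
      show "finite I" using finY unfolding I_def by simp
      fix h :: "nat \<times> nat \<Rightarrow> bit"
      obtain W :: tables where W: "\<And>i a. W i a < 2 ^ r"
        "\<And>k e. k \<in> {..<r} - B \<Longrightarrow> e \<in> Y \<Longrightarrow>
          (\<Sum>x\<in>{derived_key s c T1 e}. of_bool (bit (simple_tabulation s (c + d) W x) k)) = h (e, k)"
        and W3: "\<And>i a k. k \<notin> {..<r} - B \<Longrightarrow> \<not> bit (W i a) k"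
        by (rule ex_shift_tables[where K = "{..<r} - B" and I = "\<lambda>_. Y"
              and A = "\<lambda>_ e. {derived_key s c T1 e}" and g = "\<lambda>k e. h (e, k)"
              and f = "\<lambda>_ e. kvec (c + d) (\<lambda>i x. character s x i) (derived_key s c T1 e)"
              and r = r and s = s and m = "c + d"])
          (use ind finY in \<open>auto simp del: sum_of_bool_eq\<close>)
      have W0: "\<And>i a k. k \<in> B \<Longrightarrow> \<not> bit (W i a) k" using W3 by blast
      let ?\<sigma> = "\<lambda>(T1, T2). (T1, xor_tables s (c + d) W T2)"
      have "map_pmf ?\<sigma> M = M"
        using map_pair[of id "xor_tables s (c + d) W" "pmf_of_set (all_tables s c (s * d))" "pmf_of_set (all_tables s (c + d) r)"]
        unfolding M_def random_mixed_tables_def by (simp add: map_pmf_xor_tables[OF W(1)])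
      moreover have "?\<sigma> \<omega> \<in> A \<longleftrightarrow> \<omega> \<in> A" if w: "\<omega> \<in> set_pmf M" for \<omega>
      proof -
        obtain S1 S2 where S: "\<omega> = (S1, S2)" by (cases \<omega>)
        have S2: "S2 \<in> all_tables s (c + d) r" using w
          by (auto simp: S M_def random_mixed_tables_def finite_all_tables all_tables_nonempty)
        have "{k \<in> B. bit (xor_tables s (c + d) W S2 i a) k} = {k \<in> B. bit (S2 i a) k}" for i a
          using S2 W0 unfolding xor_tables_def all_tables_def
          by (auto simp: PiE_iff extensional_def bit_xor_iff)
        then show ?thesis by (simp add: S A_def revealed_def)
      qed
      ultimately have "map_pmf ?\<sigma> D = D" unfolding D_def using ne by (intro cond_pmf_invariant)
      moreover have "\<forall>\<omega>\<in>set_pmf D. \<forall>i\<in>I. of_bool (Z i (?\<sigma> \<omega>)) = of_bool (Z i \<omega>) + h i"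
      proof (intro ballI)
        fix \<omega> i assume w: "\<omega> \<in> set_pmf D" "i \<in> I"
        \<comment> \<open>The first tables are part of the revealed information, so under
          \<open>D\<close> the derived keys are always those given by \<open>T1\<close>.\<close>
        obtain S2 where S: "\<omega> = (T1, S2)" using w(1)
          by (cases \<omega>) (auto simp: D_def set_cond_pmf[OF ne], simp add: A_def revealed_def)
        obtain x q where i: "i = (x, q)" by (cases i)
        show "of_bool (Z i (?\<sigma> \<omega>)) = of_bool (Z i \<omega>) + h i"
          using W(2)[of q x] w(2)
          by (simp del: sum_of_bool_eq add: S i Z_def I_def mixed_tabulation_def simple_tabulation_xor_tables of_bool_bit_xor)
      qed
      ultimately show "\<exists>\<sigma>. map_pmf \<sigma> D = D \<and> (\<forall>\<omega>\<in>set_pmf D. \<forall>i\<in>I. of_bool (Z i (\<sigma> \<omega>)) = of_bool (Z i \<omega>) + h i)"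
        by blast
    qed
    then show ?thesis by (simp only: of_bool_eq_iff)
  qed
  have "finite I" using finY unfolding I_def by simp
  from indep_vars_of_fair_bits[OF this prob] show ?thesis
    unfolding remaining_bits_independent_def Let_def
    by (simp add: Y(1) B_def D_def A_def M_def I_def Z_def)
qed

section \<open>Counting dependent tuples of keys\<close>

text \<open>Cauchy--Schwarz over the fibre values: the squared norms of the fibres add up to the
  squared norm of the whole set.\<close>

lemma sum_fibres_L2_set_le:
  assumes fin: "finite X" "finite Y" "finite R" and R: "f ` X \<subseteq> R" "f ` Y \<subseteq> R"
  shows "(\<Sum>\<alpha>\<in>R. L2_set a {x \<in> X. f x = \<alpha>} * L2_set b {y \<in> Y. f y = \<alpha>}) \<le> L2_set a X * L2_set b Y"
proof -
  have fib: "L2_set (\<lambda>\<alpha>. L2_set h {x \<in> Z. f x = \<alpha>}) R = L2_set h Z" if "finite Z" "f ` Z \<subseteq> R" for h Z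
  proof -
    have "(\<Sum>\<alpha>\<in>R. (L2_set h {x \<in> Z. f x = \<alpha>})\<^sup>2) = (\<Sum>\<alpha>\<in>R. \<Sum>x\<in>{x \<in> Z. f x = \<alpha>}. (h x)\<^sup>2)"
      by (simp add: L2_set_def sum_nonneg)
    also have "\<dots> = (\<Sum>x\<in>Z. (h x)\<^sup>2)" by (rule sum.group[OF that(1) fin(3) that(2)])
    finally show ?thesis by (simp add: L2_set_def)
  qed
  have "(\<Sum>\<alpha>\<in>R. L2_set a {x \<in> X. f x = \<alpha>} * L2_set b {y \<in> Y. f y = \<alpha>})
      = (\<Sum>\<alpha>\<in>R. \<bar>L2_set a {x \<in> X. f x = \<alpha>}\<bar> * \<bar>L2_set b {y \<in> Y. f y = \<alpha>}\<bar>)" by simp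
  also have "\<dots> \<le> L2_set (\<lambda>\<alpha>. L2_set a {x \<in> X. f x = \<alpha>}) R * L2_set (\<lambda>\<alpha>. L2_set b {y \<in> Y. f y = \<alpha>}) R"
    by (rule L2_set_mult_ineq)
  also have "\<dots> = L2_set a X * L2_set b Y" using fin R by (simp add: fib)
  finally show ?thesis .
qed

text \<open>Four keys sum to zero iff this holds for each of their characters.\<close>

definition paired :: "('a \<Rightarrow> 'q) \<Rightarrow> 'a \<Rightarrow> 'a \<Rightarrow> 'a \<Rightarrow> 'a \<Rightarrow> bool" where
  "paired f x1 x2 x3 x4 \<longleftrightarrow> f x1 = f x2 \<and> f x3 = f x4 \<or> f x1 = f x3 \<and> f x2 = f x4 \<or> f x1 = f x4 \<and> f x2 = f x3"

lemma sum_le_L2_set_of_le_one: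
  assumes "finite X" "\<And>x y. x \<in> X \<Longrightarrow> y \<in> X \<Longrightarrow> x = y" "\<And>x. x \<in> X \<Longrightarrow> (a x :: real) \<ge> 0"
  shows "sum a X \<le> L2_set a X"
proof (cases "X = {}")
  case False
  then obtain x where "X = {x}" using assms(2) by blast
  then show ?thesis using assms(3) by simp
qed simp

definition paired_sum where
  "paired_sum ch c a1 a2 a3 a4 X1 X2 X3 X4 = (\<Sum>(x1, x2, x3, x4)\<in>X1 \<times> X2 \<times> X3 \<times> X4.
     of_bool (\<forall>i<(c::nat). paired (ch i) x1 x2 x3 x4) * ((a1 x1 :: real) * a2 x2 * a3 x3 * a4 x4))"

text \<open>Induction on the number of positions. At the last position one of three pairings holds;
  once the two common characters are fixed, the keys range over fibres, to which the induction
  hypothesis applies, and Cauchy--Schwarz over each common character puts the fibres together again.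
  Four separate sets are needed because the fibres differ from argument to argument.\<close>

lemma paired_sum_le:
  fixes a1 a2 a3 a4 :: "'a \<Rightarrow> real" and ch :: "nat \<Rightarrow> 'a \<Rightarrow> 'q"
  assumes nonneg: "\<And>x. a1 x \<ge> 0" "\<And>x. a2 x \<ge> 0" "\<And>x. a3 x \<ge> 0" "\<And>x. a4 x \<ge> 0"
  assumes "\<forall>X\<in>{X1, X2, X3, X4}. finite X \<and> (\<forall>x\<in>X. \<forall>y\<in>X. (\<forall>i<c. ch i x = ch i y) \<longrightarrow> x = y)"
  shows "paired_sum ch c a1 a2 a3 a4 X1 X2 X3 X4
    \<le> 3 ^ c * (L2_set a1 X1 * L2_set a2 X2 * L2_set a3 X3 * L2_set a4 X4)"
  using assms(5)
proof (induction c arbitrary: X1 X2 X3 X4)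
  case 0
  have "paired_sum ch 0 a1 a2 a3 a4 X1 X2 X3 X4 = sum a1 X1 * sum a2 X2 * sum a3 X3 * sum a4 X4"
    unfolding paired_sum_def sum.cartesian_product[symmetric]
    by (simp add: sum_distrib_left sum_distrib_right mult.assoc sum.swap[of _ X1] flip: sum_distrib_left)
  \<comment> \<open>With no position left to distinguish keys, each set has at most one
    element.\<close>
  also have "\<dots> \<le> L2_set a1 X1 * L2_set a2 X2 * L2_set a3 X3 * L2_set a4 X4"
    using 0 nonneg by (intro mult_mono sum_le_L2_set_of_le_one mult_nonneg_nonneg sum_nonneg L2_set_nonneg) auto
  finally show ?case by simp
next
  case (Suc c)
  define f where "f = ch c"
  define R where "R = f ` X1 \<union> f ` X2 \<union> f ` X3 \<union> f ` X4"
  define F where "F X \<alpha> = {x \<in> X. f x = \<alpha>}" for X \<alpha>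
  define h where "h = (\<lambda>(x1, x2, x3, x4). of_bool (\<forall>i<c. paired (ch i) x1 x2 x3 x4) * (a1 x1 * a2 x2 * a3 x3 * a4 x4))"
  have h0: "h t \<ge> 0" for t unfolding h_def using nonneg by (auto simp: case_prod_beta)
  let ?P = "X1 \<times> X2 \<times> X3 \<times> X4"
  let ?L = "L2_set a1 X1 * L2_set a2 X2 * L2_set a3 X3 * L2_set a4 X4"
  have fin: "finite X1" "finite X2" "finite X3" "finite X4" "finite R"
    using Suc.prems unfolding R_def by auto
  have fP: "finite ?P" using fin by auto
  have IH: "paired_sum ch c a1 a2 a3 a4 (F X1 \<alpha>1) (F X2 \<alpha>2) (F X3 \<alpha>3) (F X4 \<alpha>4)
      \<le> 3 ^ c * (L2_set a1 (F X1 \<alpha>1) * L2_set a2 (F X2 \<alpha>2) * L2_set a3 (F X3 \<alpha>3) * L2_set a4 (F X4 \<alpha>4))" for \<alpha>1 \<alpha>2 \<alpha>3 \<alpha>4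
  proof (rule Suc.IH)
    have "finite (F X \<alpha>) \<and> (\<forall>x\<in>F X \<alpha>. \<forall>y\<in>F X \<alpha>. (\<forall>i<c. ch i x = ch i y) \<longrightarrow> x = y)"
      if "X \<in> {X1, X2, X3, X4}" for X \<alpha>
      using Suc.prems that unfolding F_def f_def by (fastforce simp: less_Suc_eq)
    then show "\<forall>X\<in>{F X1 \<alpha>1, F X2 \<alpha>2, F X3 \<alpha>3, F X4 \<alpha>4}. finite X \<and> (\<forall>x\<in>X. \<forall>y\<in>X. (\<forall>i<c. ch i x = ch i y) \<longrightarrow> x = y)"
      by blast
  qed
  have cs: "(\<Sum>\<alpha>\<in>R. L2_set a (F X \<alpha>) * L2_set b (F Y \<alpha>)) \<le> L2_set a X * L2_set b Y"
    if "X \<in> {X1, X2, X3, X4}" "Y \<in> {X1, X2, X3, X4}" for a b :: "'a \<Rightarrow> real" and X Y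
    unfolding F_def by (rule sum_fibres_L2_set_le) (use that fin in \<open>auto simp: R_def\<close>)
  have two: "(\<Sum>(\<alpha>, \<beta>)\<in>R \<times> R. 3 ^ c * ((L2_set a (F X \<alpha>) * L2_set b (F Y \<alpha>)) * (L2_set a' (F X' \<beta>) * L2_set b' (F Y' \<beta>))))
      \<le> 3 ^ c * ((L2_set a X * L2_set b Y) * (L2_set a' X' * L2_set b' Y'))"
    if "X \<in> {X1, X2, X3, X4}" "Y \<in> {X1, X2, X3, X4}" "X' \<in> {X1, X2, X3, X4}" "Y' \<in> {X1, X2, X3, X4}"
    for a b a' b' :: "'a \<Rightarrow> real" and X Y X' Y'
  proof -
    have "(\<Sum>(\<alpha>, \<beta>)\<in>R \<times> R. 3 ^ c * ((L2_set a (F X \<alpha>) * L2_set b (F Y \<alpha>)) * (L2_set a' (F X' \<beta>) * L2_set b' (F Y' \<beta>))))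
      = 3 ^ c * ((\<Sum>\<alpha>\<in>R. L2_set a (F X \<alpha>) * L2_set b (F Y \<alpha>)) * (\<Sum>\<alpha>\<in>R. L2_set a' (F X' \<alpha>) * L2_set b' (F Y' \<alpha>)))"
      by (simp only: sum_product sum.cartesian_product) (simp add: sum_distrib_left case_prod_beta)
    also have "\<dots> \<le> 3 ^ c * ((L2_set a X * L2_set b Y) * (L2_set a' X' * L2_set b' Y'))"
      using that by (intro mult_left_mono mult_mono cs sum_nonneg mult_nonneg_nonneg L2_set_nonneg) auto
    finally show ?thesis .
  qed
  define Q1 where "Q1 = {(x1, x2, x3, x4). f x1 = f x2 \<and> f x3 = f x4}"
  define Q2 where "Q2 = {(x1, x2, x3, x4). f x1 = f x3 \<and> f x2 = f x4}"
  define Q3 where "Q3 = {(x1, x2, x3, x4). f x1 = f x4 \<and> f x2 = f x3}"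
  have g: "sum h (?P \<inter> Q) = (\<Sum>\<gamma>\<in>R \<times> R. sum h {t \<in> ?P \<inter> Q. k t = \<gamma>})"
    if "\<And>t. t \<in> ?P \<Longrightarrow> k t \<in> R \<times> R" for Q and k :: "'a \<times> 'a \<times> 'a \<times> 'a \<Rightarrow> 'q \<times> 'q"
  proof (rule sum.group[symmetric])
    show "finite (?P \<inter> Q)" "finite (R \<times> R)" using fP fin(5) by simp_all
    show "k ` (?P \<inter> Q) \<subseteq> R \<times> R" using that by blast
  qed
  have s1: "sum h (?P \<inter> Q1) \<le> 3 ^ c * ?L"
  proof -
    have "sum h (?P \<inter> Q1) = (\<Sum>(\<alpha>, \<beta>)\<in>R \<times> R. paired_sum ch c a1 a2 a3 a4 (F X1 \<alpha>) (F X2 \<alpha>) (F X3 \<beta>) (F X4 \<beta>))"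
      by (subst g[where k = "\<lambda>(x1, x2, x3, x4). (f x1, f x3)"])
        (auto simp: R_def paired_sum_def h_def Q1_def F_def intro!: sum.cong)
    also have "\<dots> \<le> (\<Sum>(\<alpha>, \<beta>)\<in>R \<times> R. 3 ^ c * ((L2_set a1 (F X1 \<alpha>) * L2_set a2 (F X2 \<alpha>)) * (L2_set a3 (F X3 \<beta>) * L2_set a4 (F X4 \<beta>))))"
      by (intro sum_mono) (use IH in \<open>auto simp: mult.assoc\<close>)
    also have "\<dots> \<le> 3 ^ c * ((L2_set a1 X1 * L2_set a2 X2) * (L2_set a3 X3 * L2_set a4 X4))"
      by (rule two) auto
    finally show ?thesis by (simp add: ac_simps)
  qed
  have s2: "sum h (?P \<inter> Q2) \<le> 3 ^ c * ?L"
  proof -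
    have "sum h (?P \<inter> Q2) = (\<Sum>(\<alpha>, \<beta>)\<in>R \<times> R. paired_sum ch c a1 a2 a3 a4 (F X1 \<alpha>) (F X2 \<beta>) (F X3 \<alpha>) (F X4 \<beta>))"
      by (subst g[where k = "\<lambda>(x1, x2, x3, x4). (f x1, f x2)"])
        (auto simp: R_def paired_sum_def h_def Q2_def F_def intro!: sum.cong)
    also have "\<dots> \<le> (\<Sum>(\<alpha>, \<beta>)\<in>R \<times> R. 3 ^ c * ((L2_set a1 (F X1 \<alpha>) * L2_set a3 (F X3 \<alpha>)) * (L2_set a2 (F X2 \<beta>) * L2_set a4 (F X4 \<beta>))))"
      by (intro sum_mono) (use IH in \<open>auto simp: ac_simps\<close>)
    also have "\<dots> \<le> 3 ^ c * ((L2_set a1 X1 * L2_set a3 X3) * (L2_set a2 X2 * L2_set a4 X4))"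
      by (rule two) auto
    finally show ?thesis by (simp add: ac_simps)
  qed
  have s3: "sum h (?P \<inter> Q3) \<le> 3 ^ c * ?L"
  proof -
    have "sum h (?P \<inter> Q3) = (\<Sum>(\<alpha>, \<beta>)\<in>R \<times> R. paired_sum ch c a1 a2 a3 a4 (F X1 \<alpha>) (F X2 \<beta>) (F X3 \<beta>) (F X4 \<alpha>))"
      by (subst g[where k = "\<lambda>(x1, x2, x3, x4). (f x1, f x2)"])
        (auto simp: R_def paired_sum_def h_def Q3_def F_def intro!: sum.cong)
    also have "\<dots> \<le> (\<Sum>(\<alpha>, \<beta>)\<in>R \<times> R. 3 ^ c * ((L2_set a1 (F X1 \<alpha>) * L2_set a4 (F X4 \<alpha>)) * (L2_set a2 (F X2 \<beta>) * L2_set a3 (F X3 \<beta>))))"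
      by (intro sum_mono) (use IH in \<open>auto simp: ac_simps\<close>)
    also have "\<dots> \<le> 3 ^ c * ((L2_set a1 X1 * L2_set a4 X4) * (L2_set a2 X2 * L2_set a3 X3))"
      by (rule two) auto
    finally show ?thesis by (simp add: ac_simps)
  qed
  have "paired_sum ch (Suc c) a1 a2 a3 a4 X1 X2 X3 X4 = (\<Sum>t\<in>?P. if t \<in> Q1 \<union> Q2 \<union> Q3 then h t else 0)"
    unfolding paired_sum_def
    by (intro sum.cong) (auto simp: h_def Q1_def Q2_def Q3_def paired_def less_Suc_eq f_def)
  \<comment> \<open>The pairings overlap when more than two characters coincide, so this is only an
    inequality.\<close>
  also have "\<dots> \<le> (\<Sum>t\<in>?P. (if t \<in> Q1 then h t else 0) + (if t \<in> Q2 then h t else 0) + (if t \<in> Q3 then h t else 0))"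
    by (intro sum_mono) (auto simp: h0)
  also have "\<dots> = sum h (?P \<inter> Q1) + sum h (?P \<inter> Q2) + sum h (?P \<inter> Q3)"
    by (simp only: sum.distrib sum.inter_restrict[OF fP])
  also have "\<dots> \<le> 3 ^ Suc c * ?L" using s1 s2 s3 by simp
  finally show ?case .
qed

lemma paired_of_kvec_sum:
  assumes "\<And>q. kvec c ch x1 q + kvec c ch x2 q = kvec c ch x3 q + kvec c ch x4 q" "i < c"
  shows "paired (ch i) x1 x2 x3 x4"
proof -
  have "of_bool (ch i x1 = a) + of_bool (ch i x2 = a)
      = (of_bool (ch i x3 = a) + of_bool (ch i x4 = a) :: bit)" for a
    using assms(1)[of "(i, a)"] assms(2) by (simp add: kvec_def)
  then have "((ch i x1 = a) \<noteq> (ch i x2 = a)) = ((ch i x3 = a) \<noteq> (ch i x4 = a))" for a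
    by (simp only: of_bool_xor_bit[symmetric] of_bool_eq_iff)
  from this[of "ch i x1"] this[of "ch i x2"] this[of "ch i x3"] show ?thesis
    unfolding paired_def by metis
qed

lemma L2_set_one: "L2_set (\<lambda>_. 1) X = sqrt (real (card X))"
  by (simp add: L2_set_def)

text \<open>A weighted representation function of sums of two keys shifted by \<open>t\<close>; its
  squared L2 norm is a weighted additive energy.\<close>

definition pair_weight :: "'a set \<Rightarrow> ('a \<Rightarrow> 'q \<Rightarrow> bit) \<Rightarrow> ('a \<Rightarrow> real) \<Rightarrow> ('q \<Rightarrow> bit) \<Rightarrow> ('q \<Rightarrow> bit) \<Rightarrow> real" where
  "pair_weight X v a t u = (\<Sum>y\<in>X. \<Sum>x\<in>X. a y * of_bool (\<forall>q. v y q + v x q + t q = u q))"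

definition keys_inj :: "'a set \<Rightarrow> nat \<Rightarrow> (nat \<Rightarrow> 'a \<Rightarrow> 'q) \<Rightarrow> bool" where
  "keys_inj X c ch \<longleftrightarrow> (\<forall>x\<in>X. \<forall>y\<in>X. (\<forall>i<c. ch i x = ch i y) \<longrightarrow> x = y)"

text \<open>Expanding the square compares two representations of the same \<open>u\<close>. The
  shift cancels and four keys with zero sum remain, two of them weighted by \<open>a\<close> and two
  by one.\<close>

lemma L2_set_pair_weight:
  fixes a :: "'a \<Rightarrow> real"
  assumes fin: "finite X" "finite U" and inj: "keys_inj X c ch" and nonneg: "\<And>x. a x \<ge> 0"
  shows "L2_set (pair_weight X (kvec c ch) a t) U \<le> sqrt (3 ^ c * real (card X)) * L2_set a X"
proof -
  let ?v = "kvec c ch"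
  let ?e = "\<lambda>y x u. of_bool (\<forall>q. ?v y q + ?v x q + t q = u q) :: real"
  have "(\<Sum>u\<in>U. (pair_weight X ?v a t u)\<^sup>2)
      = (\<Sum>u\<in>U. \<Sum>y\<in>X. \<Sum>y'\<in>X. \<Sum>x\<in>X. \<Sum>x'\<in>X. (a y * ?e y x u) * (a y' * ?e y' x' u))"
    unfolding pair_weight_def power2_eq_square sum_product ..
  also have "\<dots> = (\<Sum>y\<in>X. \<Sum>y'\<in>X. \<Sum>x\<in>X. \<Sum>x'\<in>X. \<Sum>u\<in>U. (a y * ?e y x u) * (a y' * ?e y' x' u))"
    by (simp only: sum.swap[where A = U])
  also have "\<dots> \<le> (\<Sum>y\<in>X. \<Sum>y'\<in>X. \<Sum>x\<in>X. \<Sum>x'\<in>X. of_bool (\<forall>i<c. paired (ch i) y y' x x') * (a y * a y' * 1 * 1))"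
  proof (intro sum_mono)
    fix y x y' x'
    have "(\<Sum>u\<in>U. ?e y x u * ?e y' x' u) \<le> of_bool (\<forall>i<c. paired (ch i) y y' x x')"
    proof (cases "\<forall>i<c. paired (ch i) y y' x x'")
      case True
      have "(\<Sum>u\<in>U. ?e y x u * ?e y' x' u) \<le> (\<Sum>u\<in>U. if u = (\<lambda>q. ?v y q + ?v x q + t q) then 1 else 0)"
        by (intro sum_mono) (auto simp: fun_eq_iff)
      also have "\<dots> \<le> 1" using fin(2) by simp
      finally show ?thesis using True by simp
    next
      case False
      then obtain i where i: "i < c" "\<not> paired (ch i) y y' x x'" by blast
      have "?e y x u * ?e y' x' u = 0" for u
      proof (rule ccontr)
        assume "?e y x u * ?e y' x' u \<noteq> 0"
        then have "\<And>q. ?v y q + ?v x q + t q = u q" "\<And>q. ?v y' q + ?v x' q + t q = u q"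
          by (auto split: if_splits)
        then have "\<And>q. ?v y q + ?v x q = ?v y' q + ?v x' q" by (metis add_right_cancel)
        from paired_of_kvec_sum[OF this i(1)] i(2) show False unfolding paired_def by metis
      qed
      then show ?thesis by (simp only: sum.neutral_const) simp
    qed
    then have "(a y * a y') * (\<Sum>u\<in>U. ?e y x u * ?e y' x' u)
        \<le> (a y * a y') * of_bool (\<forall>i<c. paired (ch i) y y' x x')"
      using nonneg by (intro mult_left_mono) auto
    then show "(\<Sum>u\<in>U. (a y * ?e y x u) * (a y' * ?e y' x' u))
        \<le> of_bool (\<forall>i<c. paired (ch i) y y' x x') * (a y * a y' * 1 * 1)"
      by (simp only: sum_distrib_left ac_simps mult_1_right)
  qed
  also have "\<dots> = paired_sum ch c a a (\<lambda>_. 1) (\<lambda>_. 1) X X X X"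
    unfolding paired_sum_def sum.cartesian_product ..
  also have "\<dots> \<le> 3 ^ c * (L2_set a X * L2_set a X * L2_set (\<lambda>_. 1) X * L2_set (\<lambda>_. 1) X)"
    by (rule paired_sum_le) (use nonneg fin inj in \<open>auto simp: keys_inj_def\<close>)
  also have "\<dots> = 3 ^ c * real (card X) * (L2_set a X)\<^sup>2"
    by (simp add: L2_set_one power2_eq_square)
  finally have "L2_set (pair_weight X ?v a t) U \<le> sqrt (3 ^ c * real (card X) * (L2_set a X)\<^sup>2)"
    unfolding L2_set_def[of "pair_weight X ?v a t"] by (rule real_sqrt_le_mono)
  then show ?thesis by (simp add: real_sqrt_mult)
qed

text \<open>The equation is split as y + x + t = y' + w and Cauchy--Schwarz is applied over the
  common value, so that \<open>a\<close> and \<open>b\<close> end up in different factors. For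
  weights one the bound is 3^c |X|^2, one power of |X| less than the number of free triples.\<close>

lemma zero_quadruples_le:
  fixes a b :: "'a \<Rightarrow> real"
  assumes fin: "finite X" and inj: "keys_inj X c ch" and nonneg: "\<And>x. a x \<ge> 0" "\<And>x. b x \<ge> 0"
  shows "(\<Sum>y\<in>X. \<Sum>y'\<in>X. \<Sum>x\<in>X. \<Sum>w\<in>X. a y * b y' *
        of_bool (\<forall>q. kvec c ch w q = kvec c ch y q + kvec c ch y' q + kvec c ch x q + t q))
    \<le> 3 ^ c * real (card X) * L2_set a X * L2_set b X"
proof -
  let ?v = "kvec c ch"
  \<comment> \<open>\<open>U\<close> contains every possible left-hand side, so each solution is
    counted at exactly one \<open>u\<close>.\<close>
  define U where "U = (\<lambda>(y, x). (\<lambda>q. ?v y q + ?v x q + t q)) ` (X \<times> X)"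
  have finU: "finite U" using fin unfolding U_def by simp
  let ?A = "pair_weight X ?v a t" and ?B = "pair_weight X ?v b (\<lambda>_. 0)"
  have pw0: "pair_weight X ?v h t' u \<ge> 0" if "\<And>x. h x \<ge> 0" for h t' u
    unfolding pair_weight_def using that by (intro sum_nonneg) auto
  have "(\<Sum>y\<in>X. \<Sum>y'\<in>X. \<Sum>x\<in>X. \<Sum>w\<in>X. a y * b y' * of_bool (\<forall>q. ?v w q = ?v y q + ?v y' q + ?v x q + t q))
      = (\<Sum>y\<in>X. \<Sum>y'\<in>X. \<Sum>x\<in>X. \<Sum>w\<in>X. \<Sum>u\<in>U.
        (a y * of_bool (\<forall>q. ?v y q + ?v x q + t q = u q)) * (b y' * of_bool (\<forall>q. ?v y' q + ?v w q + 0 = u q)))"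
  proof (intro sum.cong refl)
    fix y y' x w assume X: "y \<in> X" "x \<in> X"
    define u0 where "u0 = (\<lambda>q. ?v y q + ?v x q + t q)"
    have "u0 \<in> U" using X unfolding U_def u0_def by auto
    have flip: "(?v w q = ?v y q + ?v y' q + ?v x q + t q) = (?v y' q + ?v w q + 0 = u0 q)" for q
      unfolding u0_def
      by (cases "?v w q"; cases "?v y q"; cases "?v y' q"; cases "?v x q"; cases "t q") (simp_all add: add_bit_eq_xor)
    have "(\<Sum>u\<in>U. (a y * of_bool (\<forall>q. ?v y q + ?v x q + t q = u q)) * (b y' * of_bool (\<forall>q. ?v y' q + ?v w q + 0 = u q)))
        = (\<Sum>u\<in>U. if u = u0 then a y * (b y' * of_bool (\<forall>q. ?v y' q + ?v w q + 0 = u0 q)) else 0)"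
      by (intro sum.cong) (auto simp: u0_def fun_eq_iff)
    also have "\<dots> = a y * (b y' * of_bool (\<forall>q. ?v y' q + ?v w q + 0 = u0 q))"
      using finU \<open>u0 \<in> U\<close> by simp
    finally show "a y * b y' * of_bool (\<forall>q. ?v w q = ?v y q + ?v y' q + ?v x q + t q)
      = (\<Sum>u\<in>U. (a y * of_bool (\<forall>q. ?v y q + ?v x q + t q = u q)) * (b y' * of_bool (\<forall>q. ?v y' q + ?v w q + 0 = u q)))"
      by (simp only: flip mult.assoc)
  qed
  also have "\<dots> = (\<Sum>u\<in>U. ?A u * ?B u)"
    unfolding pair_weight_def sum_product
    by (simp only: sum.swap[where A = U])
  also have "\<dots> = (\<Sum>u\<in>U. \<bar>?A u\<bar> * \<bar>?B u\<bar>)" by (simp add: pw0 nonneg)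
  also have "\<dots> \<le> L2_set ?A U * L2_set ?B U" by (rule L2_set_mult_ineq)
  also have "\<dots> \<le> (sqrt (3 ^ c * real (card X)) * L2_set a X) * (sqrt (3 ^ c * real (card X)) * L2_set b X)"
    by (intro mult_mono L2_set_pair_weight fin finU inj nonneg mult_nonneg_nonneg L2_set_nonneg) auto
  also have "\<dots> = (sqrt (3 ^ c * real (card X)))\<^sup>2 * L2_set a X * L2_set b X"
    by (simp only: power2_eq_square ac_simps)
  finally show ?thesis by simp
qed

lemma sum_PiE_insert:
  assumes "i \<notin> I"
  shows "(\<Sum>f\<in>insert i I \<rightarrow>\<^sub>E X. \<Phi> f) = (\<Sum>x\<in>X. \<Sum>f\<in>I \<rightarrow>\<^sub>E X. \<Phi> (f(i := x)))"
  unfolding PiE_insert_eq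
  by (subst sum.reindex[OF inj_combinator[OF assms]]) (simp add: sum.cartesian_product case_prod_beta)

text \<open>All slots but a few are frozen, and their keys in \<open>S\<close> contribute a fixed
  shift. One power of |X| is saved against the trivial bound for walks whose two weights sit at the
  same root.\<close>

lemma zero_tuples_le:
  fixes a b :: "'a \<Rightarrow> real"
  assumes fin: "finite X" and inj: "keys_inj X c ch" and nonneg: "\<And>x. a x \<ge> 0" "\<And>x. b x \<ge> 0"
    and S: "S \<subseteq> {..l}" "card S \<ge> 3" and j: "0 \<in> S \<and> j \<in> S \<and> j \<noteq> 0 \<or> 0 \<notin> S \<and> j = 0"
  shows "(\<Sum>f\<in>{..l} \<rightarrow>\<^sub>E X. \<Sum>w\<in>X. a (f 0) * b (f j) * of_bool (\<forall>q. kvec c ch w q = (\<Sum>t\<in>S. kvec c ch (f t) q)))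
    \<le> 3 ^ c * real (card X) ^ (l - 1) * L2_set a X * L2_set b X"
proof -
  let ?v = "kvec c ch"
  let ?N = "real (card X)"
  let ?\<Phi> = "\<lambda>f. \<Sum>w\<in>X. a (f 0) * b (f j) * of_bool (\<forall>q. ?v w q = (\<Sum>t\<in>S. ?v (f t) q))"
  have finS: "finite S" using S(1) finite_subset by blast
  from j show ?thesis
  proof
    assume j: "0 \<in> S \<and> j \<in> S \<and> j \<noteq> 0"
    \<comment> \<open>A third slot of \<open>S\<close>, carrying no weight, completes root, next
      root and \<open>w\<close> to a quadruple.\<close>
    have "\<not> S \<subseteq> {0, j}" using S(2) card_mono[of "{0, j}" S] by (auto simp: card_insert_if split: if_splits)
    then obtain k where k: "k \<in> S" "k \<noteq> 0" "k \<noteq> j" by auto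
    define R where "R = {..l} - {0, j, k}"
    have ins: "{..l} = insert 0 (insert j (insert k R))" using S(1) j k unfolding R_def by auto
    have nR: "0 \<notin> insert j (insert k R)" "j \<notin> insert k R" "k \<notin> R" using j k unfolding R_def by auto
    have "card {..l} = card R + 3"
      unfolding ins using nR by (simp add: R_def)
    then have cR: "card R = l - 2" "l \<ge> 2" by auto
    have Ssplit: "(\<Sum>t\<in>S. h t) = h 0 + (h j + (h k + (\<Sum>t\<in>S - {0, j, k}. h t)))" for h :: "nat \<Rightarrow> bit"
    proof -
      have "S = insert 0 (insert j (insert k (S - {0, j, k})))" using j k by auto
      then have "(\<Sum>t\<in>S. h t) = (\<Sum>t\<in>insert 0 (insert j (insert k (S - {0, j, k}))). h t)" by simp
      also have "\<dots> = h 0 + (h j + (h k + (\<Sum>t\<in>S - {0, j, k}. h t)))" using finS j k by simp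
      finally show ?thesis .
    qed
    have "(\<Sum>f\<in>{..l} \<rightarrow>\<^sub>E X. ?\<Phi> f)
        = (\<Sum>y\<in>X. \<Sum>y'\<in>X. \<Sum>x\<in>X. \<Sum>g\<in>R \<rightarrow>\<^sub>E X. ?\<Phi> (g(k := x, j := y', 0 := y)))"
      unfolding ins by (simp only: sum_PiE_insert[OF nR(1)] sum_PiE_insert[OF nR(2)] sum_PiE_insert[OF nR(3)])
    also have "\<dots> = (\<Sum>y\<in>X. \<Sum>y'\<in>X. \<Sum>x\<in>X. \<Sum>g\<in>R \<rightarrow>\<^sub>E X. \<Sum>w\<in>X. a y * b y' *
        of_bool (\<forall>q. ?v w q = ?v y q + ?v y' q + ?v x q + (\<Sum>t\<in>S - {0, j, k}. ?v (g t) q)))"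
      using j k by (intro sum.cong refl) (simp add: Ssplit add.assoc)
    also have "\<dots> = (\<Sum>g\<in>R \<rightarrow>\<^sub>E X. \<Sum>y\<in>X. \<Sum>y'\<in>X. \<Sum>x\<in>X. \<Sum>w\<in>X. a y * b y' *
        of_bool (\<forall>q. ?v w q = ?v y q + ?v y' q + ?v x q + (\<Sum>t\<in>S - {0, j, k}. ?v (g t) q)))"
      by (simp only: sum.swap[where B = "R \<rightarrow>\<^sub>E X"])
    also have "\<dots> \<le> (\<Sum>g\<in>R \<rightarrow>\<^sub>E X. 3 ^ c * ?N * L2_set a X * L2_set b X)"
      by (intro sum_mono zero_quadruples_le fin inj nonneg)
    also have "\<dots> = 3 ^ c * (?N ^ (l - 2) * ?N) * L2_set a X * L2_set b X"
      using cR by (simp add: card_PiE R_def)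
    also have "?N ^ (l - 2) * ?N = ?N ^ (l - 1)"
      using cR(2) by (metis Suc_1 Suc_diff_Suc less_eq_Suc_le power_Suc2)
    finally show ?thesis .
  next
    assume j: "0 \<notin> S \<and> j = 0"
    \<comment> \<open>Here the root takes no part in the dependency, so the sum splits into the root
      factor and an unweighted quadruple count on three slots of \<open>S\<close> and
      \<open>w\<close>.\<close>
    obtain k1 k2 k3 where k: "{k1, k2, k3} \<subseteq> S" "k1 \<noteq> k2" "k1 \<noteq> k3" "k2 \<noteq> k3"
    proof -
      obtain S' where "S' \<subseteq> S" "card S' = 3" using S(2) by (metis obtain_subset_with_card_n)
      then show thesis using that by (auto simp: card_3_iff)
    qed
    have k0: "k1 \<noteq> 0" "k2 \<noteq> 0" "k3 \<noteq> 0" using j k(1) by (metis insert_subset)+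
    define R where "R = {..l} - {0, k1, k2, k3}"
    have ins: "{..l} = insert 0 (insert k1 (insert k2 (insert k3 R)))" using S(1) j k unfolding R_def by auto
    have nR: "0 \<notin> insert k1 (insert k2 (insert k3 R))" "k1 \<notin> insert k2 (insert k3 R)" "k2 \<notin> insert k3 R" "k3 \<notin> R"
      using k k0 unfolding R_def by auto
    have "card {..l} = card R + 4"
      unfolding ins using nR by (simp add: R_def)
    then have cR: "card R = l - 3" "l \<ge> 3" by auto
    have Ssplit: "(\<Sum>t\<in>S. h t) = h k1 + (h k2 + (h k3 + (\<Sum>t\<in>S - {k1, k2, k3}. h t)))" for h :: "nat \<Rightarrow> bit"
    proof -
      have "S = insert k1 (insert k2 (insert k3 (S - {k1, k2, k3})))" using k by auto
      then have "(\<Sum>t\<in>S. h t) = (\<Sum>t\<in>insert k1 (insert k2 (insert k3 (S - {k1, k2, k3}))). h t)" by simp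
      also have "\<dots> = h k1 + (h k2 + (h k3 + (\<Sum>t\<in>S - {k1, k2, k3}. h t)))" using finS k by simp
      finally show ?thesis .
    qed
    have out: "(\<Sum>t\<in>S - {k1, k2, k3}. ?v ((g(k3 := x3, k2 := x2, k1 := x1, 0 := y)) t) q)
        = (\<Sum>t\<in>S - {k1, k2, k3}. ?v (g t) q)" for g x1 x2 x3 y q
      using j by (intro sum.cong) auto
    have cond: "(\<Sum>t\<in>S. ?v ((g(k3 := x3, k2 := x2, k1 := x1, 0 := y)) t) q)
        = ?v x1 q + ?v x2 q + ?v x3 q + (\<Sum>t\<in>S - {k1, k2, k3}. ?v (g t) q)" for g x1 x2 x3 y q
      unfolding Ssplit out using k k0 by (simp add: add.assoc)
    let ?e = "\<lambda>g x1 x2 x3 w. of_bool (\<forall>q. ?v w q = ?v x1 q + ?v x2 q + ?v x3 q + (\<Sum>t\<in>S - {k1, k2, k3}. ?v (g t) q)) :: real"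
    have "(\<Sum>f\<in>{..l} \<rightarrow>\<^sub>E X. ?\<Phi> f)
        = (\<Sum>y\<in>X. \<Sum>x1\<in>X. \<Sum>x2\<in>X. \<Sum>x3\<in>X. \<Sum>g\<in>R \<rightarrow>\<^sub>E X. ?\<Phi> (g(k3 := x3, k2 := x2, k1 := x1, 0 := y)))"
      unfolding ins by (simp only: sum_PiE_insert[OF nR(1)] sum_PiE_insert[OF nR(2)] sum_PiE_insert[OF nR(3)] sum_PiE_insert[OF nR(4)])
    also have "\<dots> = (\<Sum>y\<in>X. \<Sum>x1\<in>X. \<Sum>x2\<in>X. \<Sum>x3\<in>X. \<Sum>g\<in>R \<rightarrow>\<^sub>E X. \<Sum>w\<in>X. a y * b y * ?e g x1 x2 x3 w)"
      unfolding cond using j by (intro sum.cong refl) simp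
    also have "\<dots> = (\<Sum>g\<in>R \<rightarrow>\<^sub>E X. \<Sum>y\<in>X. \<Sum>x1\<in>X. \<Sum>x2\<in>X. \<Sum>x3\<in>X. \<Sum>w\<in>X. a y * b y * ?e g x1 x2 x3 w)"
      by (simp only: sum.swap[where B = "R \<rightarrow>\<^sub>E X"])
    also have "\<dots> = (\<Sum>g\<in>R \<rightarrow>\<^sub>E X. (\<Sum>y\<in>X. a y * b y) * (\<Sum>x1\<in>X. \<Sum>x2\<in>X. \<Sum>x3\<in>X. \<Sum>w\<in>X. 1 * 1 * ?e g x1 x2 x3 w))"
      by (simp only: sum_distrib_right) (simp add: sum_distrib_left)
    also have "\<dots> \<le> (\<Sum>g\<in>R \<rightarrow>\<^sub>E X. (L2_set a X * L2_set b X) * (3 ^ c * ?N * L2_set (\<lambda>_. 1) X * L2_set (\<lambda>_. 1) X))"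
    proof (intro sum_mono mult_mono zero_quadruples_le fin inj)
      have "(\<Sum>y\<in>X. a y * b y) = (\<Sum>y\<in>X. \<bar>a y\<bar> * \<bar>b y\<bar>)" by (simp add: nonneg)
      also have "\<dots> \<le> L2_set a X * L2_set b X" by (rule L2_set_mult_ineq)
      finally show "(\<Sum>y\<in>X. a y * b y) \<le> L2_set a X * L2_set b X" .
    qed (auto intro!: sum_nonneg mult_nonneg_nonneg)
    also have "\<dots> = 3 ^ c * (?N ^ (l - 3) * ?N * ?N) * L2_set a X * L2_set b X"
      using cR by (simp add: card_PiE R_def L2_set_one)
    also have "?N ^ (l - 3) * ?N * ?N = ?N ^ (l - 1)"
    proof -
      obtain e where "l = e + 3" using cR(2) le_Suc_ex by (metis add.commute)
      then show ?thesis by (simp add: numeral_3_eq_3)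
    qed
    finally show ?thesis .
  qed
qed

section \<open>Large dependencies, in which many slots are determined by the others\<close>

text \<open>Each chosen slot rules out itself and its \<open>c\<close> partners for the future, at
  most \<open>c + 1\<close> slots. A partner of a chosen slot is thus either never chosen or chosen
  earlier, which permits recovering the slots in order.\<close>

lemma greedy_sequence:
  assumes "finite B" "b0 \<in> B" "\<And>t i. t \<in> B \<Longrightarrow> i < c \<Longrightarrow> p t i \<noteq> t" "card B > D * (c + 1)"
  shows "\<exists>q. q 0 = b0 \<and> q ` {..D} \<subseteq> B \<and> inj_on q {..D} \<and>
    (\<forall>t\<le>D. \<forall>i<c. \<forall>s. t \<le> s \<and> s \<le> D \<longrightarrow> p (q t) i \<noteq> q s)"
  using assms(4)
proof (induction D)
  case 0
  show ?case by (rule exI[of _ "\<lambda>_. b0"]) (use assms(2,3) in auto)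
next
  case (Suc D)
  then obtain q where q: "q 0 = b0" "q ` {..D} \<subseteq> B" "inj_on q {..D}"
    "\<And>t i s. t \<le> D \<Longrightarrow> i < c \<Longrightarrow> t \<le> s \<Longrightarrow> s \<le> D \<Longrightarrow> p (q t) i \<noteq> q s" by auto
  define F where "F = q ` {..D} \<union> (\<lambda>(t, i). p (q t) i) ` ({..D} \<times> {..<c})"
  have "card F \<le> card (q ` {..D}) + card ((\<lambda>(t, i). p (q t) i) ` ({..D} \<times> {..<c}))"
    unfolding F_def by (rule card_Un_le)
  also have "\<dots> \<le> card {..D} + card ({..D} \<times> {..<c})"
    by (intro add_mono card_image_le) auto
  also have "\<dots> = Suc D * (c + 1)" by (simp add: card_cartesian_product)
  also have "\<dots> < card B" using Suc.prems .
  finally have "\<not> B \<subseteq> F" using card_mono[of F B] unfolding F_def by auto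
  then obtain z where z: "z \<in> B" "z \<notin> F" by blast
  let ?q = "q(Suc D := z)"
  show ?case
  proof (intro exI[of _ ?q] conjI allI impI)
    show "?q 0 = b0" using q(1) by simp
    show "?q ` {..Suc D} \<subseteq> B" using q(2) z(1) by (auto simp: image_subset_iff)
    show "inj_on ?q {..Suc D}"
    proof -
      have "z \<notin> q ` {..D}" using z(2) unfolding F_def by blast
      then have "inj_on ?q (insert (Suc D) {..D})"
        using q(3) by (auto simp: inj_on_def image_iff)
      then show ?thesis by (simp add: atMost_Suc)
    qed
    fix t i s assume t: "t \<le> Suc D" "i < c" "t \<le> s \<and> s \<le> Suc D"
    show "p (?q t) i \<noteq> ?q s"
    proof (cases "t = Suc D")
      case True
      then show ?thesis using t assms(3)[OF z(1)] by auto
    next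
      case False
      then have "t \<le> D" using t by simp
      have "p (q t) i \<in> F" unfolding F_def using \<open>t \<le> D\<close> t(2) by force
      then show ?thesis using q(4)[OF \<open>t \<le> D\<close> t(2), of s] t False z(2) by (cases "s = Suc D") auto
    qed
  qed
qed

text \<open>In a zero sum every character occurs an even number of times at its position.\<close>

lemma partner_of_sum_zero:
  assumes fin: "finite B" and zero: "\<And>q. (\<Sum>t\<in>B. kvec c ch (x t) q) = 0" and t: "t \<in> B" "i < c"
  shows "\<exists>t'\<in>B. t' \<noteq> t \<and> ch i (x t') = ch i (x t)"
proof (rule ccontr)
  assume "\<not> ?thesis"
  then have "\<And>t'. t' \<in> B - {t} \<Longrightarrow> kvec c ch (x t') (i, ch i (x t)) = 0" by (auto simp: kvec_def)
  then have "(\<Sum>t'\<in>B - {t}. kvec c ch (x t') (i, ch i (x t))) = 0" by (intro sum.neutral) blast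
  moreover have "kvec c ch (x t) (i, ch i (x t)) = 1" using t(2) by (simp add: kvec_def)
  ultimately show False using zero[of "(i, ch i (x t))"] sum.remove[OF fin t(1), of "\<lambda>t'. kvec c ch (x t') (i, ch i (x t))"]
    by simp
qed

text \<open>
  Slot \<open>Suc l\<close> holds the dependent key \<open>w\<close>. The slots \<open>\<pi> (0, c), \<dots>, \<pi> (D, c)\<close> are determined by the others, one
  after the other: the \<open>i\<close>-th character at \<open>\<pi> (t, c)\<close> can be read off at slot \<open>\<pi> (t, i)\<close>. The point is that
  the number of patterns is polynomial in \<open>l\<close>, while a dependent set of slots has \<open>2 ^ l\<close> choices.
\<close>

definition dependency_pattern ::
  "'a set \<Rightarrow> nat \<Rightarrow> (nat \<Rightarrow> 'a \<Rightarrow> 'q) \<Rightarrow> nat \<Rightarrow> nat \<Rightarrow> (nat \<times> nat \<Rightarrow> nat) \<Rightarrow> (nat \<Rightarrow> 'a) \<Rightarrow> 'a \<Rightarrow> bool" where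
  "dependency_pattern X c ch D l \<pi> f w \<longleftrightarrow> w \<in> X \<and> \<pi> (0, c) = Suc l \<and> (\<forall>t\<le>D. \<forall>i\<le>c. \<pi> (t, i) \<le> Suc l)
     \<and> inj_on (\<lambda>t. \<pi> (t, c)) {..D}
     \<and> (\<forall>t\<le>D. \<forall>i<c. \<forall>s. t \<le> s \<and> s \<le> D \<longrightarrow> \<pi> (t, i) \<noteq> \<pi> (s, c))
     \<and> (\<forall>t\<le>D. \<forall>i<c. ch i ((f(Suc l := w)) (\<pi> (t, c))) = ch i ((f(Suc l := w)) (\<pi> (t, i))))"

text \<open>By induction on \<open>t\<close>: each partner of slot \<open>\<pi> (t, c)\<close> lies
  outside the determined slots or was recovered before, and the \<open>c\<close> characters read off
  at the partners identify the key.\<close>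

lemma dependency_pattern_determines:
  assumes inj: "keys_inj X c ch" and f: "f \<in> {..l} \<rightarrow>\<^sub>E X" "f' \<in> {..l} \<rightarrow>\<^sub>E X"
    and pat: "dependency_pattern X c ch D l \<pi> f w" "dependency_pattern X c ch D l \<pi> f' w'"
    and agree: "\<And>t. t \<le> l \<Longrightarrow> t \<notin> (\<lambda>t. \<pi> (t, c)) ` {1..D} \<Longrightarrow> f t = f' t"
  shows "f = f'"
proof -
  let ?x = "f(Suc l := w)" and ?x' = "f'(Suc l := w')"
  have X: "?x t \<in> X" "?x' t \<in> X" if "t \<le> Suc l" for t
    using that f pat unfolding dependency_pattern_def by (cases "t = Suc l"; auto simp: PiE_iff)+
  have eq: "?x (\<pi> (t, c)) = ?x' (\<pi> (t, c))" if "t \<le> D" for t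
    using that
  proof (induction t rule: less_induct)
    case (less t)
    have other: "?x (\<pi> (t, i)) = ?x' (\<pi> (t, i))" if i: "i < c" for i
    proof (cases "\<exists>s\<le>D. \<pi> (t, i) = \<pi> (s, c)")
      case True
      then obtain s where s: "s \<le> D" "\<pi> (t, i) = \<pi> (s, c)" by blast
      then have "s < t" using pat(1) less.prems i unfolding dependency_pattern_def by (meson not_less)
      then show ?thesis using less.IH[of s] s by simp
    next
      case False
      then have "\<pi> (t, i) \<noteq> Suc l" "\<pi> (t, i) \<notin> (\<lambda>t. \<pi> (t, c)) ` {1..D}" "\<pi> (t, i) \<le> Suc l"
        using pat(1) less.prems i unfolding dependency_pattern_def by auto
      then show ?thesis using agree[of "\<pi> (t, i)"] by simp
    qed
    have "\<forall>i<c. ch i (?x (\<pi> (t, c))) = ch i (?x' (\<pi> (t, c)))"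
      using pat less.prems other unfolding dependency_pattern_def by metis
    moreover have "\<pi> (t, c) \<le> Suc l" using pat(1) less.prems unfolding dependency_pattern_def by blast
    ultimately show ?case using inj X unfolding keys_inj_def by blast
  qed
  show ?thesis
  proof (rule PiE_ext[OF f])
    fix t assume t: "t \<in> {..l}"
    show "f t = f' t"
    proof (cases "t \<in> (\<lambda>t. \<pi> (t, c)) ` {1..D}")
      case True
      then obtain s where "s \<le> D" "t = \<pi> (s, c)" by auto
      then show ?thesis using eq[of s] t by simp
    next
      case False
      then show ?thesis using agree t by simp
    qed
  qed
qed

lemma ex_dependency_pattern:
  assumes f: "f \<in> {..l} \<rightarrow>\<^sub>E X" and w: "w \<in> X" and S: "S \<subseteq> {..l}" "card S \<ge> (D + 1) * (c + 1)"
    and zero: "\<And>q. kvec c ch w q = (\<Sum>t\<in>S. kvec c ch (f t) q)"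
  shows "\<exists>\<pi>\<in>{..D} \<times> {..c} \<rightarrow>\<^sub>E {..Suc l}. dependency_pattern X c ch D l \<pi> f w"
proof -
  let ?x = "f(Suc l := w)"
  define B where "B = insert (Suc l) S"
  have finS: "finite S" using S(1) finite_subset by blast
  have nS: "Suc l \<notin> S" using S(1) by auto
  have xS: "?x t = f t" if "t \<in> S" for t using nS that by auto
  have zB: "(\<Sum>t\<in>B. kvec c ch (?x t) q) = 0" for q
  proof -
    have "(\<Sum>t\<in>B. kvec c ch (?x t) q) = kvec c ch w q + (\<Sum>t\<in>S. kvec c ch (?x t) q)"
      using finS nS by (simp add: B_def)
    also have "(\<Sum>t\<in>S. kvec c ch (?x t) q) = kvec c ch w q"
      unfolding zero by (intro sum.cong refl) (simp only: xS)
    finally show ?thesis by simp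
  qed
  have finB: "finite B" using finS by (simp add: B_def)
  define p where "p t i = (SOME t'. t' \<in> B \<and> t' \<noteq> t \<and> ch i (?x t') = ch i (?x t))" for t i
  have p: "p t i \<in> B \<and> p t i \<noteq> t \<and> ch i (?x (p t i)) = ch i (?x t)" if "t \<in> B" "i < c" for t i
    unfolding p_def
  proof (rule someI_ex)
    show "\<exists>t'. t' \<in> B \<and> t' \<noteq> t \<and> ch i (?x t') = ch i (?x t)"
      using partner_of_sum_zero[OF finB zB that] by blast
  qed
  have "card B > D * (c + 1)" using S(2) finS nS by (simp add: B_def)
  then obtain q where q: "q 0 = Suc l" "q ` {..D} \<subseteq> B" "inj_on q {..D}"
    "\<forall>t\<le>D. \<forall>i<c. \<forall>s. t \<le> s \<and> s \<le> D \<longrightarrow> p (q t) i \<noteq> q s"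
    using greedy_sequence[OF finB, of "Suc l" c p D] p B_def by blast
  \<comment> \<open>Index \<open>c\<close> stores the chosen slot, the smaller indices its
    partners.\<close>
  define \<pi> where "\<pi> = (\<lambda>(t, i)\<in>{..D} \<times> {..c}. if i = c then q t else p (q t) i)"
  have BS: "B \<subseteq> {..Suc l}" using S(1) unfolding B_def by auto
  have qB: "q t \<in> B" if "t \<le> D" for t using q(2) that by auto
  have val: "\<pi> (t, c) = q t" "i < c \<Longrightarrow> \<pi> (t, i) = p (q t) i" if "t \<le> D" for t i
    using that unfolding \<pi>_def by auto
  have le: "\<pi> (t, i) \<le> Suc l" if "t \<le> D" "i \<le> c" for t i
    using that qB p BS by (cases "i = c") (auto simp: val subset_iff)
  show ?thesis
  proof (rule bexI[of _ \<pi>])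
    show "\<pi> \<in> {..D} \<times> {..c} \<rightarrow>\<^sub>E {..Suc l}"
      using le by (auto simp: PiE_iff) (simp add: \<pi>_def)
    have "inj_on (\<lambda>t. \<pi> (t, c)) {..D}" using q(3) by (simp add: inj_on_def val)
    then show "dependency_pattern X c ch D l \<pi> f w"
      unfolding dependency_pattern_def using w q(1,4) le p qB by (simp add: val)
  qed
qed

text \<open>A pattern consists of (D+1)(c+1) slot numbers out of l+2. Given the pattern, the tuple
  is determined by its l+1-D remaining slots.\<close>

lemma card_large_dependencies_le:
  assumes fin: "finite X" and inj: "keys_inj X c ch"
  shows "card {f \<in> {..l} \<rightarrow>\<^sub>E X. \<exists>w\<in>X. \<exists>S\<subseteq>{..l}. card S \<ge> (D + 1) * (c + 1) \<and>
      (\<forall>q. kvec c ch w q = (\<Sum>t\<in>S. kvec c ch (f t) q))} \<le> (l + 2) ^ ((D + 1) * (c + 1)) * card X ^ (l + 1 - D)"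
    (is "card ?B \<le> _")
proof -
  let ?I = "{..D} \<times> {..c} \<rightarrow>\<^sub>E {..Suc l}"
  let ?F = "\<lambda>\<pi>. {f \<in> {..l} \<rightarrow>\<^sub>E X. \<exists>w. dependency_pattern X c ch D l \<pi> f w}"
  have finP: "finite ({..l} \<rightarrow>\<^sub>E X)" using fin by (intro finite_PiE) auto
  have "?B \<subseteq> (\<Union>\<pi>\<in>?I. ?F \<pi>)"
  proof (rule subsetI, elim CollectE conjE bexE exE)
    fix f w S assume "f \<in> {..l} \<rightarrow>\<^sub>E X" "w \<in> X" "S \<subseteq> {..l}" "card S \<ge> (D + 1) * (c + 1)"
      "\<forall>q. kvec c ch w q = (\<Sum>t\<in>S. kvec c ch (f t) q)"
    then obtain \<pi> where "\<pi> \<in> ?I" "dependency_pattern X c ch D l \<pi> f w"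
      using ex_dependency_pattern[of f l X w S D c ch] by blast
    then show "f \<in> (\<Union>\<pi>\<in>?I. ?F \<pi>)" using \<open>f \<in> {..l} \<rightarrow>\<^sub>E X\<close> by blast
  qed
  then have "card ?B \<le> card (\<Union>\<pi>\<in>?I. ?F \<pi>)"
    by (rule card_mono[rotated]) (use finP in \<open>auto intro!: finite_UN_I finite_PiE\<close>)
  also have "\<dots> \<le> (\<Sum>\<pi>\<in>?I. card (?F \<pi>))" by (rule card_UN_le) (auto intro!: finite_PiE)
  also have "\<dots> \<le> (\<Sum>\<pi>\<in>?I. card X ^ (l + 1 - D))"
  proof (rule sum_mono)
    fix \<pi>
    show "card (?F \<pi>) \<le> card X ^ (l + 1 - D)"
    proof (cases "?F \<pi> = {}")
      case False
      then obtain f0 w0 where pat: "dependency_pattern X c ch D l \<pi> f0 w0" by blast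
      \<comment> \<open>The determined slot number 0 holds \<open>w\<close>, which is not part of
        the tuple; only \<open>D\<close> slots are saved.\<close>
      define Q where "Q = (\<lambda>t. \<pi> (t, c)) ` {1..D}"
      have inj\<pi>: "inj_on (\<lambda>t. \<pi> (t, c)) {..D}" and \<pi>0: "\<pi> (0, c) = Suc l"
        and le: "\<And>t. t \<le> D \<Longrightarrow> \<pi> (t, c) \<le> Suc l"
        using pat unfolding dependency_pattern_def by auto
      have "inj_on (\<lambda>t. \<pi> (t, c)) {1..D}" by (rule inj_on_subset[OF inj\<pi>]) auto
      then have cQ: "card Q = D" by (simp add: Q_def card_image)
      have "\<pi> (t, c) \<le> l" if "t \<in> {1..D}" for t
      proof -
        have "\<pi> (t, c) \<noteq> \<pi> (0, c)" using that inj_onD[OF inj\<pi>, of t 0] by auto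
        then show ?thesis using le[of t] that \<pi>0 by auto
      qed
      then have QS: "Q \<subseteq> {..l}" unfolding Q_def by auto
      have "card (?F \<pi>) \<le> card (({..l} - Q) \<rightarrow>\<^sub>E X)"
      proof (rule card_inj_on_le[where f = "\<lambda>f. restrict f ({..l} - Q)"])
        show "inj_on (\<lambda>f. restrict f ({..l} - Q)) (?F \<pi>)"
        proof (rule inj_onI)
          fix f f' assume ff: "f \<in> ?F \<pi>" "f' \<in> ?F \<pi>" and r: "restrict f ({..l} - Q) = restrict f' ({..l} - Q)"
          obtain w w' where ww: "dependency_pattern X c ch D l \<pi> f w" "dependency_pattern X c ch D l \<pi> f' w'"
            using ff by blast
          show "f = f'"
          proof (rule dependency_pattern_determines[OF inj _ _ ww])
            fix t assume "t \<le> l" "t \<notin> (\<lambda>t. \<pi> (t, c)) ` {1..D}"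
            then show "f t = f' t" using fun_cong[OF r, of t] by (simp add: Q_def)
          qed (use ff in auto)
        qed
        show "(\<lambda>f. restrict f ({..l} - Q)) ` ?F \<pi> \<subseteq> ({..l} - Q) \<rightarrow>\<^sub>E X"
          by (rule image_subsetI) (auto simp: restrict_PiE_iff PiE_iff)
        show "finite (({..l} - Q) \<rightarrow>\<^sub>E X)" using fin by (intro finite_PiE) auto
      qed
      also have "\<dots> = card X ^ (l + 1 - D)"
        using QS cQ by (simp add: card_PiE card_Diff_subset finite_subset)
      finally show ?thesis .
    next
      case True
      show ?thesis unfolding True by simp
    qed
  qed
  also have "\<dots> = (l + 2) ^ ((D + 1) * (c + 1)) * card X ^ (l + 1 - D)"
    by (simp add: card_PiE card_cartesian_product)
  finally show ?thesis .
qed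

section \<open>Alternating paths\<close>

lemma character_inj:
  assumes "x < (2 ^ s) ^ c" "y < (2 ^ s) ^ c" "\<forall>i<c. character s x i = character s y i"
  shows "x = y"
proof (rule bit_eqI)
  fix k
  have lt: "x < 2 ^ (s * c)" "y < 2 ^ (s * c)" using assms(1,2) by (simp_all add: power_mult)
  show "bit x k \<longleftrightarrow> bit y k"
  proof (cases "k < s * c")
    case True
    then have s: "s > 0" by (cases s) auto
    then have "k div s < c" "k mod s < s" using True by (simp_all add: div_less_iff_less_mult mult.commute)
    then have "bit x (k div s * s + k mod s) \<longleftrightarrow> bit y (k div s * s + k mod s)"
      using assms(3) unfolding character_eq_iff by blast
    then show ?thesis by simp
  next
    case False
    have "\<not> bit z k" if "z < 2 ^ (s * c)" for z :: nat
    proof -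
      have "take_bit (s * c) z = z" using that by (simp add: take_bit_nat_eq_self)
      then show ?thesis using False by (metis bit_take_bit_iff)
    qed
    then show ?thesis using lt by blast
  qed
qed

lemma prob_ex_le:
  assumes "finite I"
  shows "measure_pmf.prob M {T. \<exists>i\<in>I. P i T} \<le> (\<Sum>i\<in>I. measure_pmf.prob M {T. P i T})"
proof -
  have "{T. \<exists>i\<in>I. P i T} = (\<Union>i\<in>I. {T. P i T})" by auto
  then show ?thesis using measure_pmf.finite_measure_subadditive_finite[OF assms, of "\<lambda>i. {T. P i T}"] by simp
qed

lemma prob_disj_le:
  "measure_pmf.prob M {T. P T \<or> Q T} \<le> measure_pmf.prob M {T. P T} + measure_pmf.prob M {T. Q T}"
proof -
  have "{T. P T \<or> Q T} = {T. P T} \<union> {T. Q T}" by auto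
  then show ?thesis using measure_Un_le[of "{T. P T}" "measure_pmf M" "{T. Q T}"] by simp
qed

lemma prob_pair_pmf_split:
  assumes "\<And>x. measure_pmf.prob N {y. P x y} = k"
  shows "measure_pmf.prob (pair_pmf M N) {z. fst z \<in> A \<and> P (fst z) (snd z)} = measure_pmf.prob M A * k"
proof -
  have k: "k \<ge> 0" using assms[of undefined] measure_nonneg by metis
  have "emeasure (pair_pmf M N) {z. fst z \<in> A \<and> P (fst z) (snd z)}
      = (\<integral>\<^sup>+ z. indicator {z. fst z \<in> A \<and> P (fst z) (snd z)} z \<partial>pair_pmf M N)" by simp
  also have "\<dots> = (\<integral>\<^sup>+ x. \<integral>\<^sup>+ y. indicator A x * indicator {y. P x y} y \<partial>N \<partial>M)"
    unfolding nn_integral_pair_pmf' by (intro nn_integral_cong) (auto simp: indicator_def)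
  also have "\<dots> = (\<integral>\<^sup>+ x. indicator A x * ennreal k \<partial>M)"
    by (intro nn_integral_cong) (simp add: nn_integral_cmult measure_pmf.emeasure_eq_measure assms)
  also have "\<dots> = ennreal (measure_pmf.prob M A * k)"
    by (simp add: nn_integral_multc measure_pmf.emeasure_eq_measure ennreal_mult k)
  finally show ?thesis using k by (simp add: measure_pmf.emeasure_eq_measure)
qed

text \<open>Edges of a walk, each labelled with the derived position at which its ends must agree.
  Since the label alternates, edges with the same label have no key in common.\<close>

definition alt_path :: "(nat \<Rightarrow> nat) \<Rightarrow> nat \<Rightarrow> nat \<Rightarrow> (nat \<times> nat \<times> nat) set" where
  "alt_path f i l = (\<lambda>t. (f t, f (Suc t), 2 * i + t mod 2)) ` {..<l}"

lemma sum_disjoint_pairs: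
  fixes h :: "nat \<Rightarrow> bit"
  assumes "finite S" "\<And>t. t \<in> S \<Longrightarrow> Suc t \<notin> S"
  shows "(\<Sum>t\<in>S. h t + h (Suc t)) = (\<Sum>t\<in>S \<union> Suc ` S. h t)"
proof -
  have "S \<inter> Suc ` S = {}" using assms(2) by auto
  then show ?thesis using assms(1) by (simp add: sum.distrib sum.union_disjoint sum.reindex)
qed

text \<open>Edges with one label start at times of one parity, hence are disjoint, and a sum over
  edges is a sum over distinct times.\<close>

lemma sum_path:
  assumes inj: "inj_on f {..l}" and S: "S \<subseteq> {t \<in> alt_path f i l. snd (snd t) = j}"
  shows "\<exists>R\<subseteq>{t. t < l \<and> 2 * i + t mod 2 = j}. (S = {} \<longleftrightarrow> R = {}) \<and>
    (\<forall>q. (\<Sum>(x, x', _)\<in>S. v x q + v x' q :: bit) = (\<Sum>t\<in>R \<union> Suc ` R. v (f t) q))"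
proof -
  let ?g = "\<lambda>t. (f t, f (Suc t), 2 * i + t mod 2)"
  define R where "R = {t. t < l \<and> ?g t \<in> S}"
  have SR: "S = ?g ` R" using S unfolding R_def alt_path_def by auto
  have Rj: "R \<subseteq> {t. t < l \<and> 2 * i + t mod 2 = j}" using S unfolding R_def by auto
  have "inj_on ?g R" using inj unfolding R_def inj_on_def by auto
  then have "(\<Sum>(x, x', _)\<in>S. v x q + v x' q) = (\<Sum>t\<in>R. v (f t) q + v (f (Suc t)) q)" for q
    unfolding SR by (simp add: sum.reindex)
  moreover have "(\<Sum>t\<in>R. v (f t) q + v (f (Suc t)) q) = (\<Sum>t\<in>R \<union> Suc ` R. v (f t) q)" for q
  proof (rule sum_disjoint_pairs)
    show "finite R" unfolding R_def by simp
    fix t assume "t \<in> R"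
    show "Suc t \<notin> R"
    proof
      assume "Suc t \<in> R"
      then have "2 * i + t mod 2 = j" "2 * i + Suc t mod 2 = j" using \<open>t \<in> R\<close> Rj by blast+
      then show False by presburger
    qed
  qed
  ultimately show ?thesis using Rj SR by (intro exI[of _ R]) auto
qed

text \<open>A nonempty set of disjoint edges sums to a nonempty set of distinct keys, which is
  nonzero by independence.\<close>

lemma indep_path:
  assumes inj: "inj_on f {..l}" and ind: "indep (f ` {..l}) v"
  shows "indep {t \<in> alt_path f i l. snd (snd t) = j} (\<lambda>(x, x', _) q. v x q + v x' q)"
  unfolding indep_def
proof (intro allI impI)
  fix S assume S: "S \<subseteq> {t \<in> alt_path f i l. snd (snd t) = j}" "S \<noteq> {}"
  obtain R where R: "R \<subseteq> {t. t < l \<and> 2 * i + t mod 2 = j}" "R \<noteq> {}"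
    "\<And>q. (\<Sum>(x, x', _)\<in>S. v x q + v x' q) = (\<Sum>t\<in>R \<union> Suc ` R. v (f t) q)"
    using sum_path[OF inj S(1), of v] S(2) by blast
  have sub: "R \<union> Suc ` R \<subseteq> {..l}" using R(1) by auto
  have "(\<Sum>x\<in>f ` (R \<union> Suc ` R). v x q) = (\<Sum>t\<in>R \<union> Suc ` R. v (f t) q)" for q
    by (simp add: sum.reindex[OF inj_on_subset[OF inj sub]])
  moreover have "f ` (R \<union> Suc ` R) \<subseteq> f ` {..l}" "f ` (R \<union> Suc ` R) \<noteq> {}" using sub R(2) by auto
  ultimately have "\<exists>q. (\<Sum>t\<in>R \<union> Suc ` R. v (f t) q) \<noteq> 0" using ind unfolding indep_def by metis
  then show "\<exists>q. (\<Sum>i\<in>S. (case i of (x, x', _) \<Rightarrow> \<lambda>q. v x q + v x' q) q) \<noteq> 0"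
    unfolding R(3)[symmetric] by (simp add: case_prod_beta)
qed

lemma card_path: "inj_on f {..l} \<Longrightarrow> card (alt_path f i l) = l"
  unfolding alt_path_def by (subst card_image) (auto simp: inj_on_def)

text \<open>The walk stops at the first key that depends on the earlier ones. It must stop, since up
  to then all its keys are distinct members of a finite set.\<close>

lemma ex_independent_path:
  assumes "finite A" "E \<subseteq> A" "indep E v" and f: "\<And>t. f t \<in> A"
  obtains l where "in_span (E \<union> f ` {1..l}) v (v (f (Suc l)))" "indep (E \<union> f ` {1..l}) v"
    "inj_on f {1..l}" "f ` {1..l} \<inter> E = {}"
proof -
  define Q where "Q l = in_span (E \<union> f ` {1..l}) v (v (f (Suc l)))" for l
  have finE: "finite E" using assms finite_subset by blast
  have P: "indep (E \<union> f ` {1..l}) v \<and> inj_on f {1..l} \<and> f ` {1..l} \<inter> E = {}" if "\<forall>t<l. \<not> Q t" for l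
    using that
  proof (induction l)
    case 0
    then show ?case using assms(3) by simp
  next
    case (Suc l)
    then have IH: "indep (E \<union> f ` {1..l}) v" "inj_on f {1..l}" "f ` {1..l} \<inter> E = {}" by auto
    have nQ: "\<not> in_span (E \<union> f ` {1..l}) v (v (f (Suc l)))" using Suc.prems unfolding Q_def by blast
    have e: "{1..Suc l} = insert (Suc l) {1..l}" by auto
    have new: "f (Suc l) \<notin> E \<union> f ` {1..l}" by (rule not_in_span_imp_notin[OF nQ])
    have "indep (insert (f (Suc l)) (E \<union> f ` {1..l})) v"
      by (rule indep_insert[OF _ IH(1) nQ]) (use finE in simp)
    then show ?case using IH new unfolding e by (auto simp: inj_on_insert)
  qed
  have "\<exists>l. Q l"
  proof (rule ccontr)
    assume "\<nexists>l. Q l"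
    then have "inj_on f {1..Suc (card A)}" using P by blast
    then have "card (f ` {1..Suc (card A)}) = Suc (card A)" by (simp add: card_image)
    moreover have "card (f ` {1..Suc (card A)}) \<le> card A" using f assms(1) by (intro card_mono) auto
    ultimately show False by simp
  qed
  then obtain l where "Q l" "\<forall>t<l. \<not> Q t" by (metis LeastI_ex not_less_Least)
  then show thesis using that P Q_def by blast
qed

lemma sum_of_bool_mult_const:
  assumes "finite A"
  shows "(\<Sum>w\<in>A. of_bool (P w) * k) = real (card {w \<in> A. P w}) * k"
proof -
  have "(\<Sum>w\<in>A. of_bool (P w) * k) = (\<Sum>w\<in>A. of_bool (P w)) * k" by (simp only: sum_distrib_right)
  then show ?thesis using assms by (simp add: Int_def)
qed

section \<open>Exploration of the selected keys\<close>

locale mixed_exploration =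
  fixes s c d r b :: nat and X :: "nat set" and p :: "nat \<Rightarrow> nat" and v :: "nat \<Rightarrow> bool"
  assumes c: "c \<ge> 1" and X: "X \<subseteq> {..<(2 ^ s) ^ c}"
    and p: "inj_on p {..<b}" "p ` {..<b} \<subseteq> {..<r}"
begin

abbreviation "kv \<equiv> kvec c (\<lambda>i x. character s x i)"

abbreviation "M \<equiv> random_mixed_tables s c d r"

abbreviation "selected \<equiv> selected_keys s c d X b p v"

abbreviation "dchar T x j \<equiv> character s (simple_tabulation s c (fst T) x) j"

lemma finite_X: "finite X"
  using X finite_subset by blast

lemma keys_inj_X: "keys_inj X c (\<lambda>i x. character s x i)"
  unfolding keys_inj_def using character_inj X by (metis lessThan_iff subsetD)

definition path_event :: "nat set \<Rightarrow> (nat \<times> nat \<times> nat) set \<Rightarrow> (tables \<times> tables) set" where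
  "path_event E Cn = {T. (\<forall>(x, x', j)\<in>Cn. dchar T x j = dchar T x' j) \<and> E \<subseteq> selected T}"

abbreviation "pair_kv \<equiv> (\<lambda>(x, x', _) q. kv x q + kv x' q) :: nat \<times> nat \<times> nat \<Rightarrow> nat \<times> nat \<Rightarrow> bit"

definition admissible :: "nat set \<Rightarrow> (nat \<times> nat \<times> nat) set \<Rightarrow> nat \<Rightarrow> bool" where
  "admissible E Cn i \<longleftrightarrow> finite E \<and> E \<subseteq> X \<and> indep E kv \<and> finite Cn \<and> (\<forall>(x, x', j)\<in>Cn. j < 2 * i)
     \<and> (\<forall>j. indep {t \<in> Cn. snd (snd t) = j} pair_kv)"

text \<open>A derived key begins with the original characters, so on the first \<open>c\<close>
  positions the incidence vectors agree, whatever the first tables are.\<close>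

lemma indep_derived:
  assumes "E \<subseteq> X" "indep E kv"
  shows "indep E (\<lambda>e. kvec (c + d) (\<lambda>i x. character s x i) (derived_key s c T1 e))"
  unfolding indep_def
proof (intro allI impI)
  fix S assume S: "S \<subseteq> E" "S \<noteq> {}"
  then obtain q where q: "(\<Sum>e\<in>S. kv e q) \<noteq> 0" using assms(2) unfolding indep_def by blast
  obtain i a where ia: "q = (i, a)" by (cases q)
  have "i < c"
  proof (rule ccontr)
    assume "\<not> i < c"
    then have "(\<Sum>e\<in>S. kv e q) = 0" by (simp add: ia kvec_def)
    then show False using q by simp
  qed
  have "(\<Sum>e\<in>S. kvec (c + d) (\<lambda>i x. character s x i) (derived_key s c T1 e) q) = (\<Sum>e\<in>S. kv e q)"
  proof (rule sum.cong[OF refl])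
    fix e assume "e \<in> S"
    then have "e < (2 ^ s) ^ c" using S assms(1) X by auto
    then show "kvec (c + d) (\<lambda>i x. character s x i) (derived_key s c T1 e) q = kv e q"
      using \<open>i < c\<close> by (simp add: ia kvec_def character_derived_key)
  qed
  then show "\<exists>q. (\<Sum>e\<in>S. kvec (c + d) (\<lambda>i x. character s x i) (derived_key s c T1 e) q) \<noteq> 0"
    using q by metis
qed

text \<open>The equalities depend on the first tables only. For every choice of these, the derived
  keys in \<open>E\<close> are independent, so selection has the same conditional
  probability.\<close>

lemma prob_path_event:
  assumes "admissible E Cn i" "2 * i \<le> d"
  shows "measure_pmf.prob M (path_event E Cn) = (1 / 2 ^ s) ^ card Cn * (1 / 2 ^ b) ^ card E"
proof -
  let ?P1 = "pmf_of_set (all_tables s c (s * d))" and ?P2 = "pmf_of_set (all_tables s (c + d) r)"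
  define B where "B = p ` {..<b}"
  define g where "g k \<longleftrightarrow> (\<exists>i<b. p i = k \<and> v i)" for k
  define A where "A = {T1. \<forall>(x, x', j)\<in>Cn. character s (simple_tabulation s c T1 x) j = character s (simple_tabulation s c T1 x') j}"
  define P where "P T1 T2 \<longleftrightarrow> (\<forall>e\<in>E. \<forall>k\<in>B. bit (simple_tabulation s (c + d) T2 (derived_key s c T1 e)) k = g k)" for T1 T2
  have gp: "g (p i) = v i" if "i < b" for i
    using p(1) that unfolding g_def inj_on_def by auto
  have E: "finite E" "E \<subseteq> X" "indep E kv" using assms(1) unfolding admissible_def by auto
  have "path_event E Cn = {z. fst z \<in> A \<and> P (fst z) (snd z)}"
    using E(2) by (fastforce simp: path_event_def A_def P_def B_def gp selected_keys_def mixed_tabulation_def)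
  then have "measure_pmf.prob M (path_event E Cn)
      = measure_pmf.prob (pair_pmf ?P1 ?P2) {z. fst z \<in> A \<and> P (fst z) (snd z)}"
    unfolding random_mixed_tables_def by simp
  also have "\<dots> = measure_pmf.prob ?P1 A * (1 / 2) ^ (card E * card B)"
  proof (rule prob_pair_pmf_split)
    fix T1
    show "measure_pmf.prob ?P2 {T2. P T1 T2} = (1 / 2) ^ (card E * card B)"
      unfolding P_def
      by (rule prob_bits_simple_tabulation) (use E p(2) indep_derived in \<open>auto simp: B_def\<close>)
  qed
  also have "measure_pmf.prob ?P1 A = (1 / 2 ^ s) ^ card Cn"
    unfolding A_def by (rule prob_equal_characters) (use assms in \<open>auto simp: admissible_def\<close>)
  also have "card B = b" using p(1) by (simp add: B_def card_image)
  finally show ?thesis by (simp add: power_mult[symmetric] power_divide mult.commute)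
qed

definition root_choice :: "nat set \<Rightarrow> nat \<Rightarrow> bool" where
  "root_choice S j \<longleftrightarrow> 0 \<in> S \<and> j \<in> S \<and> j \<noteq> 0 \<or> 0 \<notin> S \<and> j = 0"

definition key_dependent :: "(nat \<Rightarrow> nat) \<Rightarrow> nat set \<Rightarrow> nat \<Rightarrow> bool" where
  "key_dependent f S w \<longleftrightarrow> (\<forall>q. kv w q = (\<Sum>t\<in>S. kv (f t) q))"

text \<open>A consequence of lying in the span of \<open>E\<close>. The span comes with
  exponentially many subsets of \<open>E\<close>, the box has only polynomially many keys.\<close>

definition in_box :: "nat set \<Rightarrow> nat \<Rightarrow> bool" where
  "in_box E w \<longleftrightarrow> (\<forall>k<c. \<exists>e\<in>E. character s w k = character s e k)"

definition small_sets :: "nat \<Rightarrow> nat \<Rightarrow> nat set set" where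
  "small_sets L l = {S. S \<subseteq> {..l} \<and> 3 \<le> card S \<and> card S < L}"

definition extends :: "nat set \<Rightarrow> (nat \<times> nat \<times> nat) set \<Rightarrow> nat \<Rightarrow> nat \<Rightarrow> nat set \<Rightarrow> (nat \<times> nat \<times> nat) set \<Rightarrow> nat \<Rightarrow> bool" where
  "extends E Cn l k E' Cn' i \<longleftrightarrow> admissible E' Cn' (Suc i) \<and> card E' = card E + l \<and> card Cn' = card Cn + k"

text \<open>
  The keys in \<open>E\<close> have been explored, the equalities of derived characters in \<open>Cn\<close> have been imposed, and
  \<open>m\<close> walks remain, the next one starting from \<open>y\<close> and using the derived positions \<open>2 * i\<close> and \<open>2 * i + 1\<close>.
  The first alternative closes the walk by a new equality, the second one by a linear dependency.
\<close>

fun reach :: "nat \<Rightarrow> nat \<Rightarrow> nat \<Rightarrow> nat set \<Rightarrow> (nat \<times> nat \<times> nat) set \<Rightarrow> nat \<Rightarrow> tables \<times> tables \<Rightarrow> bool" where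
  "reach L 0 i E Cn y T \<longleftrightarrow> T \<in> path_event E Cn"
| "reach L (Suc m) i E Cn y T \<longleftrightarrow> (\<exists>l\<in>{..card X}. \<exists>f\<in>{..l} \<rightarrow>\<^sub>E X. f 0 = y \<and>
     ((\<exists>w\<in>X. (in_box (E \<union> f ` {1..l}) w \<and> extends E Cn l (Suc l) (E \<union> f ` {1..l}) (insert (f l, w, 2 * i + l mod 2) (Cn \<union> alt_path f i l)) i) \<and>
        reach L m (Suc i) (E \<union> f ` {1..l}) (insert (f l, w, 2 * i + l mod 2) (Cn \<union> alt_path f i l)) y T) \<or>
      (\<exists>S\<in>small_sets L l. \<exists>j\<in>{..l}. \<exists>w\<in>X. (root_choice S j \<and> key_dependent f S w \<and> extends E Cn l l (E \<union> f ` {1..l}) (Cn \<union> alt_path f i l) i) \<and>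
        reach L m (Suc i) (E \<union> f ` {1..l}) (Cn \<union> alt_path f i l) (f j) T)))"

text \<open>The probability cost of one step to a prescribed key: \<open>b\<close> selection bits
  and one equality of characters.\<close>

definition rate :: real where "rate = 1 / (2 ^ b * 2 ^ s)"

text \<open>The union bound for \<open>reach\<close> after the probability of the explored part has
  been split off. Only lengths of walks and roots survive; the factor
  \<open>real (l + 1) ^ K\<close> is this walk's share in the box counts of all walks.\<close>

fun weight :: "nat \<Rightarrow> nat \<Rightarrow> nat \<Rightarrow> nat \<Rightarrow> real" where
  "weight L K 0 y = 1"
| "weight L K (Suc m) y = (\<Sum>l\<in>{..card X}. rate ^ l * real (l + 1) ^ K * (\<Sum>f\<in>{..l} \<rightarrow>\<^sub>E X. of_bool (f 0 = y) *
     (weight L K m y / 2 ^ s + (\<Sum>S\<in>small_sets L l. \<Sum>j\<in>{..l}. \<Sum>w\<in>X.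
        of_bool (root_choice S j \<and> key_dependent f S w) * weight L K m (f j)))))"

lemma rate_nonneg: "rate \<ge> 0"
  by (simp add: rate_def)

lemma weight_nonneg: "weight L K m y \<ge> 0"
  by (induction m arbitrary: y) (auto intro!: sum_nonneg mult_nonneg_nonneg add_nonneg_nonneg simp: rate_nonneg)

lemma finite_small_sets: "finite (small_sets L l)"
  unfolding small_sets_def by (rule finite_subset[of _ "Pow {..l}"]) auto

lemma finite_paths: "finite ({..l::nat} \<rightarrow>\<^sub>E X)"
  using finite_X by (intro finite_PiE) auto

text \<open>A key of the box is determined by naming, for each position, a key of \<open>E\<close>
  with the same character.\<close>

lemma card_in_box:
  assumes "finite E"
  shows "card {w \<in> X. in_box E w} \<le> card E ^ c"
proof -
  define g where "g w = (\<lambda>k\<in>{..<c}. SOME e. e \<in> E \<and> character s w k = character s e k)" for w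
  have g: "g w k \<in> E \<and> character s w k = character s (g w k) k" if "in_box E w" "k < c" for w k
  proof -
    have "\<exists>e. e \<in> E \<and> character s w k = character s e k" using that unfolding in_box_def by blast
    from someI_ex[OF this] show ?thesis using that(2) by (simp add: g_def)
  qed
  have "card {w \<in> X. in_box E w} \<le> card ({..<c} \<rightarrow>\<^sub>E E)"
  proof (rule card_inj_on_le[where f = g])
    show "inj_on g {w \<in> X. in_box E w}"
    proof (rule inj_onI)
      fix w w' assume w: "w \<in> {w \<in> X. in_box E w}" "w' \<in> {w \<in> X. in_box E w}" "g w = g w'"
      then have "\<forall>k<c. character s w k = character s w' k" using g by (metis (mono_tags, lifting) mem_Collect_eq)
      then show "w = w'" using keys_inj_X w unfolding keys_inj_def by blast
    qed
    show "g ` {w \<in> X. in_box E w} \<subseteq> {..<c} \<rightarrow>\<^sub>E E"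
    proof (intro image_subsetI PiE_I)
      show "g w k \<in> E" if "w \<in> {w \<in> X. in_box E w}" "k \<in> {..<c}" for w k using g that by blast
      show "g w k = undefined" if "k \<notin> {..<c}" for w k using that by (simp add: g_def)
    qed
    show "finite ({..<c} \<rightarrow>\<^sub>E E)" using assms by (intro finite_PiE) auto
  qed
  then show ?thesis by (simp add: card_PiE)
qed

lemma prob_guarded_le:
  assumes "B \<Longrightarrow> measure_pmf.prob M {T. P T} \<le> k" "k \<ge> 0"
  shows "measure_pmf.prob M {T. B \<and> P T} \<le> of_bool B * k"
  using assms by (cases B) auto

text \<open>Union bound over walks, by induction on their number. Each of the \<open>m\<close>
  remaining walks may choose its closing key in a box, which accounts for the exponent
  \<open>c * m\<close>.\<close>

lemma prob_reach_le:
  assumes "admissible E Cn i" "2 * (i + m) \<le> d" "c * m \<le> K"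
  shows "measure_pmf.prob M {T. reach L m i E Cn y T}
    \<le> (1 / 2 ^ s) ^ card Cn * (1 / 2 ^ b) ^ card E * real (card E + 1) ^ (c * m) * weight L K m y"
  using assms
proof (induction m arbitrary: i E Cn y)
  case 0
  then show ?case using prob_path_event[of E Cn i] by simp
next
  case (Suc m)
  have finE: "finite E" using Suc.prems(1) unfolding admissible_def by auto
  define \<kappa> where "\<kappa> = (1 / 2 ^ s) ^ card Cn * (1 / 2 ^ b) ^ card E * real (card E + 1) ^ (c * Suc m)"
  have \<kappa>0: "\<kappa> \<ge> 0" unfolding \<kappa>_def by simp
  have IH: "measure_pmf.prob M {T. reach L m (Suc i) E' Cn' y' T}
      \<le> (1 / 2 ^ s) ^ (card Cn + k) * (1 / 2 ^ b) ^ (card E + l) * real (card E + l + 1) ^ (c * m) * weight L K m y'"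
    if "extends E Cn l k E' Cn' i" for E' Cn' y' l k
    using Suc.IH[of E' Cn' "Suc i" y'] that Suc.prems(2,3) unfolding extends_def by simp
  \<comment> \<open>The size of the explored set is bounded by a product, so that the old size goes
    into the prefactor and the new length into \<open>weight\<close>.\<close>
  have factor: "real (card E + l + 1) ^ e \<le> real (card E + 1) ^ e * real (l + 1) ^ e" for l e
  proof -
    have "card E + l + 1 \<le> (card E + 1) * (l + 1)" by (simp add: algebra_simps)
    then have "real (card E + l + 1) ^ e \<le> real ((card E + 1) * (l + 1)) ^ e"
      by (intro power_mono) (simp_all only: of_nat_le_iff of_nat_0_le_iff)
    then show ?thesis by (simp only: of_nat_mult power_mult_distrib)
  qed
  have lK: "real (l + 1) ^ e \<le> real (l + 1) ^ K" if "e \<le> c * Suc m" for l e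
    using that Suc.prems(3) by (intro power_increasing) auto
  have eK: "real (card E + l + 1) ^ e \<le> real (card E + 1) ^ (c * Suc m) * real (l + 1) ^ K" if "e \<le> c * Suc m" for l e
  proof -
    have "real (card E + l + 1) ^ e \<le> real (card E + 1) ^ e * real (l + 1) ^ e" by (rule factor)
    also have "\<dots> \<le> real (card E + 1) ^ (c * Suc m) * real (l + 1) ^ K"
      by (intro mult_mono lK that power_increasing) auto
    finally show ?thesis .
  qed
  have segment: "measure_pmf.prob M {T.
       (\<exists>w\<in>X. (in_box (E \<union> f ` {1..l}) w \<and> extends E Cn l (Suc l) (E \<union> f ` {1..l}) (insert (f l, w, 2 * i + l mod 2) (Cn \<union> alt_path f i l)) i) \<and>
          reach L m (Suc i) (E \<union> f ` {1..l}) (insert (f l, w, 2 * i + l mod 2) (Cn \<union> alt_path f i l)) y T) \<or>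
        (\<exists>S\<in>small_sets L l. \<exists>j\<in>{..l}. \<exists>w\<in>X. (root_choice S j \<and> key_dependent f S w \<and> extends E Cn l l (E \<union> f ` {1..l}) (Cn \<union> alt_path f i l) i) \<and>
          reach L m (Suc i) (E \<union> f ` {1..l}) (Cn \<union> alt_path f i l) (f j) T)}
      \<le> \<kappa> * (rate ^ l * real (l + 1) ^ K * (weight L K m y / 2 ^ s + (\<Sum>S\<in>small_sets L l. \<Sum>j\<in>{..l}. \<Sum>w\<in>X.
        of_bool (root_choice S j \<and> key_dependent f S w) * weight L K m (f j))))"
    (is "measure_pmf.prob M {T. ?P T \<or> ?Q T} \<le> _") for l f
  proof -
    let ?E = "E \<union> f ` {1..l}"
    have cE: "card ?E \<le> card E + l"
      using card_Un_le[of E "f ` {1..l}"] card_image_le[of "{1..l}" f] by simp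
    let ?k = "(1 / 2 ^ s) ^ (card Cn + Suc l) * (1 / 2 ^ b) ^ (card E + l) * real (card E + l + 1) ^ (c * m) * weight L K m y"
    have k0: "?k \<ge> 0" by (intro mult_nonneg_nonneg weight_nonneg) auto
    have "measure_pmf.prob M {T. ?P T} \<le> (\<Sum>w\<in>X. of_bool (in_box ?E w) * ?k)"
      by (rule order_trans[OF prob_ex_le[OF finite_X]], rule sum_mono,
          rule order_trans[OF prob_guarded_le[OF _ k0]], rule IH, blast, rule mult_right_mono[OF _ k0]) auto
    also have "\<dots> = real (card {w \<in> X. in_box ?E w}) * ?k"
      by (rule sum_of_bool_mult_const[OF finite_X])
    \<comment> \<open>The box count raises the exponent from \<open>c * m\<close> to
      \<open>c * Suc m\<close>.\<close>
    also have "\<dots> \<le> real (card E + l + 1) ^ c * ?k"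
    proof (rule mult_right_mono[OF _ k0])
      have "card {w \<in> X. in_box ?E w} \<le> card ?E ^ c" by (rule card_in_box) (use finE in simp)
      also have "\<dots> \<le> (card E + l + 1) ^ c" using cE by (intro power_mono) auto
      finally show "real (card {w \<in> X. in_box ?E w}) \<le> real (card E + l + 1) ^ c"
        by (simp only: of_nat_le_iff of_nat_power[symmetric])
    qed
    also have "\<dots> = (1 / 2 ^ s) ^ card Cn * (1 / 2 ^ b) ^ card E * rate ^ l * real (card E + l + 1) ^ (c * Suc m) * (weight L K m y / 2 ^ s)"
      by (simp add: rate_def power_add power_divide power_mult_distrib field_simps)
    also have "\<dots> \<le> (1 / 2 ^ s) ^ card Cn * (1 / 2 ^ b) ^ card E * rate ^ l * (real (card E + 1) ^ (c * Suc m) * real (l + 1) ^ K) * (weight L K m y / 2 ^ s)"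
      by (intro mult_right_mono mult_left_mono eK) (auto simp: weight_nonneg rate_nonneg)
    also have "\<dots> = \<kappa> * (rate ^ l * real (l + 1) ^ K * (weight L K m y / 2 ^ s))"
      by (simp only: \<kappa>_def ac_simps)
    finally have 1: "measure_pmf.prob M {T. ?P T} \<le> \<kappa> * (rate ^ l * real (l + 1) ^ K * (weight L K m y / 2 ^ s))" .
    have z: "(1 / 2 ^ s) ^ (card Cn + l) * (1 / 2 ^ b) ^ (card E + l) * real (card E + l + 1) ^ (c * m) * weight L K m y'
        \<le> \<kappa> * (rate ^ l * real (l + 1) ^ K * weight L K m y')" for y'
    proof -
      have "(1 / 2 ^ s) ^ (card Cn + l) * (1 / 2 ^ b) ^ (card E + l) * real (card E + l + 1) ^ (c * m) * weight L K m y'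
          = (1 / 2 ^ s) ^ card Cn * (1 / 2 ^ b) ^ card E * rate ^ l * real (card E + l + 1) ^ (c * m) * weight L K m y'"
        by (simp add: rate_def power_add power_divide power_mult_distrib field_simps)
      also have "\<dots> \<le> (1 / 2 ^ s) ^ card Cn * (1 / 2 ^ b) ^ card E * rate ^ l * (real (card E + 1) ^ (c * Suc m) * real (l + 1) ^ K) * weight L K m y'"
        by (intro mult_right_mono mult_left_mono eK) (auto simp: weight_nonneg rate_nonneg)
      also have "\<dots> = \<kappa> * (rate ^ l * real (l + 1) ^ K * weight L K m y')" by (simp only: \<kappa>_def ac_simps)
      finally show ?thesis .
    qed
    have zk0: "\<kappa> * (rate ^ l * real (l + 1) ^ K * weight L K m y') \<ge> 0" for y'
      using \<kappa>0 by (intro mult_nonneg_nonneg weight_nonneg) (auto simp: rate_nonneg)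
    have "measure_pmf.prob M {T. ?Q T} \<le> (\<Sum>S\<in>small_sets L l. \<Sum>j\<in>{..l}. \<Sum>w\<in>X.
        of_bool (root_choice S j \<and> key_dependent f S w) * (\<kappa> * (rate ^ l * real (l + 1) ^ K * weight L K m (f j))))"
      by (rule order_trans[OF prob_ex_le[OF finite_small_sets]], rule sum_mono,
          rule order_trans[OF prob_ex_le[OF finite_atMost]], rule sum_mono,
          rule order_trans[OF prob_ex_le[OF finite_X]], rule sum_mono,
          rule order_trans[OF prob_guarded_le[OF _ zk0]], rule order_trans[OF IH z], blast,
          rule mult_right_mono[OF _ zk0]) auto
    also have "\<dots> = \<kappa> * (rate ^ l * real (l + 1) ^ K * (\<Sum>S\<in>small_sets L l. \<Sum>j\<in>{..l}. \<Sum>w\<in>X.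
        of_bool (root_choice S j \<and> key_dependent f S w) * weight L K m (f j)))"
      by (simp only: sum_distrib_left ac_simps)
    finally have 2: "measure_pmf.prob M {T. ?Q T} \<le> \<dots>" .
    show ?thesis
      by (rule order_trans[OF prob_disj_le], rule order_trans[OF add_mono[OF 1 2]]) (simp add: algebra_simps)
  qed
  have tk0: "\<kappa> * (rate ^ l * real (l + 1) ^ K * (weight L K m y / 2 ^ s + (\<Sum>S\<in>small_sets L l. \<Sum>j\<in>{..l}. \<Sum>w\<in>X.
        of_bool (root_choice S j \<and> key_dependent f S w) * weight L K m (f j)))) \<ge> 0" for l f
    using \<kappa>0 by (intro mult_nonneg_nonneg add_nonneg_nonneg sum_nonneg divide_nonneg_nonneg weight_nonneg) (auto simp: rate_nonneg)
  have "measure_pmf.prob M {T. reach L (Suc m) i E Cn y T}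
      \<le> (\<Sum>l\<in>{..card X}. \<Sum>f\<in>{..l} \<rightarrow>\<^sub>E X. of_bool (f 0 = y) *
        (\<kappa> * (rate ^ l * real (l + 1) ^ K * (weight L K m y / 2 ^ s + (\<Sum>S\<in>small_sets L l. \<Sum>j\<in>{..l}. \<Sum>w\<in>X.
        of_bool (root_choice S j \<and> key_dependent f S w) * weight L K m (f j))))))"
    unfolding reach.simps
    by (rule order_trans[OF prob_ex_le[OF finite_atMost]], rule sum_mono,
        rule order_trans[OF prob_ex_le[OF finite_paths]], rule sum_mono,
        rule prob_guarded_le[OF segment tk0])
  also have "\<dots> = \<kappa> * weight L K (Suc m) y"
    by (simp only: weight.simps sum_distrib_left ac_simps)
  finally show ?case unfolding \<kappa>_def .
qed


section \<open>Norm bounds for the weights\<close>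

text \<open>The contribution of walks of length \<open>l\<close> to the norm of one step, without
  the factor 1/2^s: the first term stems from closing equalities, the second from dependencies,
  summed over \<open>S\<close> and the next root.\<close>

definition segment_const :: "nat \<Rightarrow> nat \<Rightarrow> real \<Rightarrow> nat \<Rightarrow> real" where
  "segment_const L K \<psi> l = real (l + 1) ^ K * (\<psi> ^ l + real (card (small_sets L l)) * real (l + 1) * 3 ^ c * \<psi> ^ (l - 1))"

lemma sum_paths_root:
  "(\<Sum>f\<in>{..l} \<rightarrow>\<^sub>E X. h (f 0) :: real) = real (card X) ^ l * (\<Sum>y\<in>X. h y)"
proof -
  have e: "{..l} = insert 0 {1..l}" by auto
  have "(\<Sum>f\<in>{..l} \<rightarrow>\<^sub>E X. h (f 0)) = (\<Sum>y\<in>X. \<Sum>f\<in>{1..l} \<rightarrow>\<^sub>E X. h ((f(0 := y)) 0))"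
    unfolding e by (rule sum_PiE_insert) simp
  also have "\<dots> = real (card X) ^ l * (\<Sum>y\<in>X. h y)"
    by (simp add: card_PiE sum_distrib_left)
  finally show ?thesis .
qed

lemma sum_mult_le_L2_set:
  fixes a g :: "'a \<Rightarrow> real"
  assumes "\<And>x. a x \<ge> 0" "\<And>x. g x \<ge> 0"
  shows "(\<Sum>x\<in>A. a x * g x) \<le> L2_set a A * L2_set g A"
  using L2_set_mult_ineq[of a g A] assms by simp

definition branch_weight :: "nat \<Rightarrow> nat \<Rightarrow> nat \<Rightarrow> nat \<Rightarrow> (nat \<Rightarrow> nat) \<Rightarrow> real" where
  "branch_weight L K m l f = (\<Sum>S\<in>small_sets L l. \<Sum>j\<in>{..l}. \<Sum>w\<in>X.
     of_bool (root_choice S j \<and> key_dependent f S w) * weight L K m (f j))"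

text \<open>Each key chosen along the walk pairs with one \<open>rate\<close>, giving
  \<open>\<psi>\<close>. A closing equality has its own 1/2^s; a dependency leaves one
  \<open>rate\<close> without a key to pair with, which is worth as much.\<close>

lemma segment_weight_le:
  assumes \<psi>: "rate * real (card X) \<le> \<psi>" and a: "\<And>y. a y \<ge> 0"
  shows "(\<Sum>f\<in>{..l} \<rightarrow>\<^sub>E X. a (f 0) * (weight L K m (f 0) / 2 ^ s + branch_weight L K m l f)) * rate ^ l
      \<le> (\<psi> ^ l + real (card (small_sets L l)) * real (l + 1) * 3 ^ c * \<psi> ^ (l - 1)) / 2 ^ s
        * (L2_set a X * L2_set (weight L K m) X)"
proof -
  let ?G = "weight L K m"
  let ?n = "real (card X)"
  let ?LL = "L2_set a X * L2_set ?G X"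
  let ?Z = "\<lambda>l f. branch_weight L K m l f"
  have LL0: "?LL \<ge> 0" by simp
  have \<psi>0: "\<psi> \<ge> 0" using \<psi> rate_nonneg by (meson mult_nonneg_nonneg of_nat_0_le_iff order_trans)
  have r1: "rate ^ l * ?n ^ l \<le> \<psi> ^ l" for l
    using \<psi> rate_nonneg by (simp add: power_mult_distrib[symmetric] power_mono)
  have r2: "rate \<le> 1 / 2 ^ s" by (simp add: rate_def field_simps)
  have "(\<Sum>f\<in>{..l} \<rightarrow>\<^sub>E X. a (f 0) * ?G (f 0)) \<le> ?n ^ l * ?LL"
    unfolding sum_paths_root[where h = "\<lambda>y. a y * ?G y"]
    by (intro mult_left_mono sum_mult_le_L2_set a weight_nonneg) simp
  then have "(\<Sum>f\<in>{..l} \<rightarrow>\<^sub>E X. a (f 0) * ?G (f 0)) * rate ^ l \<le> ?n ^ l * ?LL * rate ^ l"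
    by (intro mult_right_mono) (auto simp: rate_nonneg)
  also have "\<dots> = (rate ^ l * ?n ^ l) * ?LL" by (simp only: ac_simps)
  also have "\<dots> \<le> \<psi> ^ l * ?LL" by (intro mult_right_mono r1 LL0)
  finally have 1: "(\<Sum>f\<in>{..l} \<rightarrow>\<^sub>E X. a (f 0) * ?G (f 0)) * rate ^ l / 2 ^ s \<le> \<psi> ^ l / 2 ^ s * ?LL"
    by (simp add: divide_right_mono)
  have "(\<Sum>f\<in>{..l} \<rightarrow>\<^sub>E X. a (f 0) * ?Z l f)
      = (\<Sum>S\<in>small_sets L l. \<Sum>j\<in>{..l}. \<Sum>f\<in>{..l} \<rightarrow>\<^sub>E X. \<Sum>w\<in>X. a (f 0) * (of_bool (root_choice S j \<and> key_dependent f S w) * ?G (f j)))"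
    by (simp only: branch_weight_def sum_distrib_left sum.swap[where A = "{..l} \<rightarrow>\<^sub>E X"])
  also have "\<dots> \<le> (\<Sum>S\<in>small_sets L l. \<Sum>j\<in>{..l}. 3 ^ c * ?n ^ (l - 1) * L2_set a X * L2_set ?G X)"
  proof (intro sum_mono)
    fix S j assume S: "S \<in> small_sets L l"
    show "(\<Sum>f\<in>{..l} \<rightarrow>\<^sub>E X. \<Sum>w\<in>X. a (f 0) * (of_bool (root_choice S j \<and> key_dependent f S w) * ?G (f j)))
        \<le> 3 ^ c * ?n ^ (l - 1) * L2_set a X * L2_set ?G X"
    proof (cases "root_choice S j")
      case True
      have "(\<Sum>f\<in>{..l} \<rightarrow>\<^sub>E X. \<Sum>w\<in>X. a (f 0) * (of_bool (root_choice S j \<and> key_dependent f S w) * ?G (f j)))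
          = (\<Sum>f\<in>{..l} \<rightarrow>\<^sub>E X. \<Sum>w\<in>X. a (f 0) * ?G (f j) * of_bool (\<forall>q. kv w q = (\<Sum>t\<in>S. kv (f t) q)))"
        using True by (simp only: key_dependent_def simp_thms ac_simps)
      also have "\<dots> \<le> 3 ^ c * ?n ^ (l - 1) * L2_set a X * L2_set ?G X"
        by (rule zero_tuples_le)
          (use S True finite_X keys_inj_X a weight_nonneg in \<open>auto simp: small_sets_def root_choice_def\<close>)
      finally show ?thesis .
    next
      case False
      then show ?thesis by simp
    qed
  qed
  also have "\<dots> = real (card (small_sets L l)) * real (l + 1) * 3 ^ c * (?n ^ (l - 1) * ?LL)"
    by (simp add: algebra_simps)
  finally have "(\<Sum>f\<in>{..l} \<rightarrow>\<^sub>E X. a (f 0) * ?Z l f) * rate ^ l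
      \<le> real (card (small_sets L l)) * real (l + 1) * 3 ^ c * (?n ^ (l - 1) * ?LL) * rate ^ l"
    by (intro mult_right_mono) (auto simp: rate_nonneg)
  \<comment> \<open>The unpaired \<open>rate\<close> is at most 1/2^s. For \<open>l = 0\<close> the
    subtraction is truncated, but a single slot has no subset of size three.\<close>
  also have "\<dots> \<le> real (card (small_sets L l)) * real (l + 1) * 3 ^ c * \<psi> ^ (l - 1) / 2 ^ s * ?LL"
  proof (cases l)
    case 0
    have "S \<notin> small_sets L 0" for S
      using card_mono[of "{..0}" S] unfolding small_sets_def by auto
    then have "small_sets L 0 = {}" by blast
    then show ?thesis using 0 by simp
  next
    case (Suc l')
    have "?n ^ l' * rate ^ l = (rate ^ l' * ?n ^ l') * rate" by (simp add: Suc)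
    also have "\<dots> \<le> \<psi> ^ l' * (1 / 2 ^ s)"
      using \<psi>0 rate_nonneg by (intro mult_mono r1 r2) auto
    finally have "real (card (small_sets L l)) * real (l + 1) * 3 ^ c * ?LL * (?n ^ l' * rate ^ l)
        \<le> real (card (small_sets L l)) * real (l + 1) * 3 ^ c * ?LL * (\<psi> ^ l' * (1 / 2 ^ s))"
      by (intro mult_left_mono) auto
    then show ?thesis by (simp add: Suc ac_simps)
  qed
  finally have 2: "(\<Sum>f\<in>{..l} \<rightarrow>\<^sub>E X. a (f 0) * ?Z l f) * rate ^ l
      \<le> real (card (small_sets L l)) * real (l + 1) * 3 ^ c * \<psi> ^ (l - 1) / 2 ^ s * ?LL" .
  have "(\<Sum>f\<in>{..l} \<rightarrow>\<^sub>E X. a (f 0) * (?G (f 0) / 2 ^ s + ?Z l f)) * rate ^ l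
      = (\<Sum>f\<in>{..l} \<rightarrow>\<^sub>E X. a (f 0) * ?G (f 0)) * rate ^ l / 2 ^ s + (\<Sum>f\<in>{..l} \<rightarrow>\<^sub>E X. a (f 0) * ?Z l f) * rate ^ l"
  proof -
    have "(\<Sum>f\<in>{..l} \<rightarrow>\<^sub>E X. a (f 0) * (?G (f 0) / 2 ^ s + ?Z l f))
        = (\<Sum>f\<in>{..l} \<rightarrow>\<^sub>E X. a (f 0) * ?G (f 0)) / 2 ^ s + (\<Sum>f\<in>{..l} \<rightarrow>\<^sub>E X. a (f 0) * ?Z l f)"
      by (simp add: distrib_left sum.distrib sum_divide_distrib)
    then show ?thesis by (simp add: distrib_right)
  qed
  also have "\<dots> \<le> \<psi> ^ l / 2 ^ s * ?LL + real (card (small_sets L l)) * real (l + 1) * 3 ^ c * \<psi> ^ (l - 1) / 2 ^ s * ?LL"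
    by (rule add_mono[OF 1 2])
  finally show ?thesis by (simp only: add_divide_distrib distrib_right)
qed

lemma sum_mult_weight_Suc:
  "(\<Sum>y\<in>X. a y * weight L K (Suc m) y)
      = (\<Sum>l\<in>{..card X}. real (l + 1) ^ K * ((\<Sum>f\<in>{..l} \<rightarrow>\<^sub>E X. a (f 0) * (weight L K m (f 0) / 2 ^ s + branch_weight L K m l f)) * rate ^ l))"
proof -
  let ?G = "weight L K m"
  let ?Z = "\<lambda>l f. branch_weight L K m l f"
  have "(\<Sum>y\<in>X. a y * weight L K (Suc m) y)
      = (\<Sum>y\<in>X. \<Sum>l\<in>{..card X}. \<Sum>f\<in>{..l} \<rightarrow>\<^sub>E X. a y * (rate ^ l * real (l + 1) ^ K * (of_bool (f 0 = y) * (?G y / 2 ^ s + ?Z l f))))"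
    by (simp only: weight.simps branch_weight_def[symmetric] sum_distrib_left)
  also have "\<dots> = (\<Sum>l\<in>{..card X}. \<Sum>f\<in>{..l} \<rightarrow>\<^sub>E X. \<Sum>y\<in>X. a y * (rate ^ l * real (l + 1) ^ K * (of_bool (f 0 = y) * (?G y / 2 ^ s + ?Z l f))))"
    by (subst sum.swap, intro sum.cong refl, subst sum.swap, rule refl)
  also have "\<dots> = (\<Sum>l\<in>{..card X}. \<Sum>f\<in>{..l} \<rightarrow>\<^sub>E X. real (l + 1) ^ K * (a (f 0) * (?G (f 0) / 2 ^ s + ?Z l f) * rate ^ l))"
  proof (intro sum.cong refl)
    fix l :: nat and f assume f: "f \<in> {..l} \<rightarrow>\<^sub>E X"
    have "(\<Sum>y\<in>X. a y * (rate ^ l * real (l + 1) ^ K * (of_bool (f 0 = y) * (?G y / 2 ^ s + ?Z l f))))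
      = (\<Sum>y\<in>X. if f 0 = y then real (l + 1) ^ K * (a y * (?G y / 2 ^ s + ?Z l f) * rate ^ l) else 0)"
    proof (intro sum.cong refl)
      fix y
      show "a y * (rate ^ l * real (l + 1) ^ K * (of_bool (f 0 = y) * (?G y / 2 ^ s + ?Z l f)))
        = (if f 0 = y then real (l + 1) ^ K * (a y * (?G y / 2 ^ s + ?Z l f) * rate ^ l) else 0)"
        by (cases "f 0 = y") (simp_all add: ac_simps)
    qed
    also have "\<dots> = real (l + 1) ^ K * (a (f 0) * (?G (f 0) / 2 ^ s + ?Z l f) * rate ^ l)"
      using f finite_X by (subst sum.delta') (auto simp: PiE_iff)
    finally show "(\<Sum>y\<in>X. a y * (rate ^ l * real (l + 1) ^ K * (of_bool (f 0 = y) * (?G y / 2 ^ s + ?Z l f))))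
      = real (l + 1) ^ K * (a (f 0) * (?G (f 0) / 2 ^ s + ?Z l f) * rate ^ l)" .
  qed
  finally show ?thesis by (simp only: sum_distrib_left sum_distrib_right)
qed

lemma sum_mult_weight_le:
  assumes \<psi>: "rate * real (card X) \<le> \<psi>" and a: "\<And>y. a y \<ge> 0"
  shows "(\<Sum>y\<in>X. a y * weight L K (Suc m) y)
    \<le> (\<Sum>l\<in>{..card X}. segment_const L K \<psi> l) / 2 ^ s * L2_set a X * L2_set (weight L K m) X"
proof -
  have "(\<Sum>y\<in>X. a y * weight L K (Suc m) y)
    \<le> (\<Sum>l\<in>{..card X}. real (l + 1) ^ K * ((\<psi> ^ l + real (card (small_sets L l)) * real (l + 1) * 3 ^ c * \<psi> ^ (l - 1)) / 2 ^ s
        * (L2_set a X * L2_set (weight L K m) X)))"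
    unfolding sum_mult_weight_Suc by (intro sum_mono mult_left_mono segment_weight_le \<psi> a) auto
  also have "\<dots> = (\<Sum>l\<in>{..card X}. segment_const L K \<psi> l) / 2 ^ s * L2_set a X * L2_set (weight L K m) X"
    unfolding segment_const_def sum_divide_distrib sum_distrib_right
    by (intro sum.cong refl) (simp only: times_divide_eq_left times_divide_eq_right mult.assoc)
  finally show ?thesis .
qed

text \<open>The bilinear bound is tested against \<open>weight L K (Suc m)\<close> itself, and one
  factor of its norm is cancelled. Each walk thus multiplies the norm by at most C/2^s.\<close>

lemma L2_set_weight_le:
  assumes \<psi>: "rate * real (card X) \<le> \<psi>" and C: "(\<Sum>l\<in>{..card X}. segment_const L K \<psi> l) \<le> C"
  shows "L2_set (weight L K m) X \<le> (C / 2 ^ s) ^ m * sqrt (real (card X))"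
proof (induction m)
  case 0
  then show ?case by (simp add: L2_set_def)
next
  case (Suc m)
  let ?a = "L2_set (weight L K (Suc m)) X" and ?g = "L2_set (weight L K m) X"
  have \<psi>0: "\<psi> \<ge> 0" using \<psi> rate_nonneg by (meson mult_nonneg_nonneg of_nat_0_le_iff order_trans)
  have "(\<Sum>l\<in>{..card X}. segment_const L K \<psi> l) \<ge> 0"
    unfolding segment_const_def using \<psi>0 by (intro sum_nonneg) auto
  then have C0: "C \<ge> 0" using C by simp
  have "?a * ?a = (\<Sum>y\<in>X. weight L K (Suc m) y * weight L K (Suc m) y)"
    unfolding L2_set_def power2_eq_square by (intro real_sqrt_mult_self[THEN trans] abs_of_nonneg sum_nonneg) auto
  also have "\<dots> \<le> (\<Sum>l\<in>{..card X}. segment_const L K \<psi> l) / 2 ^ s * ?a * ?g"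
    by (rule sum_mult_weight_le[OF \<psi> weight_nonneg])
  also have "\<dots> \<le> C / 2 ^ s * ?a * ?g"
    by (intro mult_right_mono divide_right_mono C) auto
  finally have le: "?a * ?a \<le> (C / 2 ^ s * ?g) * ?a" by (simp only: ac_simps)
  have "?a \<le> C / 2 ^ s * ?g"
  proof (cases "?a = 0")
    case True
    have "C / 2 ^ s * ?g \<ge> 0" using C0 by simp
    then show ?thesis using True by linarith
  next
    case False
    then have "?a > 0" using L2_set_nonneg[of "weight L K (Suc m)" X] by linarith
    then show ?thesis using le by (rule mult_right_le_imp_le[rotated])
  qed
  also have "\<dots> \<le> C / 2 ^ s * ((C / 2 ^ s) ^ m * sqrt (real (card X)))"
    using C0 by (intro mult_left_mono Suc) auto
  finally show ?case by (simp only: power_Suc mult.assoc)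
qed

text \<open>Cauchy--Schwarz against the constant one: the first root is unrestricted, and the two
  square roots combine to |X|.\<close>

lemma sum_weight_le:
  assumes "rate * real (card X) \<le> \<psi>" "(\<Sum>l\<in>{..card X}. segment_const L K \<psi> l) \<le> C"
  shows "(\<Sum>y\<in>X. weight L K m y) \<le> (C / 2 ^ s) ^ m * real (card X)"
proof -
  have "(\<Sum>y\<in>X. 1 * weight L K m y) \<le> L2_set (\<lambda>_. 1) X * L2_set (weight L K m) X"
    by (rule sum_mult_le_L2_set) (auto simp: weight_nonneg)
  also have "\<dots> \<le> sqrt (real (card X)) * ((C / 2 ^ s) ^ m * sqrt (real (card X)))"
    unfolding L2_set_one by (intro mult_left_mono L2_set_weight_le[OF assms]) auto
  also have "\<dots> = (C / 2 ^ s) ^ m * (sqrt (real (card X)) * sqrt (real (card X)))" by (simp only: ac_simps)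
  finally show ?thesis by simp
qed

section \<open>Walks closed by a large dependency\<close>

text \<open>Only a single walk with its own equalities is recorded, without the earlier exploration,
  since such a walk is improbable enough on its own.\<close>

definition large_dependency :: "nat \<Rightarrow> nat \<Rightarrow> tables \<times> tables \<Rightarrow> bool" where
  "large_dependency L i T \<longleftrightarrow> (\<exists>l\<in>{..card X}. \<exists>f\<in>{f \<in> {..l} \<rightarrow>\<^sub>E X. \<exists>w\<in>X. \<exists>S\<subseteq>{..l}. card S \<ge> L \<and> key_dependent f S w}.
     (admissible (f ` {..l}) (alt_path f i l) (Suc i) \<and> card (f ` {..l}) = l + 1 \<and> card (alt_path f i l) = l) \<and> T \<in> path_event (f ` {..l}) (alt_path f i l))"

text \<open>The walk event has probability 2^s \<open>rate ^ (l + 1)\<close>, and only l+1-D of its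
  keys are free. The \<open>D\<close> unpaired rates are at most 1/2^s each.\<close>

lemma prob_large_dependency_le:
  assumes \<psi>: "rate * real (card X) \<le> \<psi>" and i: "2 * Suc i \<le> d"
  shows "measure_pmf.prob M {T. large_dependency ((D + 1) * (c + 1)) i T}
    \<le> 2 ^ s * (1 / 2 ^ s) ^ D * (\<Sum>l\<in>{..card X}. real (l + 2) ^ ((D + 1) * (c + 1)) * \<psi> ^ (l + 1 - D))"
proof -
  let ?L = "(D + 1) * (c + 1)"
  let ?B = "\<lambda>l. {f \<in> {..l} \<rightarrow>\<^sub>E X. \<exists>w\<in>X. \<exists>S\<subseteq>{..l}. card S \<ge> ?L \<and> key_dependent f S w}"
  let ?k = "\<lambda>l. (1 / 2 ^ s) ^ l * (1 / 2 ^ b) ^ (l + 1) :: real"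
  have \<psi>0: "\<psi> \<ge> 0" using \<psi> rate_nonneg by (meson mult_nonneg_nonneg of_nat_0_le_iff order_trans)
  have finB: "finite (?B l)" for l using finite_paths by simp
  have ev_le: "measure_pmf.prob M {T. T \<in> path_event (f ` {..l}) (alt_path f i l)} \<le> ?k l"
    if "admissible (f ` {..l}) (alt_path f i l) (Suc i) \<and> card (f ` {..l}) = l + 1 \<and> card (alt_path f i l) = l" for f l
    using prob_path_event[of "f ` {..l}" "alt_path f i l" "Suc i"] that i by simp
  have "measure_pmf.prob M {T. large_dependency ?L i T} \<le> (\<Sum>l\<in>{..card X}. \<Sum>f\<in>?B l. ?k l)"
    unfolding large_dependency_def
    by (rule order_trans[OF prob_ex_le[OF finite_atMost]], rule sum_mono,
        rule order_trans[OF prob_ex_le[OF finB]], rule sum_mono,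
        rule order_trans[OF prob_guarded_le[OF ev_le]]) (auto intro: mult_left_le_one_le)
  also have "\<dots> = (\<Sum>l\<in>{..card X}. real (card (?B l)) * ?k l)" by simp
  also have "\<dots> \<le> (\<Sum>l\<in>{..card X}. 2 ^ s * (1 / 2 ^ s) ^ D * (real (l + 2) ^ ?L * \<psi> ^ (l + 1 - D)))"
  proof (rule sum_mono)
    fix l
    show "real (card (?B l)) * ?k l \<le> 2 ^ s * (1 / 2 ^ s) ^ D * (real (l + 2) ^ ?L * \<psi> ^ (l + 1 - D))"
    proof (cases "?B l = {}")
      case True
      show ?thesis unfolding True using \<psi>0 by simp
    next
      case False
      then obtain S where "S \<subseteq> {..l}" "card S \<ge> ?L" by blast
      then have "?L \<le> l + 1" using card_mono[of "{..l}" S] by simp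
      moreover have "D \<le> ?L" by simp
      \<comment> \<open>A dependency of this size fits only into a walk with at least
        \<open>D\<close> keys, so the subtraction is not truncated.\<close>
      ultimately obtain e where e: "l + 1 = D + e" using le_Suc_ex le_trans by metis
      have cB: "card (?B l) \<le> (l + 2) ^ ?L * card X ^ (l + 1 - D)"
        using card_large_dependencies_le[OF finite_X keys_inj_X, of l D] unfolding key_dependent_def .
      have "real (card (?B l)) * ?k l \<le> real ((l + 2) ^ ?L * card X ^ (l + 1 - D)) * ?k l"
        by (intro mult_right_mono) (use cB in \<open>simp_all only: of_nat_le_iff\<close>, simp)
      also have "\<dots> = real (l + 2) ^ ?L * (2 ^ s * rate ^ (l + 1) * real (card X) ^ (l + 1 - D))"
        by (simp add: rate_def power_divide power_mult_distrib field_simps)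
      also have "\<dots> = real (l + 2) ^ ?L * (2 ^ s * rate ^ D * (rate * real (card X)) ^ e)"
      proof -
        have e1: "rate ^ (l + 1) = rate ^ D * rate ^ e" by (simp only: e power_add)
        have e2: "l + 1 - D = e" by (simp only: e diff_add_inverse)
        show ?thesis unfolding e1 e2 power_mult_distrib by (simp only: ac_simps)
      qed
      also have "\<dots> \<le> real (l + 2) ^ ?L * (2 ^ s * (1 / 2 ^ s) ^ D * \<psi> ^ e)"
      proof (intro mult_left_mono mult_mono power_mono \<psi>)
        show "rate \<le> 1 / 2 ^ s" by (simp add: rate_def field_simps)
      qed (auto simp: rate_nonneg)
      also have "\<dots> = 2 ^ s * (1 / 2 ^ s) ^ D * (real (l + 2) ^ ?L * \<psi> ^ (l + 1 - D))"
        unfolding e diff_add_inverse by (simp only: ac_simps)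
      finally show ?thesis .
    qed
  qed
  finally show ?thesis by (simp only: sum_distrib_left)
qed

section \<open>Why the exploration finds every dependency\<close>

text \<open>The walk uses two derived positions that no earlier equality uses. At each position the
  equalities are therefore either the old ones or edges of the new path alone, and nothing is
  counted twice.\<close>

lemma extends_path:
  assumes admissible: "admissible E Cn i" and ind: "indep (E \<union> g ` {1..l}) kv" and inj: "inj_on g {1..l}" "g ` {1..l} \<inter> E = {}"
    and g: "g 0 \<in> E" "\<And>t. t \<le> l \<Longrightarrow> g t \<in> X"
  shows "inj_on g {..l}" "indep (g ` {..l}) kv" "extends E Cn l l (E \<union> g ` {1..l}) (Cn \<union> alt_path g i l) i"
proof -
  have e: "{..l} = insert 0 {1..l}" by auto
  have "g 0 \<notin> g ` {1..l}" using inj(2) g(1) by blast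
  then show injg: "inj_on g {..l}" unfolding e using inj(1) by (auto simp: inj_on_insert)
  have "g ` {..l} \<subseteq> E \<union> g ` {1..l}" unfolding e using g(1) by auto
  then show indg: "indep (g ` {..l}) kv" using ind indep_subset by blast
  have W: "finite E" "E \<subseteq> X" "finite Cn" "\<And>x x' j. (x, x', j) \<in> Cn \<Longrightarrow> j < 2 * i"
    "\<And>j. indep {t \<in> Cn. snd (snd t) = j} pair_kv" using admissible unfolding admissible_def by auto
  have disj: "Cn \<inter> alt_path g i l = {}" using W(4) unfolding alt_path_def by fastforce
  have fp: "finite (alt_path g i l)" unfolding alt_path_def by simp
  have "indep {t \<in> Cn \<union> alt_path g i l. snd (snd t) = j} pair_kv" for j
  proof (cases "j < 2 * i")
    case True
    then have "{t \<in> Cn \<union> alt_path g i l. snd (snd t) = j} = {t \<in> Cn. snd (snd t) = j}"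
      unfolding alt_path_def by auto
    then show ?thesis using W(5) by simp
  next
    case False
    then have "{t \<in> Cn \<union> alt_path g i l. snd (snd t) = j} = {t \<in> alt_path g i l. snd (snd t) = j}"
      using W(4) by auto
    then show ?thesis using indep_path[OF injg indg] by simp
  qed
  moreover have "\<forall>(x, x', j)\<in>Cn \<union> alt_path g i l. j < 2 * Suc i"
    using W(4) unfolding alt_path_def by (fastforce simp: less_Suc_eq)
  moreover have "g ` {1..l} \<subseteq> X" using g(2) by auto
  ultimately have "admissible (E \<union> g ` {1..l}) (Cn \<union> alt_path g i l) (Suc i)"
    unfolding admissible_def using W(1-3) ind fp by blast
  moreover have "card (E \<union> g ` {1..l}) = card E + l"
    using W(1) inj by (subst card_Un_disjoint) (auto simp: card_image)
  moreover have "card (Cn \<union> alt_path g i l) = card Cn + l"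
    using W(3) fp disj card_path[OF injg] by (subst card_Un_disjoint) auto
  ultimately show "extends E Cn l l (E \<union> g ` {1..l}) (Cn \<union> alt_path g i l) i" unfolding extends_def by blast
qed

text \<open>At the position of the closing edge there are only path edges, so being outside their
  span suffices.\<close>

lemma extends_path_closing:
  assumes admissible: "admissible E Cn i" and ext: "extends E Cn l l E' (Cn \<union> alt_path g i l) i"
    and j: "j = 2 * i + l mod 2"
    and ns: "\<not> in_span {t \<in> alt_path g i l. snd (snd t) = j} pair_kv (pair_kv (x, w, j))"
  shows "extends E Cn l (Suc l) E' (insert (x, w, j) (Cn \<union> alt_path g i l)) i"
proof -
  have W: "\<And>x x' j. (x, x', j) \<in> Cn \<Longrightarrow> j < 2 * i" using admissible unfolding admissible_def by auto
  have W': "finite E'" "E' \<subseteq> X" "indep E' kv" "finite (Cn \<union> alt_path g i l)"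
    "\<forall>(x, x', j)\<in>Cn \<union> alt_path g i l. j < 2 * Suc i"
    "\<And>j. indep {t \<in> Cn \<union> alt_path g i l. snd (snd t) = j} pair_kv"
    using ext unfolding extends_def admissible_def by auto
  have W2: "snd (snd t) \<noteq> j" if "t \<in> Cn" for t
    using W[of "fst t" "fst (snd t)" "snd (snd t)"] that j by simp
  then have pj: "{t \<in> Cn \<union> alt_path g i l. snd (snd t) = j} = {t \<in> alt_path g i l. snd (snd t) = j}"
    by blast
  have "(x, w, j) \<notin> {t \<in> alt_path g i l. snd (snd t) = j}" by (rule not_in_span_imp_notin[OF ns])
  then have new: "(x, w, j) \<notin> Cn \<union> alt_path g i l" unfolding pj[symmetric] by simp
  have "indep {t \<in> insert (x, w, j) (Cn \<union> alt_path g i l). snd (snd t) = j'} pair_kv" for j'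
  proof (cases "j' = j")
    case True
    then have "{t \<in> insert (x, w, j) (Cn \<union> alt_path g i l). snd (snd t) = j'}
        = insert (x, w, j) {t \<in> alt_path g i l. snd (snd t) = j}"
      unfolding pj[symmetric] by auto
    moreover have "indep (insert (x, w, j) {t \<in> alt_path g i l. snd (snd t) = j}) pair_kv"
    proof (rule indep_insert[OF _ _ ns])
      show "finite {t \<in> alt_path g i l. snd (snd t) = j}" using W'(4) by simp
      show "indep {t \<in> alt_path g i l. snd (snd t) = j} pair_kv" using W'(6)[of j] unfolding pj .
    qed
    ultimately show ?thesis by simp
  next
    case False
    then have "{t \<in> insert (x, w, j) (Cn \<union> alt_path g i l). snd (snd t) = j'} = {t \<in> Cn \<union> alt_path g i l. snd (snd t) = j'}"
      by auto
    then show ?thesis using W'(6) by simp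
  qed
  moreover have "j < 2 * Suc i" unfolding j by simp
  moreover have "card (insert (x, w, j) (Cn \<union> alt_path g i l)) = card Cn + Suc l"
    using new W'(4) ext unfolding extends_def by simp
  ultimately show ?thesis using W'(1-5) ext unfolding extends_def admissible_def by simp
qed


text \<open>
  The edges of the path at the position of its closing edge are disjoint and avoid its last key, so the
  closing equality can only be redundant if \<open>w\<close> is a sum of keys of the path.
\<close>

lemma dependent_of_in_span_path:
  assumes inj: "inj_on g {..l}" and g: "g l \<in> X" and w: "w \<in> X" "w \<noteq> g l"
    and span: "in_span {t \<in> alt_path g i l. snd (snd t) = 2 * i + l mod 2} pair_kv (pair_kv (g l, w, 2 * i + l mod 2))"
  obtains S where "S \<subseteq> {..l}" "card S \<ge> 3" "key_dependent g S w"
proof -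
  obtain S0 where S0: "S0 \<subseteq> {t \<in> alt_path g i l. snd (snd t) = 2 * i + l mod 2}"
    "\<And>q. kv (g l) q + kv w q = (\<Sum>t\<in>S0. pair_kv t q)"
    using span unfolding in_span_def by auto
  obtain R where R: "R \<subseteq> {t. t < l \<and> 2 * i + t mod 2 = 2 * i + l mod 2}" "S0 = {} \<longleftrightarrow> R = {}"
    "\<And>q. (\<Sum>(x, x', _)\<in>S0. kv x q + kv x' q) = (\<Sum>t\<in>R \<union> Suc ` R. kv (g t) q)"
    using sum_path[OF inj S0(1), of kv] by blast
  \<comment> \<open>Edges at the closing position start at the parity of \<open>l\<close>, hence
    none of them ends at time \<open>l\<close>.\<close>
  have Rl: "t < l \<and> Suc t < l" if "t \<in> R" for t
  proof -
    have "t < l" "t mod 2 = l mod 2" using R(1) that by auto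
    then have "Suc t \<noteq> l" by presburger
    then show ?thesis using \<open>t < l\<close> by simp
  qed
  have finR: "finite R" using R(1) finite_subset[of R "{..<l}"] by auto
  define S where "S = insert l (R \<union> Suc ` R)"
  have dep: "key_dependent g S w"
    unfolding key_dependent_def
  proof
    fix q
    have "l \<notin> R \<union> Suc ` R" using Rl by auto
    then have "(\<Sum>t\<in>S. kv (g t) q) = kv (g l) q + (\<Sum>t\<in>R \<union> Suc ` R. kv (g t) q)"
      unfolding S_def using finR by simp
    also have "\<dots> = kv (g l) q + (kv (g l) q + kv w q)"
      unfolding R(3)[symmetric] S0(2) by (simp add: case_prod_beta)
    also have "\<dots> = kv w q" by (simp add: add.assoc[symmetric])
    finally show "kv w q = (\<Sum>t\<in>S. kv (g t) q)" by simp
  qed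
  \<comment> \<open>Without edges the vector of \<open>w\<close> would be that of the last key,
    although a partner is a different key. One edge and time \<open>l\<close> already give three
    slots.\<close>
  have "R \<noteq> {}"
  proof
    assume "R = {}"
    then have eq: "kv w q = kv (g l) q" for q using dep unfolding key_dependent_def S_def by (simp del: split_paired_All)
    have "character s w k = character s (g l) k" if "k < c" for k
      using eq[of "(k, character s w k)"] that by (simp add: kvec_def)
    then have "w = g l" using keys_inj_X w(1) g unfolding keys_inj_def by blast
    then show False using w(2) by simp
  qed
  then obtain t where t: "t \<in> R" by blast
  have "{t, Suc t, l} \<subseteq> S" using t unfolding S_def by auto
  moreover have "card {t, Suc t, l} = 3" using Rl[OF t] by simp
  moreover have "finite S" unfolding S_def using finR by simp
  ultimately have "card S \<ge> 3" by (metis card_mono)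
  moreover have "S \<subseteq> {..l}" unfolding S_def using Rl by (auto simp: less_imp_le)
  ultimately show thesis using that dep by blast
qed

lemma ex_root_choice:
  assumes "card S \<ge> 3" "S \<subseteq> {..l}"
  obtains j where "j \<in> {..l}" "root_choice S j"
proof (cases "0 \<in> S")
  case True
  have "\<not> S \<subseteq> {0}" using assms(1) card_mono[of "{0}" S] by auto
  then obtain j where "j \<in> S" "j \<noteq> 0" by blast
  then show thesis using that[of j] True assms(2) unfolding root_choice_def by auto
next
  case False
  then show thesis using that[of 0] unfolding root_choice_def by simp
qed

text \<open>Each character of \<open>w\<close> is a coordinate with value one, which some summand
  must share.\<close>

lemma in_box_of_in_span:
  assumes "in_span E kv (kv w)"
  shows "in_box E w"
  unfolding in_box_def
proof (intro allI impI)
  fix k assume k: "k < c"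
  obtain S where S: "S \<subseteq> E" "\<And>q. kv w q = (\<Sum>e\<in>S. kv e q)" using assms unfolding in_span_def by blast
  have "kv w (k, character s w k) = 1" using k by (simp add: kvec_def)
  then have "(\<Sum>e\<in>S. kv e (k, character s w k)) \<noteq> 0" by (simp add: S(2)[symmetric])
  then obtain e where "e \<in> S" "kv e (k, character s w k) \<noteq> 0" by (meson sum.neutral)
  then show "\<exists>e\<in>E. character s w k = character s e k"
    using S(1) by (intro bexI[of _ e]) (auto simp: kvec_def split: if_splits)
qed

text \<open>The deterministic part: all walks remain in the set \<open>A\<close>, where partners
  exist at every derived position. The invariant is that the explored keys lie in \<open>A\<close>
  and contain the root.\<close>

lemma reach_if_no_large_dependency:
  assumes A: "A \<subseteq> selected T" and D: "2 * D \<le> d"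
    and partner: "\<And>x j. x \<in> A \<Longrightarrow> j < d \<Longrightarrow> \<exists>x'\<in>A. x' \<noteq> x \<and> dchar T x j = dchar T x' j"
    and nb: "\<And>i. i < D \<Longrightarrow> \<not> large_dependency L i T"
  shows "admissible E Cn i \<Longrightarrow> E \<subseteq> A \<Longrightarrow> y \<in> E \<Longrightarrow> T \<in> path_event E Cn \<Longrightarrow> i + m = D \<Longrightarrow> reach L m i E Cn y T"
proof (induction m arbitrary: i E Cn y)
  case 0
  then show ?case by simp
next
  case (Suc m)
  have AX: "A \<subseteq> X" using A unfolding selected_keys_def by auto
  have finA: "finite A" using AX finite_X finite_subset by blast
  have id: "2 * Suc i \<le> d" using Suc.prems(5) D by simp
  \<comment> \<open>The partner used at time \<open>t\<close>; its derived position follows the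
    parity of \<open>t\<close>.\<close>
  define nx where "nx t x = (SOME x'. x' \<in> A \<and> x' \<noteq> x \<and> dchar T x (2 * i + t mod 2) = dchar T x' (2 * i + t mod 2))" for t x
  have nx: "nx t x \<in> A \<and> nx t x \<noteq> x \<and> dchar T x (2 * i + t mod 2) = dchar T (nx t x) (2 * i + t mod 2)" if "x \<in> A" for t x
  proof -
    have "2 * i + a < d" if "a < 2" for a using id that by simp
    then have "2 * i + t mod 2 < d" by simp
    then have "\<exists>x'. x' \<in> A \<and> x' \<noteq> x \<and> dchar T x (2 * i + t mod 2) = dchar T x' (2 * i + t mod 2)"
      using partner[OF that] by blast
    then show ?thesis unfolding nx_def by (rule someI_ex)
  qed
  define f where "f = rec_nat y nx"
  have f0: "f 0 = y" and fS: "f (Suc t) = nx t (f t)" for t by (simp_all add: f_def)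
  have fA: "f t \<in> A" for t
  proof (induction t)
    case 0
    show ?case unfolding f0 by (rule subsetD[OF Suc.prems(2,3)])
  next
    case (Suc t)
    then show ?case unfolding fS by (rule nx[THEN conjunct1])
  qed
  have indE: "indep E kv" using Suc.prems(1) unfolding admissible_def by blast
  obtain l where l: "in_span (E \<union> f ` {1..l}) kv (kv (f (Suc l)))" "indep (E \<union> f ` {1..l}) kv"
    "inj_on f {1..l}" "f ` {1..l} \<inter> E = {}"
    using ex_independent_path[OF finA Suc.prems(2) indE fA] .
  \<comment> \<open>Walks are enumerated as extensional functions on \<open>{..l}\<close>, so the
    infinite walk is cut off.\<close>
  define g where "g = restrict f {..l}"
  define w where "w = f (Suc l)"
  define E' where "E' = E \<union> g ` {1..l}"
  define P where "P = Cn \<union> alt_path g i l"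
  have gf: "g t = f t" if "t \<le> l" for t using that by (simp add: g_def)
  have gim: "g ` {1..l} = f ` {1..l}" by (rule image_cong[OF refl]) (simp add: gf)
  have gX: "g t \<in> X" if "t \<le> l" for t unfolding gf[OF that] using fA AX by blast
  have gPi: "g \<in> {..l} \<rightarrow>\<^sub>E X" unfolding g_def restrict_PiE_iff using fA AX by blast
  have g0: "g 0 = y" by (simp add: gf f0)
  have injg1: "inj_on g {1..l}" 
    by (rule inj_on_cong[THEN iffD2, OF _ l(3)]) (simp add: gf)
  have ext0: "inj_on g {..l}" "indep (g ` {..l}) kv" "extends E Cn l l E' P i"
  proof -
    have "indep (E \<union> g ` {1..l}) kv" "g ` {1..l} \<inter> E = {}" unfolding gim by (rule l(2) l(4))+
    moreover have "g 0 \<in> E" unfolding g0 by (rule Suc.prems(3))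
    ultimately have *: "indep (E \<union> g ` {1..l}) kv" "g ` {1..l} \<inter> E = {}" "g 0 \<in> E" by blast+
    show "inj_on g {..l}" "indep (g ` {..l}) kv" "extends E Cn l l E' P i"
      unfolding E'_def P_def using extends_path[OF Suc.prems(1) *(1) injg1 *(2,3) gX] by blast+
  qed
  have w: "w \<in> A" "w \<noteq> g l" "dchar T (g l) (2 * i + l mod 2) = dchar T w (2 * i + l mod 2)"
    unfolding w_def fS using nx[OF fA, of l l] gf by auto
  have lX: "l \<le> card X"
  proof -
    have "l = card (g ` {1..l})" using injg1 by (simp add: card_image)
    also have "\<dots> \<le> card X" using gX finite_X by (intro card_mono) auto
    finally show ?thesis .
  qed
  have E'A: "E' \<subseteq> A" unfolding E'_def gim using Suc.prems(2) fA by auto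
  have path_ev: "dchar T x j = dchar T x' j" if m: "(x, x', j) \<in> alt_path g i l" for x x' j
  proof -
    obtain t where t: "t < l" "x = g t" "x' = g (Suc t)" "j = 2 * i + t mod 2"
      using m unfolding alt_path_def by auto
    then show ?thesis using nx[OF fA, of t t] by (simp add: gf fS)
  qed
  have evP: "T \<in> path_event E' P"
    using Suc.prems(4) path_ev E'A A unfolding path_event_def P_def by blast
  show ?case
  proof (cases "in_span {t \<in> alt_path g i l. snd (snd t) = 2 * i + l mod 2} pair_kv (pair_kv (g l, w, 2 * i + l mod 2))")
    case False
    define Cn' where "Cn' = insert (g l, w, 2 * i + l mod 2) P"
    have ext: "extends E Cn l (Suc l) E' Cn' i"
      unfolding Cn'_def P_def
      by (rule extends_path_closing[OF Suc.prems(1) _ refl False]) (use ext0(3) P_def in simp)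
    have "reach L m (Suc i) E' Cn' y T"
    proof (rule Suc.IH)
      show "admissible E' Cn' (Suc i)" using ext unfolding extends_def by blast
      show "T \<in> path_event E' Cn'" using evP w(3) unfolding path_event_def Cn'_def by simp
    qed (use E'A Suc.prems(3,5) E'_def in auto)
    moreover have "in_box E' w" unfolding E'_def gim w_def by (rule in_box_of_in_span[OF l(1)])
    moreover have "w \<in> X" using w(1) AX by blast
    ultimately show ?thesis
      using lX gPi g0 ext unfolding Cn'_def P_def E'_def
      by (simp only: reach.simps, intro bexI[of _ l] bexI[of _ g] conjI disjI1 bexI[of _ w]) simp_all
  next
    case True
    obtain S where S: "S \<subseteq> {..l}" "card S \<ge> 3" "key_dependent g S w"
      by (rule dependent_of_in_span_path[OF ext0(1) gX[OF order_refl] _ w(2) True]) (use w(1) AX in auto)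
    have "card S < L"
    proof (rule ccontr)
      assume "\<not> card S < L"
      then have mem: "g \<in> {f \<in> {..l} \<rightarrow>\<^sub>E X. \<exists>w\<in>X. \<exists>S\<subseteq>{..l}. card S \<ge> L \<and> key_dependent f S w}"
        using gPi S w(1) AX by (auto simp: not_less)
      \<comment> \<open>Earlier keys and equalities are dropped, and the walk is regarded as an
        extension of its root alone.\<close>
      have wf0: "admissible {y} {} i"
        unfolding admissible_def using Suc.prems(1-3) indE AX indep_subset[of E kv "{y}"] by (auto simp: indep_def)
      have sub: "{y} \<union> g ` {1..l} = g ` {..l}"
      proof -
        have "{..l} = insert 0 {1..l}" by auto
        then show ?thesis using g0 by simp
      qed
      have "extends {y} {} l l ({y} \<union> g ` {1..l}) ({} \<union> alt_path g i l) i"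
      proof (rule extends_path(3)[OF wf0])
        show "indep ({y} \<union> g ` {1..l}) kv" using ext0(2) unfolding sub .
        show "g ` {1..l} \<inter> {y} = {}" unfolding gim using l(4) Suc.prems(3) by blast
      qed (use injg1 g0 gX in auto)
      then have "admissible (g ` {..l}) (alt_path g i l) (Suc i) \<and> card (g ` {..l}) = l + 1 \<and> card (alt_path g i l) = l"
        unfolding sub extends_def by simp
      moreover have "T \<in> path_event (g ` {..l}) (alt_path g i l)"
        unfolding path_event_def using path_ev gf fA A by auto
      ultimately have "large_dependency L i T" unfolding large_dependency_def using lX mem by blast
      then show False using nb[of i] Suc.prems(5) by simp
    qed
    then have Ss: "S \<in> small_sets L l" using S unfolding small_sets_def by simp
    obtain j where j: "j \<in> {..l}" "root_choice S j" by (rule ex_root_choice[OF S(2,1)])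
    \<comment> \<open>Slot 0 is not among the newly added keys, but the old root belongs to
      \<open>E\<close>.\<close>
    have gj: "g j \<in> E'"
      using j(1) g0 Suc.prems(3) unfolding E'_def by (cases j) auto
    have "reach L m (Suc i) E' P (g j) T"
    proof (rule Suc.IH)
      show "admissible E' P (Suc i)" using ext0(3) unfolding extends_def by blast
    qed (use E'A gj evP Suc.prems(5) in auto)
    moreover have "w \<in> X" using w(1) AX by blast
    ultimately show ?thesis
      using lX gPi g0 ext0(3) Ss j S(3) unfolding P_def E'_def
      by (simp only: reach.simps, intro bexI[of _ l] bexI[of _ g] conjI disjI2 bexI[of _ S] bexI[of _ j] bexI[of _ w]) simp_all
  qed
qed

text \<open>A dependency of derived keys is a zero sum over some \<open>A\<close>. Reading it at the
  positions \<open>c + j\<close> supplies the partners that drive the walks, starting from any key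
  of \<open>A\<close>.\<close>

lemma remaining_bits_independent_if_not_reach:
  assumes T: "T \<in> set_pmf M" and D: "2 * D \<le> d"
    and nb: "\<And>i. i < D \<Longrightarrow> \<not> large_dependency L i T" and nr: "\<And>y. y \<in> X \<Longrightarrow> \<not> (admissible {y} {} 0 \<and> reach L D 0 {y} {} y T)"
  shows "remaining_bits_independent s c d r X b p v T"
proof -
  obtain T1 T2 where TT: "T = (T1, T2)" by (cases T)
  let ?f = "\<lambda>x. kvec (c + d) (\<lambda>i x. character s x i) (derived_key s c T1 x)"
  have "indep (selected T) ?f"
  proof (rule ccontr)
    assume "\<not> ?thesis"
    then obtain A where A: "A \<subseteq> selected T" "A \<noteq> {}" "\<And>q. (\<Sum>x\<in>A. ?f x q) = 0"
      unfolding indep_def by auto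
    have AX: "A \<subseteq> X" using A(1) unfolding selected_keys_def by auto
    have finA: "finite A" using AX finite_X finite_subset by blast
    have partner: "\<exists>x'\<in>A. x' \<noteq> x \<and> dchar T x j = dchar T x' j" if x: "x \<in> A" and j: "j < d" for x j
    proof -
      obtain x' where x': "x' \<in> A" "x' \<noteq> x"
        "character s (derived_key s c T1 x') (c + j) = character s (derived_key s c T1 x) (c + j)"
        using partner_of_sum_zero[OF finA A(3) x, of "c + j"] j by auto
      have "x < (2 ^ s) ^ c" "x' < (2 ^ s) ^ c" using x x'(1) AX X by auto
      then show ?thesis using x' by (auto simp: character_derived_key TT intro!: bexI[of _ x'])
    qed
    obtain y where y: "y \<in> A" using A(2) by blast
    have "y \<in> X" using y AX by blast
    have "kv y (0, character s y 0) = 1" using c by (simp add: kvec_def)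
    then have "indep {y} kv"
      unfolding indep_def subset_singleton_iff by (auto simp del: split_paired_Ex)
    then have wf0: "admissible {y} {} 0" unfolding admissible_def using \<open>y \<in> X\<close> by (simp add: indep_def)
    moreover have "reach L D 0 {y} {} y T"
      by (rule reach_if_no_large_dependency[OF A(1) D partner nb wf0]) (use y A(1) in \<open>auto simp: path_event_def\<close>)
    ultimately show False using nr \<open>y \<in> X\<close> by blast
  qed
  then show ?thesis
    using remaining_bits_independentI[of T1 T2 s c d r "selected T" X b p v] T finite_X unfolding TT by blast
qed

section \<open>Putting the bounds together\<close>

lemma prob_remaining_bits_dependent_le:
  assumes \<psi>: "rate * real (card X) \<le> \<psi>" and D: "2 * D \<le> d"
    and C: "(\<Sum>l\<in>{..card X}. segment_const ((D + 1) * (c + 1)) (c * D) \<psi> l) \<le> C"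
    and C': "(\<Sum>l\<in>{..card X}. real (l + 2) ^ ((D + 1) * (c + 1)) * \<psi> ^ (l + 1 - D)) \<le> C'"
  shows "measure_pmf.prob M {T. \<not> remaining_bits_independent s c d r X b p v T}
    \<le> (real D * C' + 2 ^ (c * D) * C ^ D * \<psi>) * (2 ^ s * (1 / 2 ^ s) ^ D)"
proof -
  let ?L = "(D + 1) * (c + 1)"
  let ?P = "\<lambda>y T. admissible {y} {} 0 \<and> reach ?L D 0 {y} {} y T"
  have C0: "C \<ge> 0"
  proof -
    have "\<psi> \<ge> 0" using \<psi> rate_nonneg by (meson mult_nonneg_nonneg of_nat_0_le_iff order_trans)
    then have "(\<Sum>l\<in>{..card X}. segment_const ?L (c * D) \<psi> l) \<ge> 0"
      unfolding segment_const_def by (intro sum_nonneg) auto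
    then show ?thesis using C by simp
  qed
  have "measure_pmf.prob M {T. \<not> remaining_bits_independent s c d r X b p v T}
      \<le> measure_pmf.prob M {T. (\<exists>i\<in>{..<D}. large_dependency ?L i T) \<or> (\<exists>y\<in>X. ?P y T)}"
  proof (rule measure_pmf.finite_measure_mono_AE)
    show "AE T in M. T \<in> {T. \<not> remaining_bits_independent s c d r X b p v T} \<longrightarrow>
        T \<in> {T. (\<exists>i\<in>{..<D}. large_dependency ?L i T) \<or> (\<exists>y\<in>X. ?P y T)}"
      by (rule AE_pmfI) (use remaining_bits_independent_if_not_reach[OF _ D, of _ ?L] in blast)
  qed simp
  also have "\<dots> \<le> measure_pmf.prob M {T. \<exists>i\<in>{..<D}. large_dependency ?L i T} + measure_pmf.prob M {T. \<exists>y\<in>X. ?P y T}"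
    by (rule prob_disj_le)
  also have "measure_pmf.prob M {T. \<exists>i\<in>{..<D}. large_dependency ?L i T} \<le> (\<Sum>i\<in>{..<D}. 2 ^ s * (1 / 2 ^ s) ^ D * C')"
  proof (rule order_trans[OF prob_ex_le], simp, rule sum_mono)
    fix i assume "i \<in> {..<D}"
    then have "2 * Suc i \<le> d" using D by simp
    from prob_large_dependency_le[OF \<psi> this, of D]
    show "measure_pmf.prob M {T. large_dependency ?L i T} \<le> 2 ^ s * (1 / 2 ^ s) ^ D * C'"
      by (rule order_trans) (intro mult_left_mono C', simp)
  qed
  also have "(\<Sum>i\<in>{..<D}. 2 ^ s * (1 / 2 ^ s) ^ D * C') = real D * C' * (2 ^ s * (1 / 2 ^ s) ^ D)"
    by simp
  also have "measure_pmf.prob M {T. \<exists>y\<in>X. ?P y T} \<le> 2 ^ (c * D) * C ^ D * \<psi> * (2 ^ s * (1 / 2 ^ s) ^ D)"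
  proof -
    have k0: "(1 / 2 ^ b) * 2 ^ (c * D) * weight ?L (c * D) D y \<ge> 0" for y by (simp add: weight_nonneg)
    have "measure_pmf.prob M {T. \<exists>y\<in>X. ?P y T} \<le> (\<Sum>y\<in>X. (1 / 2 ^ b) * 2 ^ (c * D) * weight ?L (c * D) D y)"
    proof (rule order_trans[OF prob_ex_le[OF finite_X]], rule sum_mono)
      fix y assume "y \<in> X"
      have "measure_pmf.prob M {T. ?P y T} \<le> of_bool (admissible {y} {} 0) * ((1 / 2 ^ b) * 2 ^ (c * D) * weight ?L (c * D) D y)"
        by (rule prob_guarded_le[OF _ k0], rule order_trans[OF prob_reach_le[where K = "c * D"]]) (use D in auto)
      also have "\<dots> \<le> (1 / 2 ^ b) * 2 ^ (c * D) * weight ?L (c * D) D y"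
        using k0 by (intro mult_left_le_one_le) auto
      finally show "measure_pmf.prob M {T. ?P y T} \<le> (1 / 2 ^ b) * 2 ^ (c * D) * weight ?L (c * D) D y" .
    qed
    also have "\<dots> = (1 / 2 ^ b) * 2 ^ (c * D) * (\<Sum>y\<in>X. weight ?L (c * D) D y)"
      by (simp only: sum_distrib_left)
    also have "\<dots> \<le> (1 / 2 ^ b) * 2 ^ (c * D) * ((C / 2 ^ s) ^ D * real (card X))"
      by (intro mult_left_mono sum_weight_le[OF \<psi> C]) auto
    \<comment> \<open>The first root pays for its selection but for no equality: |X|/2^b is
      \<open>rate * real (card X)\<close> times 2^s, the origin of the exponent 1 in 1 - D.\<close>
    also have "\<dots> = 2 ^ (c * D) * C ^ D * (rate * real (card X)) * (2 ^ s * (1 / 2 ^ s) ^ D)"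
      by (simp add: rate_def power_divide field_simps)
    also have "\<dots> \<le> 2 ^ (c * D) * C ^ D * \<psi> * (2 ^ s * (1 / 2 ^ s) ^ D)"
      using C0 by (intro mult_right_mono mult_left_mono \<psi>) auto
    finally show ?thesis .
  qed
  finally show ?thesis by (simp add: algebra_simps)
qed

lemma card_small_sets_le: "card (small_sets L l) \<le> L * (l + 1) ^ L"
proof -
  have fin: "finite {S. S \<subseteq> {..l} \<and> card S = k}" for k
    by (rule finite_subset[of _ "Pow {..l}"]) auto
  have "card (small_sets L l) \<le> card (\<Union>k\<in>{..<L}. {S. S \<subseteq> {..l} \<and> card S = k})"
    by (rule card_mono) (auto simp: small_sets_def fin)
  also have "\<dots> \<le> (\<Sum>k\<in>{..<L}. card {S. S \<subseteq> {..l} \<and> card S = k})"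
    by (rule card_UN_le) simp
  also have "\<dots> \<le> (\<Sum>k\<in>{..<L}. (l + 1) ^ L)"
  proof (rule sum_mono)
    fix k assume k: "k \<in> {..<L}"
    have "card {S. S \<subseteq> {..l} \<and> card S = k} = (l + 1) choose k"
      by (subst n_subsets) auto
    also have "\<dots> \<le> (l + 1) ^ k"
      by (cases "k \<le> l + 1") (auto intro: binomial_le_pow simp: binomial_eq_0)
    also have "\<dots> \<le> (l + 1) ^ L" using k by (intro power_increasing) auto
    finally show "card {S. S \<subseteq> {..l} \<and> card S = k} \<le> (l + 1) ^ L" .
  qed
  finally show ?thesis by simp
qed

text \<open>Bounded set sizes make the number of dependency sets polynomial in \<open>l\<close>;
  replacing the exponent \<open>l - 1\<close> by \<open>l\<close> costs the division by
  \<open>\<psi>\<close>.\<close>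

lemma segment_const_le:
  assumes "0 < \<psi>" "\<psi> < 1"
  shows "segment_const L K \<psi> l \<le> (1 + real L * 3 ^ c / \<psi>) * (real (l + 1) ^ (K + L + 1) * \<psi> ^ l)"
proof -
  have "\<psi> * \<psi> ^ (l - 1) \<le> \<psi> ^ l"
    using assms by (cases l) auto
  then have p: "\<psi> ^ (l - 1) \<le> \<psi> ^ l / \<psi>" using assms by (simp add: field_simps)
  have cs: "real (card (small_sets L l)) \<le> real L * real (l + 1) ^ L"
    using card_small_sets_le[of L l] by (metis of_nat_le_iff of_nat_mult of_nat_power)
  have "segment_const L K \<psi> l
      \<le> real (l + 1) ^ K * (\<psi> ^ l + (real L * real (l + 1) ^ L) * real (l + 1) * 3 ^ c * (\<psi> ^ l / \<psi>))"
    unfolding segment_const_def using assms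
    by (intro mult_left_mono add_left_mono mult_mono cs p) auto
  also have "\<dots> \<le> real (l + 1) ^ K * (real (l + 1) ^ (L + 1) * \<psi> ^ l + (real L * real (l + 1) ^ L) * real (l + 1) * 3 ^ c * (\<psi> ^ l / \<psi>))"
    using assms by (intro mult_left_mono add_right_mono) (auto simp: mult_le_cancel_right1 one_le_power simp del: power_Suc)
  also have "\<dots> = (1 + real L * 3 ^ c / \<psi>) * (real (l + 1) ^ (K + L + 1) * \<psi> ^ l)"
    by (simp add: power_add algebra_simps add_divide_distrib)
  finally show ?thesis .
qed

end

text \<open>Ratio test: the quotients tend to \<open>\<psi>\<close>, hence eventually stay below the
  midpoint of \<open>\<psi>\<close> and 1.\<close>

lemma summable_power_mult:
  fixes \<psi> :: real
  assumes "0 < \<psi>" "\<psi> < 1"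
  shows "summable (\<lambda>l. real (l + k) ^ e * \<psi> ^ l)"
proof -
  have "(\<lambda>n. (real (Suc n + k) / real (n + k)) ^ e * \<psi>) \<longlonglongrightarrow> 1 ^ e * \<psi>"
    by (intro tendsto_intros) real_asymp
  then have "eventually (\<lambda>n. (real (Suc n + k) / real (n + k)) ^ e * \<psi> < (1 + \<psi>) / 2) sequentially"
    by (rule order_tendstoD) (use assms in simp)
  then obtain N where N: "\<And>n. n \<ge> N \<Longrightarrow> (real (Suc n + k) / real (n + k)) ^ e * \<psi> < (1 + \<psi>) / 2"
    unfolding eventually_sequentially by blast
  show ?thesis
  \<comment> \<open>Starting at \<open>Suc N\<close> keeps the denominator \<open>n + k\<close>
    positive even for \<open>k = 0\<close>.\<close>
  proof (rule summable_ratio_test[where c = "(1 + \<psi>) / 2" and N = "Suc N"])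
    show "(1 + \<psi>) / 2 < 1" using assms by simp
    fix n assume n: "n \<ge> Suc N"
    have pos: "real (n + k) > 0" using n by simp
    have "real (Suc n + k) ^ e * \<psi> ^ Suc n = ((real (Suc n + k) / real (n + k)) ^ e * \<psi>) * (real (n + k) ^ e * \<psi> ^ n)"
      using pos by (simp add: power_divide)
    also have "\<dots> \<le> (1 + \<psi>) / 2 * (real (n + k) ^ e * \<psi> ^ n)"
      using N[of n] n assms by (intro mult_right_mono) auto
    finally show "norm (real (Suc n + k) ^ e * \<psi> ^ Suc n) \<le> (1 + \<psi>) / 2 * norm (real (n + k) ^ e * \<psi> ^ n)"
      using assms by simp
  qed
qed

theorem theorem5:
  fixes c d :: nat and \<epsilon> :: real
  assumes "c \<ge> 1" and "\<epsilon> > 0"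
  shows "\<exists>C>0. \<forall>(s::nat) (u::nat) (r::nat) (X::nat set) (b::nat) (p::nat \<Rightarrow> nat) (v::nat \<Rightarrow> bool).
           real u powr (1 / real c) \<le> 2 ^ s \<longrightarrow>
           (c \<ge> 2 \<longrightarrow> 2 ^ s \<le> real u powr (1 / (real c - 1))) \<longrightarrow>
           X \<subseteq> {..<u} \<longrightarrow>
           inj_on p {..<b} \<longrightarrow> p ` {..<b} \<subseteq> {..<r} \<longrightarrow>
           real (card X) / 2 ^ b \<le> 2 ^ s / (1 + \<epsilon>) \<longrightarrow>
           measure_pmf.prob (random_mixed_tables s c d r)
               {T. remaining_bits_independent s c d r X b p v T}
             \<ge> 1 - C * (2 ^ s) powr (1 - real_of_int \<lfloor>real d / 2\<rfloor>)"
proof -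
  define D where "D = d div 2"
  define \<psi> where "\<psi> = 1 / (1 + \<epsilon>)"
  define L where "L = (D + 1) * (c + 1)"
  define h where "h k e l = real (l + k) ^ e * \<psi> ^ l" for k e l
  define C1 where "C1 = (1 + real L * 3 ^ c / \<psi>) * (\<Sum>l. h 1 (c * D + L + 1) l)"
  \<comment> \<open>Division by \<open>\<psi> ^ D\<close> compensates for the exponent
    \<open>l + 1 - D\<close> in place of \<open>l\<close>.\<close>
  define C2 where "C2 = (\<Sum>l. h 2 L l) / \<psi> ^ D"
  define C where "C = real D * C2 + 2 ^ (c * D) * C1 ^ D * \<psi> + 1"
  have \<psi>: "0 < \<psi>" "\<psi> < 1" using assms(2) by (simp_all add: \<psi>_def)
  have h0: "h k e l \<ge> 0" for k e l unfolding h_def using \<psi> by simp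
  have hsum: "summable (h k e)" for k e unfolding h_def by (rule summable_power_mult[OF \<psi>])
  have hle: "(\<Sum>l\<in>{..N}. h k e l) \<le> (\<Sum>l. h k e l)" for k e N
    by (rule sum_le_suminf[OF hsum]) (auto simp: h0)
  have "C1 \<ge> 0" "C2 \<ge> 0"
    unfolding C1_def C2_def using \<psi> by (auto intro!: mult_nonneg_nonneg divide_nonneg_nonneg suminf_nonneg hsum h0)
  then have C: "C > 0" unfolding C_def using \<psi> by (intro add_nonneg_pos add_nonneg_nonneg mult_nonneg_nonneg) auto
  have main: "measure_pmf.prob (random_mixed_tables s c d r) {T. remaining_bits_independent s c d r X b p v T}
      \<ge> 1 - C * (2 ^ s) powr (1 - real_of_int \<lfloor>real d / 2\<rfloor>)"
    if u: "real u powr (1 / real c) \<le> 2 ^ s" "X \<subseteq> {..<u}" and p: "inj_on p {..<b}" "p ` {..<b} \<subseteq> {..<r}"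
      and card: "real (card X) / 2 ^ b \<le> 2 ^ s / (1 + \<epsilon>)"
    for s u r b :: nat and X :: "nat set" and p :: "nat \<Rightarrow> nat" and v :: "nat \<Rightarrow> bool"
  proof -
    \<comment> \<open>Raising the lower bound on the alphabet size to the power \<open>c\<close>
      shows that every key below \<open>u\<close> is a vector of \<open>c\<close>
      characters.\<close>
    have "real u \<le> (2 ^ s) ^ c"
    proof (cases "u = 0")
      case False
      have "real u = (real u powr (1 / real c)) ^ c"
        using False assms(1) by (simp add: powr_realpow[symmetric] powr_powr)
      also have "\<dots> \<le> (2 ^ s) ^ c" by (rule power_mono[OF u(1)]) simp
      finally show ?thesis .
    qed simp
    then have "real u \<le> real ((2 ^ s) ^ c)" by simp
    then have "u \<le> (2 ^ s) ^ c" by (simp only: of_nat_le_iff)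
    then interpret mixed_exploration s c d r b X p v
      using u(2) p assms(1) by unfold_locales auto
    have rate: "rate * real (card X) \<le> \<psi>"
      using card unfolding rate_def \<psi>_def by (simp add: field_simps)
    have 1: "(\<Sum>l\<in>{..card X}. segment_const ((D + 1) * (c + 1)) (c * D) \<psi> l) \<le> C1"
    proof -
      have "(\<Sum>l\<in>{..card X}. segment_const L (c * D) \<psi> l)
          \<le> (\<Sum>l\<in>{..card X}. (1 + real L * 3 ^ c / \<psi>) * h 1 (c * D + L + 1) l)"
        unfolding h_def by (intro sum_mono segment_const_le \<psi>)
      also have "\<dots> \<le> C1"
        unfolding C1_def sum_distrib_left[symmetric] using \<psi> by (intro mult_left_mono hle) auto
      finally show ?thesis unfolding L_def .
    qed
    have 2: "(\<Sum>l\<in>{..card X}. real (l + 2) ^ ((D + 1) * (c + 1)) * \<psi> ^ (l + 1 - D)) \<le> C2"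
    proof -
      \<comment> \<open>Truncation is harmless: l+1-D+D is at least \<open>l\<close> in any case,
        and \<open>\<psi>\<close> is below 1.\<close>
      have "\<psi> ^ (l + 1 - D) \<le> \<psi> ^ l / \<psi> ^ D" for l
      proof -
        have "\<psi> ^ (l + 1 - D + D) \<le> \<psi> ^ l" using \<psi> by (intro power_decreasing) auto
        then show ?thesis using \<psi> by (simp add: power_add field_simps)
      qed
      then have "(\<Sum>l\<in>{..card X}. real (l + 2) ^ L * \<psi> ^ (l + 1 - D)) \<le> (\<Sum>l\<in>{..card X}. real (l + 2) ^ L * (\<psi> ^ l / \<psi> ^ D))"
        by (intro sum_mono mult_left_mono) auto
      also have "\<dots> = (\<Sum>l\<in>{..card X}. h 2 L l) / \<psi> ^ D" by (simp add: h_def sum_divide_distrib)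
      also have "\<dots> \<le> C2" unfolding C2_def using \<psi> by (intro divide_right_mono hle) auto
      finally show ?thesis unfolding L_def .
    qed
    have "2 * D \<le> d" by (simp add: D_def)
    from prob_remaining_bits_dependent_le[OF rate this 1 2]
    have "measure_pmf.prob M {T. \<not> remaining_bits_independent s c d r X b p v T}
        \<le> (real D * C2 + 2 ^ (c * D) * C1 ^ D * \<psi>) * (2 ^ s * (1 / 2 ^ s) ^ D)" .
    also have "\<dots> \<le> C * (2 ^ s * (1 / 2 ^ s) ^ D)"
      unfolding C_def by (intro mult_right_mono) auto
    also have "2 ^ s * (1 / 2 ^ s) ^ D = (2 ^ s) powr (1 - real_of_int \<lfloor>real d / 2\<rfloor>)"
    proof -
      have "\<lfloor>real d / 2\<rfloor> = int D"
        using floor_divide_of_nat_eq[of d 2, where 'a = real] by (simp add: D_def)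
      then show ?thesis by (simp add: powr_diff powr_realpow power_divide)
    qed
    finally have "measure_pmf.prob M {T. \<not> remaining_bits_independent s c d r X b p v T}
      \<le> C * (2 ^ s) powr (1 - real_of_int \<lfloor>real d / 2\<rfloor>)" .
    moreover have "measure_pmf.prob M {T. \<not> remaining_bits_independent s c d r X b p v T}
        = 1 - measure_pmf.prob M {T. remaining_bits_independent s c d r X b p v T}"
    proof -
      have "{T. \<not> remaining_bits_independent s c d r X b p v T}
          = space M - {T. remaining_bits_independent s c d r X b p v T}" by auto
      then show ?thesis
        using measure_pmf.prob_compl[of "{T. remaining_bits_independent s c d r X b p v T}" M] by simp
    qed
    ultimately show ?thesis by linarith
  qed
  show ?thesis
    by (intro exI[of _ C] conjI C allI impI main)
qed

end
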